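(* Suppose that $G^2$ and $A^\top A$ commute; that the eigenvalues $g_j^2$ of $G^2$ (in increasing order) grow polynomially in the sense that for some $C\ge1$ and every $J$ $$C^{-1}\le\frac1{J\,g_J^{-2}}\sum_{j\ge J}g_j^{-2}\le C;$$ and that the eigenvalues $a_j^2$ of $A^\top A$ in the same eigenbasis (same indexing) are non-increasing in $j$. Let $J$ be the smallest index such that $$J\,g_J^2\ge M\,\sigma^{-2}a_J^2 .$$ Then with $\mu=J/M$ the penalized MLE $\tilde f_\mu$ is nearly minimax over $\mathcal F_G(M)$ and the minimax risk is of order $\mathrm{tr}(F_\mu^{-1})\asymp M\,g_J^{-2}$. The prior $N(0,G_\mu^{-2})$ leads to posterior contraction of order $\mathrm{tr}(F_\mu^{-1})\asymp M\,g_J^{-2}$ as well.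
   Context: Linear Gaussian inverse problem: $Y=Af^*+\sigma\varepsilon$, $A$ a linear operator between (possibly infinite-dimensional) Hilbert spaces, $\varepsilon$ standard Gaussian noise with $\mathrm{Var}(\varepsilon)=I$, $\sigma>0$. $G^2$ is a positive self-adjoint operator with discrete spectrum on the source space, $M>0$, $\mathcal F_G(M)=\{f:\|Gf\|^2\le M\}$, $G_\mu^2=\mu G^2$, $F_\mu=\sigma^{-2}A^\top A+\mu G^2$, and $$\tilde f_\mu=\arg\min_f\{\sigma^{-2}\|Y-Af\|^2+\|G_\mu f\|^2\}=\sigma^{-2}F_\mu^{-1}A^\top Y .$$ For the prior $N(0,G_\mu^{-2})$ the posterior is $f\mid Y\sim N(\tilde f_\mu,F_\mu^{-1})$. The loss is $\|\hat f-f^*\|^2$. $a\asymp b$ means equality in order, i.e. up to fixed positive constants from above and below. Terminology. "Nearly minimax with minimax risk of order $R$" means that, with fixed positive constants $C_1,\dots,C_4$: $\sup_{f^*\in\mathcal F_G(M)}P(\|\tilde f_\mu-f^*\|^2>C_1R)\le e^{-C_2M\mu}$, while $\inf_{\hat f}\sup_{f^*\in\mathcal F_G(M)}P(\|\hat f-f^*\|^2>C_3R)\ge1-e^{-C_4M\mu}$, the infimum being over all estimators. "Posterior contraction of order $R$" means that, for $f^*\in\mathcal F_G(M)$, with high probability (up to terms exponentially small in $M\mu$) the posterior probability of $\{f:\|f-f^*\|^2>CR\}$ is exponentially small in $M\mu$, for a fixed constant $C$. *)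

theory Defs
  imports "HOL-Probability.Probability"
begin

section \<open>Densely defined operators on a real Hilbert space\<close>

text \<open>
  An operator is a domain together with a total function whose values off the domain are
  irrelevant.
\<close>

datatype 'a opr = Opr (op_dom: "'a set") (op_app: "'a \<Rightarrow> 'a")

definition densely_defined_linear :: "'a::real_inner opr \<Rightarrow> bool" where
  "densely_defined_linear T \<longleftrightarrow>
     subspace (op_dom T) \<and> closure (op_dom T) = UNIV \<and>
     (\<forall>x\<in>op_dom T. \<forall>y\<in>op_dom T. op_app T (x + y) = op_app T x + op_app T y) \<and>
     (\<forall>c. \<forall>x\<in>op_dom T. op_app T (c *\<^sub>R x) = c *\<^sub>R op_app T x)"

text \<open>
  The second conjunct says that the graph of \<open>T\<close> is the graph of its Hilbert space adjoint;
  symmetry alone would only give one direction.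
\<close>

definition self_adjoint :: "'a::real_inner opr \<Rightarrow> bool" where
  "self_adjoint T \<longleftrightarrow> densely_defined_linear T \<and>
     (\<forall>y z. (y \<in> op_dom T \<and> op_app T y = z) \<longleftrightarrow> (\<forall>x\<in>op_dom T. op_app T x \<bullet> y = x \<bullet> z))"

definition positive_self_adjoint :: "'a::real_inner opr \<Rightarrow> bool" where
  "positive_self_adjoint T \<longleftrightarrow> self_adjoint T \<and> (\<forall>x\<in>op_dom T. 0 \<le> op_app T x \<bullet> x)"

definition positive_sqrt :: "'a::real_inner opr \<Rightarrow> 'a opr \<Rightarrow> bool" where
  "positive_sqrt G S \<longleftrightarrow> positive_self_adjoint G \<and>
     op_dom S = {x \<in> op_dom G. op_app G x \<in> op_dom G} \<and>
     (\<forall>x\<in>op_dom S. op_app S x = op_app G (op_app G x))"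

text \<open>Only used for self-adjoint operators, whose spectrum is real.\<close>

definition op_spectrum :: "'a::real_inner opr \<Rightarrow> real set" where
  "op_spectrum T = {l. \<not> (\<exists>R. bounded_linear R \<and>
     (\<forall>x. R x \<in> op_dom T \<and> op_app T (R x) - l *\<^sub>R R x = x) \<and>
     (\<forall>x\<in>op_dom T. R (op_app T x - l *\<^sub>R x) = x))}"

definition discrete_spectrum :: "'a::real_inner opr \<Rightarrow> bool" where
  "discrete_spectrum T \<longleftrightarrow> (\<forall>l\<in>op_spectrum T.
     (\<exists>d>0. \<forall>k\<in>op_spectrum T. k \<noteq> l \<longrightarrow> d \<le> \<bar>k - l\<bar>) \<and>
     (\<exists>x\<in>op_dom T. x \<noteq> 0 \<and> op_app T x = l *\<^sub>R x) \<and>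
     (\<exists>B. finite B \<and> {x \<in> op_dom T. op_app T x = l *\<^sub>R x} \<subseteq> span B))"

text \<open>
  \<open>S\<close> commutes with the everywhere defined operator \<open>B\<close>: \<open>B S\<close> is contained in \<open>S B\<close>.
\<close>

definition commutes_with :: "'a::real_inner opr \<Rightarrow> ('a \<Rightarrow> 'a) \<Rightarrow> bool" where
  "commutes_with S B \<longleftrightarrow> (\<forall>x\<in>op_dom S. B x \<in> op_dom S \<and> op_app S (B x) = B (op_app S x))"

definition op_scale :: "real \<Rightarrow> 'a::real_inner opr \<Rightarrow> 'a opr" where
  "op_scale c T = Opr (op_dom T) (\<lambda>x. c *\<^sub>R op_app T x)"

definition op_inverse :: "'a opr \<Rightarrow> 'a \<Rightarrow> 'a" where
  "op_inverse T x = (THE y. y \<in> op_dom T \<and> op_app T y = x)"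

section \<open>Orthonormal bases\<close>

text \<open>
  Coordinates are numbered from \<open>1\<close>, since the index enters the formulas as a number.
  Both finite-dimensional and infinite-dimensional source spaces are allowed.
\<close>

definition coordinate_set :: "nat set \<Rightarrow> bool" where
  "coordinate_set I \<longleftrightarrow> I = {1..} \<or> (\<exists>p. I = {1..p})"

definition orthonormal_basis :: "nat set \<Rightarrow> (nat \<Rightarrow> 'a::real_inner) \<Rightarrow> bool" where
  "orthonormal_basis I e \<longleftrightarrow>
     (\<forall>i\<in>I. \<forall>j\<in>I. e i \<bullet> e j = (if i = j then 1 else 0)) \<and> closure (span (e ` I)) = UNIV"

definition op_trace :: "nat set \<Rightarrow> (nat \<Rightarrow> 'a::real_inner) \<Rightarrow> ('a \<Rightarrow> 'a) \<Rightarrow> real" where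
  "op_trace I e B = (\<Sum>\<^sub>\<infinity>j\<in>I. B (e j) \<bullet> e j)"

section \<open>Gaussian noise and Gaussian measures\<close>

text \<open>
  In infinite dimension standard Gaussian noise is not a random vector, but a random linear
  functional: \<open>W v\<close> is the real random variable written \<open>\<langle>\<epsilon>, v\<rangle>\<close>, and the coordinates in any
  orthonormal system are independent standard normal. In finite dimension this is the usual
  vector with distribution \<open>N(0, I)\<close>.
\<close>

definition standard_gaussian_noise ::
  "'w measure \<Rightarrow> ('b::real_inner \<Rightarrow> 'w \<Rightarrow> real) \<Rightarrow> bool" where
  "standard_gaussian_noise P W \<longleftrightarrow> prob_space P \<and>
     (\<forall>v. W v \<in> borel_measurable P) \<and>
     (\<forall>u v a b. AE w in P. W (a *\<^sub>R u + b *\<^sub>R v) w = a * W u w + b * W v w) \<and>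
     (\<forall>B. pairwise orthogonal B \<and> (\<forall>b\<in>B. norm b = 1) \<longrightarrow>
        prob_space.indep_vars P (\<lambda>_. borel) W B \<and>
        (\<forall>b\<in>B. distributed P lborel (W b) std_normal_density))"

text \<open>
  \<open>N(m, V)\<close>, with the degenerate directions treated separately because
  \<^const>\<open>normal_density\<close> does not describe a point mass when the standard deviation is \<open>0\<close>.
\<close>

definition gaussian_measure ::
  "'a::real_inner \<Rightarrow> ('a \<Rightarrow> 'a) \<Rightarrow> 'a measure \<Rightarrow> bool" where
  "gaussian_measure m V Q \<longleftrightarrow> prob_space Q \<and> sets Q = sets borel \<and>
     (\<forall>h. if V h \<bullet> h = 0 then (AE x in Q. x \<bullet> h = m \<bullet> h)
          else distributed Q lborel (\<lambda>x. x \<bullet> h) (normal_density (m \<bullet> h) (sqrt (V h \<bullet> h))))"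

section \<open>The inverse problem\<close>

text \<open>
  The observation \<open>Y = A f + \<sigma> \<epsilon>\<close> is likewise recorded through all the numbers \<open>\<langle>Y, v\<rangle>\<close>, so the
  data are functions \<open>'b \<Rightarrow> real\<close>. Estimators are the measurable functions of the data.
\<close>

definition observation ::
  "('a::real_inner \<Rightarrow> 'b::real_inner) \<Rightarrow> real \<Rightarrow> ('b \<Rightarrow> 'w \<Rightarrow> real) \<Rightarrow> 'a \<Rightarrow> 'w \<Rightarrow> 'b \<Rightarrow> real" where
  "observation A s W f w = (\<lambda>v. A f \<bullet> v + s * W v w)"

definition data_space :: "('b \<Rightarrow> real) measure" where
  "data_space = (\<Pi>\<^sub>M v\<in>UNIV. borel)"

definition estimators :: "(('b \<Rightarrow> real) \<Rightarrow> 'a::topological_space) set" where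
  "estimators = measurable data_space borel"

definition ellipsoid :: "'a::real_inner opr \<Rightarrow> real \<Rightarrow> 'a set" where
  "ellipsoid G M = {f \<in> op_dom G. (norm (op_app G f))\<^sup>2 \<le> M}"

text \<open>\<open>F\<^sub>\<mu> = \<sigma>\<^sup>-\<^sup>2 A\<^sup>T A + \<mu> G\<^sup>2\<close>, where \<open>S\<close> stands for \<open>G\<^sup>2\<close>.\<close>

definition F_op ::
  "('a::real_inner \<Rightarrow> 'b::real_inner) \<Rightarrow> 'a opr \<Rightarrow> real \<Rightarrow> real \<Rightarrow> 'a opr" where
  "F_op A S s mu = Opr (op_dom S) (\<lambda>x. (1 / s\<^sup>2) *\<^sub>R adjoint A (A x) + mu *\<^sub>R op_app S x)"

text \<open>
  The penalized maximum likelihood estimator \<open>\<sigma>\<^sup>-\<^sup>2 F\<^sub>\<mu>\<^sup>-\<^sup>1 A\<^sup>T Y\<close> as a function of the data \<open>y\<close>.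
  As \<open>Y\<close> is only a functional, the vector is given by its coordinates
  \<open>\<langle>\<sigma>\<^sup>-\<^sup>2 F\<^sub>\<mu>\<^sup>-\<^sup>1 A\<^sup>T Y, e\<^sub>j\<rangle> = \<sigma>\<^sup>-\<^sup>2 \<langle>Y, A F\<^sub>\<mu>\<^sup>-\<^sup>1 e\<^sub>j\<rangle>\<close>. For a vector \<open>Y\<close> of the target space it is
  the minimizer of the penalized least squares functional, see
  \<open>penalized_least_squares_minimizer\<close> below; for white noise in infinite dimension
  that functional is infinite, and the estimator is given by the closed form.
\<close>

definition penalized_mle ::
  "nat set \<Rightarrow> (nat \<Rightarrow> 'a::real_inner) \<Rightarrow> ('a \<Rightarrow> 'b::real_inner) \<Rightarrow> 'a opr \<Rightarrow> real \<Rightarrow> real \<Rightarrow>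
     ('b \<Rightarrow> real) \<Rightarrow> 'a" where
  "penalized_mle I e A S s mu y =
     (\<Sum>\<^sub>\<infinity>j\<in>I. ((1 / s\<^sup>2) * y (A (op_inverse (F_op A S s mu) (e j)))) *\<^sub>R e j)"

lemma penalized_least_squares_minimizer:
  fixes A :: "'a::real_inner \<Rightarrow> 'b::real_inner"
  assumes A: "bounded_linear A" and adj: "\<And>x y. A x \<bullet> y = x \<bullet> adjoint A y"
    and G: "positive_sqrt G S" and mu: "mu \<ge> 0"
    and x: "x \<in> op_dom S" "op_app (F_op A S s mu) x = (1 / s\<^sup>2) *\<^sub>R adjoint A Y"
    and f: "f \<in> op_dom G"
  shows "(1 / s\<^sup>2) * (norm (Y - A x))\<^sup>2 + mu * (norm (op_app G x))\<^sup>2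
       \<le> (1 / s\<^sup>2) * (norm (Y - A f))\<^sup>2 + mu * (norm (op_app G f))\<^sup>2"
proof -
  have sa: "self_adjoint G" using G by (auto simp: positive_sqrt_def positive_self_adjoint_def)
  have xG: "x \<in> op_dom G" "op_app G x \<in> op_dom G" "op_app S x = op_app G (op_app G x)"
    using G x(1) by (auto simp: positive_sqrt_def)
  have lin: "subspace (op_dom G)"
    "\<And>u v. u \<in> op_dom G \<Longrightarrow> v \<in> op_dom G \<Longrightarrow> op_app G (u + v) = op_app G u + op_app G v"
    using sa by (auto simp: self_adjoint_def densely_defined_linear_def)
  have sym: "op_app G u \<bullet> v = u \<bullet> op_app G v" if "u \<in> op_dom G" "v \<in> op_dom G" for u v
    using sa that unfolding self_adjoint_def by blast
  define h where "h = f - x"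
  have h: "h \<in> op_dom G" "f = x + h"
    using lin(1) f xG(1) by (auto simp: h_def subspace_diff)
  have Gf: "op_app G f = op_app G x + op_app G h" using lin(2) h xG(1) by simp
  have Af: "A f = A x + A h" using h(2) A by (simp add: linear_simps)
  have eq: "(1 / s\<^sup>2) * (A h \<bullet> A x) + mu * (op_app G h \<bullet> op_app G x) = (1 / s\<^sup>2) * (A h \<bullet> Y)"
  proof -
    have "h \<bullet> op_app (F_op A S s mu) x = h \<bullet> ((1 / s\<^sup>2) *\<^sub>R adjoint A Y)" using x(2) by simp
    moreover have "op_app G h \<bullet> op_app G x = h \<bullet> op_app S x"
      using sym[OF h(1) xG(2)] xG(3) by simp
    ultimately show ?thesis
      by (simp add: F_op_def inner_add_right adj)
  qed
  have "(1 / s\<^sup>2) * (norm (Y - A f))\<^sup>2 + mu * (norm (op_app G f))\<^sup>2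
      = (1 / s\<^sup>2) * (norm (Y - A x))\<^sup>2 + mu * (norm (op_app G x))\<^sup>2
        + ((1 / s\<^sup>2) * (norm (A h))\<^sup>2 + mu * (norm (op_app G h))\<^sup>2)
        + 2 * ((1 / s\<^sup>2) * (A h \<bullet> A x) + mu * (op_app G h \<bullet> op_app G x) - (1 / s\<^sup>2) * (A h \<bullet> Y))"
    unfolding Af Gf power2_norm_eq_inner
    by (simp add: algebra_simps inner_commute)
  moreover have "0 \<le> (1 / s\<^sup>2) * (norm (A h))\<^sup>2 + mu * (norm (op_app G h))\<^sup>2"
    using mu by simp
  ultimately show ?thesis using eq by simp
qed

section \<open>Minimaxity and posterior contraction\<close>

definition loss_prob ::
  "'w measure \<Rightarrow> ('b::real_inner \<Rightarrow> 'w \<Rightarrow> real) \<Rightarrow> ('a::real_inner \<Rightarrow> 'b) \<Rightarrow> real \<Rightarrow>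
     (('b \<Rightarrow> real) \<Rightarrow> 'a) \<Rightarrow> 'a \<Rightarrow> real \<Rightarrow> real" where
  "loss_prob P W A s fhat f r =
     measure P {w \<in> space P. (norm (fhat (observation A s W f w) - f))\<^sup>2 > r}"

text \<open>\<open>R\<close> is the order of the risk; \<open>n\<close>, which is \<open>M \<mu>\<close>, governs the exponential terms.\<close>

definition nearly_minimax ::
  "real \<Rightarrow> real \<Rightarrow> real \<Rightarrow> real \<Rightarrow> 'w measure \<Rightarrow> ('b::real_inner \<Rightarrow> 'w \<Rightarrow> real) \<Rightarrow>
     ('a::real_inner \<Rightarrow> 'b) \<Rightarrow> real \<Rightarrow> 'a set \<Rightarrow> (('b \<Rightarrow> real) \<Rightarrow> 'a) \<Rightarrow> real \<Rightarrow> real \<Rightarrow> bool" where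
  "nearly_minimax C1 C2 C3 C4 P W A s \<F> ftilde R n \<longleftrightarrow>
     ftilde \<in> estimators \<and>
     (SUP f\<in>\<F>. loss_prob P W A s ftilde f (C1 * R)) \<le> exp (- C2 * n) \<and>
     (INF fhat\<in>estimators. SUP f\<in>\<F>. loss_prob P W A s fhat f (C3 * R)) \<ge> 1 - exp (- C4 * n)"

text \<open>
  The kernel \<open>\<kappa>\<close> is a regular conditional distribution of \<open>f\<close> given the data, when \<open>f\<close> has
  distribution \<open>Q\<close> independently of the noise.
\<close>

definition is_posterior ::
  "'a::real_inner measure \<Rightarrow> 'w measure \<Rightarrow> ('b::real_inner \<Rightarrow> 'w \<Rightarrow> real) \<Rightarrow> ('a \<Rightarrow> 'b) \<Rightarrow> real \<Rightarrow>
     (('b \<Rightarrow> real) \<Rightarrow> 'a measure) \<Rightarrow> bool" where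
  "is_posterior Q P W A s \<kappa> \<longleftrightarrow> \<kappa> \<in> measurable data_space (prob_algebra borel) \<and>
     (\<forall>B\<in>sets borel. \<forall>D\<in>sets data_space.
        emeasure (Q \<Otimes>\<^sub>M P) {(f, w) \<in> space (Q \<Otimes>\<^sub>M P). f \<in> B \<and> observation A s W f w \<in> D} =
        (\<integral>\<^sup>+ (f, w). indicator D (observation A s W f w) * emeasure (\<kappa> (observation A s W f w)) B
           \<partial>(Q \<Otimes>\<^sub>M P)))"

definition posterior_contraction ::
  "real \<Rightarrow> real \<Rightarrow> real \<Rightarrow> 'w measure \<Rightarrow> ('b::real_inner \<Rightarrow> 'w \<Rightarrow> real) \<Rightarrow>
     ('a::real_inner \<Rightarrow> 'b) \<Rightarrow> real \<Rightarrow> 'a set \<Rightarrow> (('b \<Rightarrow> real) \<Rightarrow> 'a measure) \<Rightarrow> real \<Rightarrow> real \<Rightarrow> bool"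
  where
  "posterior_contraction K1 K2 K3 P W A s \<F> \<kappa> R n \<longleftrightarrow> (\<forall>fstar\<in>\<F>.
     measure P {w \<in> space P.
       measure (\<kappa> (observation A s W fstar w)) {f. (norm (f - fstar))\<^sup>2 > K1 * R} > exp (- K2 * n)}
     \<le> exp (- K3 * n))"

section \<open>Assumptions\<close>

text \<open>
  Convergence of the tail sum need not be assumed separately: a divergent \<open>infsum\<close> is \<open>0\<close>,
  which the lower bound excludes. The condition bounds \<open>g\<^sub>J\<^sup>2 / g\<^bsub>J-1\<^esub>\<^sup>2\<close> in terms of \<open>C\<close> only for
  \<open>J\<close> large compared with \<open>C\<close>; therefore the constants in the theorem depend on the sequence \<open>g\<close>
  and not just on \<open>C\<close> (take \<open>g\<^sub>1 = 1\<close>, \<open>g\<^sub>j = K j\<close> for \<open>j \<ge> 2\<close>, and \<open>K\<close> large).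
\<close>

definition polynomial_growth :: "nat set \<Rightarrow> (nat \<Rightarrow> real) \<Rightarrow> real \<Rightarrow> bool" where
  "polynomial_growth I g C \<longleftrightarrow> (\<forall>J\<in>I.
     1 / C \<le> 1 / (real J * (1 / (g J)\<^sup>2)) * (\<Sum>\<^sub>\<infinity>j\<in>{j\<in>I. J \<le> j}. 1 / (g j)\<^sup>2) \<and>
     1 / (real J * (1 / (g J)\<^sup>2)) * (\<Sum>\<^sub>\<infinity>j\<in>{j\<in>I. J \<le> j}. 1 / (g j)\<^sup>2) \<le> C)"

text \<open>
  \<open>S\<close> is \<open>G\<^sup>2\<close>, with eigenvalues \<open>g\<^sub>j\<^sup>2\<close>; \<open>A\<^sup>T A\<close> has eigenvalues \<open>a\<^sub>j\<^sup>2\<close> in the same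
  eigenbasis \<open>e\<close>.
\<close>

definition operator_assumptions ::
  "nat set \<Rightarrow> (nat \<Rightarrow> real) \<Rightarrow> (nat \<Rightarrow> real) \<Rightarrow> (nat \<Rightarrow> 'a::real_inner) \<Rightarrow> 'a opr \<Rightarrow> 'a opr \<Rightarrow>
     ('a \<Rightarrow> 'b::real_inner) \<Rightarrow> bool" where
  "operator_assumptions I g a e G S A \<longleftrightarrow>
     positive_self_adjoint S \<and> discrete_spectrum S \<and> positive_sqrt G S \<and>
     bounded_linear A \<and> commutes_with S (\<lambda>x. adjoint A (A x)) \<and>
     orthonormal_basis I e \<and>
     (\<forall>j\<in>I. e j \<in> op_dom S \<and> op_app S (e j) = (g j)\<^sup>2 *\<^sub>R e j) \<and>
     (\<forall>j\<in>I. adjoint A (A (e j)) = (a j)\<^sup>2 *\<^sub>R e j) \<and>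
     (\<forall>i\<in>I. \<forall>j\<in>I. i \<le> j \<longrightarrow> (a j)\<^sup>2 \<le> (a i)\<^sup>2)"

definition smallest_index ::
  "nat set \<Rightarrow> (nat \<Rightarrow> real) \<Rightarrow> (nat \<Rightarrow> real) \<Rightarrow> real \<Rightarrow> real \<Rightarrow> nat \<Rightarrow> bool" where
  "smallest_index I g a M s J \<longleftrightarrow>
     J \<in> I \<and> real J * (g J)\<^sup>2 \<ge> M * (1 / s\<^sup>2) * (a J)\<^sup>2 \<and>
     (\<forall>j\<in>I. j < J \<longrightarrow> \<not> real j * (g j)\<^sup>2 \<ge> M * (1 / s\<^sup>2) * (a j)\<^sup>2)"

end

theory Submission
  imports Defs
begin

text \<open>In the eigenbasis \<open>e\<close> all operators are diagonal, and \<open>F\<^sub>\<mu>\<close> has the eigenvalues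
  \<open>lam j = a\<^sub>j\<^sup>2 / \<sigma>\<^sup>2 + \<mu> g\<^sub>j\<^sup>2\<close>. Up to constants, the choice of \<open>J\<close> makes the prior term dominate for
  \<open>j \<ge> J\<close> and the data term for \<open>j < J\<close>. Polynomial growth says that the tail sums of \<open>1 / g\<^sub>j\<^sup>2\<close> are of order
  \<open>J / g\<^sub>J\<^sup>2\<close>, and it also keeps the ratio of \<open>g\<^sub>J\<close> to \<open>g\<^bsub>J-1\<^esub>\<close> bounded.
  Hence the trace of \<open>F\<^sub>\<mu>\<^sup>-\<^sup>1\<close> is of order \<open>rate = M / g\<^sub>J\<^sup>2\<close>, every \<open>1 / lam j\<close> is at most of order \<open>rate / J\<close> (\<open>inverse_lam_le\<close>), and the
  squared bias over the ellipsoid is at most of order \<open>rate\<close> (\<open>bias_factor_le\<close>).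

  Upper bound. The coordinates of the estimation error are a bias plus independent Gaussians of
  variance at most \<open>1 / lam j\<close>. Since no single variance exceeds \<open>rate / J\<close> by more than a constant,
  the exponential moment of their energy at the level \<open>J / rate\<close> is at most \<open>exp (c J)\<close>, and the
  Chernoff bound gives an error probability \<open>exp (- J)\<close> above a multiple of \<open>rate\<close>.

  Lower bound. A block of order \<open>J\<close> indices above \<open>J\<close> has comparable \<open>g\<close> (\<open>slow_variation\<close>) and a
  signal-to-noise ratio below a constant. On the vertices of a cube in this block, with random signs,
  the Cameron-Martin formula writes the law of the data under each vertex as a density with respect to
  pure noise, and these densities are products over the coordinates. Averaged over the signs, the
  probability that an estimator gets all but a small fraction of the signs right is therefore at most
  a product of factors below \<open>1\<close> (\<open>hard_vertex\<close>), and a fraction of wrong signs costs a multiple of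
  \<open>rate\<close>.

  Posterior. Under the joint law of parameter and data, the residuals \<open>f\<^sub>j - \<langle>f\<^sub>\<mu>, e\<^sub>j\<rangle>\<close>, where \<open>f\<^sub>\<mu>\<close>
  is the penalized estimator, are independent Gaussians of variance \<open>1 / lam j\<close>, and they are
  independent of the data (\<open>joint_char\<close>).
  So any regular conditional distribution gives them, for almost all data, the same exponential moment
  as before, and its mass far from the estimator is at most \<open>exp (- J)\<close>. The exceptional data are a
  null set of their marginal law, whereas the true parameter is a fixed element of the ellipsoid. The
  Cameron-Martin formula again makes the laws of the data under all parameters equivalent, and so
  absolutely continuous with respect to the marginal law.

  Both the independence and the Cameron-Martin formula are statements about the law of a process
  indexed by the whole target space. They are reduced to one-dimensional computations by the fact
  that finite-dimensional laws are determined by their characteristic functions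
  (\<open>charfun_determines_process_law\<close>), which follows from Levy's theorem on the line.\<close>

section \<open>Laws determined by characteristic functions\<close>

lemma integrable_iexp_finite:
  assumes "finite_measure M" "X \<in> borel_measurable M"
  shows "integrable M (\<lambda>w. iexp (X w))"
proof -
  interpret finite_measure M by fact
  show ?thesis using assms(2)
    by (intro integrable_const_bound[where B=1]) auto
qed

text \<open>The characteristic function at \<open>0\<close> is the total mass, so both measures may be normalized by the
  same constant and compared by Levy's theorem. Finite instead of probability measures are needed
  because the induction below restricts measures to events.\<close>
lemma finite_measure_charfun_eq_imp_measure_eq:
  assumes fin: "finite_measure M1" "finite_measure M2"
    and meas: "X1 \<in> borel_measurable M1" "X2 \<in> borel_measurable M2"
    and eq: "\<And>t. (CLINT w|M1. iexp (t * X1 w)) = (CLINT w|M2. iexp (t * X2 w))"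
    and E: "E \<in> sets borel"
  shows "measure M1 {w \<in> space M1. X1 w \<in> E} = measure M2 {w \<in> space M2. X2 w \<in> E}"
proof -
  interpret M1: finite_measure M1 by fact
  interpret M2: finite_measure M2 by fact
  note meas[measurable] E[measurable]
  define m where "m = measure M1 (space M1)"
  have m2: "m = measure M2 (space M2)"
    using eq[of 0] by (simp add: m_def)
  show ?thesis
  proof (cases "m = 0")
    case True
    have "measure M1 {w \<in> space M1. X1 w \<in> E} \<le> 0"
      using True M1.finite_measure_mono[of "{w \<in> space M1. X1 w \<in> E}" "space M1"]
      by (auto simp: m_def)
    moreover have "measure M2 {w \<in> space M2. X2 w \<in> E} \<le> 0"
      using True M2.finite_measure_mono[of "{w \<in> space M2. X2 w \<in> E}" "space M2"]
      by (auto simp: m2)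
    ultimately show ?thesis by (metis antisym measure_nonneg)
  next
    case False
    hence m: "m > 0" by (simp add: m_def zero_less_measure_iff)
    have law: "real_distribution N \<and> (\<forall>t. char N t = (1 / m) *\<^sub>R (CLINT w|M. iexp (t * X w))) \<and>
        emeasure N E = ennreal (1 / m * measure M {w \<in> space M. X w \<in> E})"
      if M: "finite_measure M" and [measurable]: "X \<in> borel_measurable M"
        and tot: "measure M (space M) = m" and N: "N = density (distr M borel X) (\<lambda>_. ennreal (1 / m))"
      for M :: "'x measure" and X N
    proof -
      interpret finite_measure M by fact
      have em: "emeasure N B = ennreal (1 / m * measure M {w \<in> space M. X w \<in> B})" if "B \<in> sets borel" for B
      proof -
        have "X -` B \<inter> space M = {w \<in> space M. X w \<in> B}" by auto
        then show ?thesis using that m unfolding N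
          by (simp add: emeasure_density emeasure_distr emeasure_eq_measure ennreal_mult'[symmetric]
              nn_integral_cmult_indicator)
      qed
      have "real_distribution N"
      proof (intro real_distribution.intro real_distribution_axioms.intro prob_spaceI)
        show "emeasure N (space N) = 1" using em[of UNIV] m by (simp add: N tot)
      qed (simp add: N)
      moreover have "char N t = (1 / m) *\<^sub>R (CLINT w|M. iexp (t * X w))" for t
        unfolding char_def N using m by (subst integral_density) (auto simp: integral_distr)
      ultimately show ?thesis using em[OF E] by simp
    qed
    note l1 = law[OF fin(1) meas(1) m_def[symmetric] refl] and l2 = law[OF fin(2) meas(2) m2[symmetric] refl]
    have "density (distr M1 borel X1) (\<lambda>_. ennreal (1 / m)) = density (distr M2 borel X2) (\<lambda>_. ennreal (1 / m))"
      using l1 l2 eq by (intro Levy_uniqueness ext) auto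
    hence "ennreal (1 / m * measure M1 {w \<in> space M1. X1 w \<in> E}) =
       ennreal (1 / m * measure M2 {w \<in> space M2. X2 w \<in> E})"
      using l1 l2 by simp
    thus ?thesis using m by (simp add: ennreal_inj)
  qed
qed

lemma finite_measure_density_bounded:
  assumes "finite_measure M" "Z \<in> borel_measurable M" and Zb: "\<And>w. 0 \<le> Z w \<and> Z w \<le> (K::real)"
  shows "finite_measure (density M (\<lambda>w. ennreal (Z w)))"
proof -
  interpret finite_measure M by fact
  note assms(2)[measurable]
  have "integrable M Z"
    using Zb by (intro integrable_const_bound[where B=K]) auto
  thus ?thesis
    using Zb by (intro finite_measureI)
      (simp add: emeasure_density nn_integral_eq_integral cong: nn_integral_cong)
qed

text \<open>A bounded weight turns the measure into another finite one. The weight will be a function of the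
  other variables, so that one variable at a time can be passed from frequencies to events.\<close>
lemma weighted_law_unique:
  assumes fin: "finite_measure M1" "finite_measure M2"
    and meas: "X1 \<in> borel_measurable M1" "X2 \<in> borel_measurable M2"
    and Z: "Z1 \<in> borel_measurable M1" "Z2 \<in> borel_measurable M2"
    and Zb: "\<And>w. 0 \<le> Z1 w \<and> Z1 w \<le> K" "\<And>w. 0 \<le> Z2 w \<and> Z2 w \<le> K"
    and eq: "\<And>t. (CLINT w|M1. Z1 w *\<^sub>R iexp (t * X1 w)) = (CLINT w|M2. Z2 w *\<^sub>R iexp (t * X2 w))"
    and E: "E \<in> sets borel"
  shows "(LINT w|M1. indicator E (X1 w) * Z1 w) = (LINT w|M2. indicator E (X2 w) * Z2 w)"
proof -
  have main: "finite_measure (density M (\<lambda>w. ennreal (Z w))) \<and>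
     (\<forall>t. (CLINT w|density M (\<lambda>w. ennreal (Z w)). iexp (t * X w)) = (CLINT w|M. Z w *\<^sub>R iexp (t * X w))) \<and>
     measure (density M (\<lambda>w. ennreal (Z w))) {w \<in> space M. X w \<in> E} = (LINT w|M. indicator E (X w) * Z w)"
    if "finite_measure M" and [measurable]: "X \<in> borel_measurable M" "Z \<in> borel_measurable M"
      and Zb: "\<And>w. 0 \<le> Z w \<and> Z w \<le> K" for M :: "'x measure" and X Z
  proof -
    interpret finite_measure M by fact
    note E[measurable]
    have a: "finite_measure (density M (\<lambda>w. ennreal (Z w)))"
      by (rule finite_measure_density_bounded[OF that(1,3) Zb])
    interpret D: finite_measure "density M (\<lambda>w. ennreal (Z w))" by (rule a)
    have "measure (density M (\<lambda>w. ennreal (Z w))) {w \<in> space M. X w \<in> E} =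
       integral\<^sup>L (density M (\<lambda>w. ennreal (Z w))) (indicator {w \<in> space M. X w \<in> E})"
      by (simp add: Int_absorb1 subset_eq)
    also have "\<dots> = (LINT w|M. Z w *\<^sub>R indicator {w \<in> space M. X w \<in> E} w)"
      using Zb by (subst integral_density) auto
    also have "\<dots> = (LINT w|M. indicator E (X w) * Z w)"
      by (intro Bochner_Integration.integral_cong) (auto simp: indicator_def)
    finally have c: "measure (density M (\<lambda>w. ennreal (Z w))) {w \<in> space M. X w \<in> E} = \<dots>" .
    have b: "(CLINT w|density M (\<lambda>w. ennreal (Z w)). iexp (t * X w)) = (CLINT w|M. Z w *\<^sub>R iexp (t * X w))" for t
      using Zb by (subst integral_density) auto
    show ?thesis using a b c by blast
  qed
  note m1 = main[OF fin(1) meas(1) Z(1) Zb(1)] and m2 = main[OF fin(2) meas(2) Z(2) Zb(2)]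
  have "measure (density M1 (\<lambda>w. ennreal (Z1 w))) {w \<in> space (density M1 (\<lambda>w. ennreal (Z1 w))). X1 w \<in> E} =
     measure (density M2 (\<lambda>w. ennreal (Z2 w))) {w \<in> space (density M2 (\<lambda>w. ennreal (Z2 w))). X2 w \<in> E}"
    using m1 m2 eq meas E by (intro finite_measure_charfun_eq_imp_measure_eq) auto
  thus ?thesis using m1 m2 by simp
qed

text \<open>The weights \<open>1 + cos S\<close> and \<open>1 + sin S\<close> are nonnegative, hence densities, and by Euler's formulas
  the characteristic functions that they produce are combinations of unweighted joint ones.\<close>
lemma trig_weight_integrals:
  assumes M: "finite_measure M" and meas: "X \<in> borel_measurable M" "S \<in> borel_measurable M"
  shows "(CLINT w|M. (1 + cos (S w)) *\<^sub>R iexp (X w)) =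
      (CLINT w|M. iexp (X w)) + (1/2) * (CLINT w|M. iexp (X w + S w)) + (1/2) * (CLINT w|M. iexp (X w - S w))"
    and "(CLINT w|M. (1 + sin (S w)) *\<^sub>R iexp (X w)) =
      (CLINT w|M. iexp (X w)) + (- \<i> / 2) * (CLINT w|M. iexp (X w + S w)) + (\<i> / 2) * (CLINT w|M. iexp (X w - S w))"
proof -
  note meas[measurable]
  have mult: "iexp (x + y) = iexp x * iexp y" "iexp (x - y) = iexp x * iexp (- y)" for x y :: real
    by (simp_all add: exp_add[symmetric] algebra_simps)
  have c: "(1 + cos y) *\<^sub>R iexp x = iexp x + (1/2) * iexp (x + y) + (1/2) * iexp (x - y)" for x y :: real
  proof -
    have "complex_of_real (1 + cos y) = 1 + (1/2) * (iexp y + iexp (- y))"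
      by (simp add: complex_eq_iff Re_exp Im_exp)
    thus ?thesis unfolding mult scaleR_conv_of_real by (simp only:) (simp add: algebra_simps)
  qed
  have s: "(1 + sin y) *\<^sub>R iexp x = iexp x + (- \<i> / 2) * iexp (x + y) + (\<i>/2) * iexp (x - y)" for x y :: real
  proof -
    have "complex_of_real (1 + sin y) = 1 + ((- \<i> / 2) * iexp y + (\<i>/2) * iexp (- y))"
      by (simp add: complex_eq_iff Re_exp Im_exp)
    thus ?thesis unfolding mult scaleR_conv_of_real by (simp only:) (simp add: algebra_simps)
  qed
  have i: "integrable M (\<lambda>w. iexp (X w))" "integrable M (\<lambda>w. iexp (X w + S w))" "integrable M (\<lambda>w. iexp (X w - S w))"
    by (intro integrable_iexp_finite[OF M]; measurable)+
  have lin: "(CLINT w|M. iexp (X w) + a * iexp (X w + S w) + b * iexp (X w - S w)) =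
      (CLINT w|M. iexp (X w)) + a * (CLINT w|M. iexp (X w + S w)) + b * (CLINT w|M. iexp (X w - S w))" for a b
    by (simp only: i Bochner_Integration.integral_add Bochner_Integration.integrable_add
        integrable_mult_right integral_mult_right_zero)
  show "(CLINT w|M. (1 + cos (S w)) *\<^sub>R iexp (X w)) =
      (CLINT w|M. iexp (X w)) + (1/2) * (CLINT w|M. iexp (X w + S w)) + (1/2) * (CLINT w|M. iexp (X w - S w))"
    "(CLINT w|M. (1 + sin (S w)) *\<^sub>R iexp (X w)) =
      (CLINT w|M. iexp (X w)) + (- \<i> / 2) * (CLINT w|M. iexp (X w + S w)) + (\<i> / 2) * (CLINT w|M. iexp (X w - S w))"
    unfolding c s by (rule lin)+
qed

text \<open>Induction on the number of variables. With trigonometric weights in the remaining variables, the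
  one-dimensional statement turns the condition on \<open>X k\<close> from a frequency into an event; what is left
  is the joint characteristic function of the remaining variables under the restricted measures.\<close>
lemma charfun_determines_boxes:
  assumes "finite F"
    and "finite_measure M1" "finite_measure M2"
    and "\<And>j. j \<in> F \<Longrightarrow> X1 j \<in> borel_measurable M1" "\<And>j. j \<in> F \<Longrightarrow> X2 j \<in> borel_measurable M2"
    and "\<And>t. (CLINT w|M1. iexp (\<Sum>j\<in>F. t j * X1 j w)) = (CLINT w|M2. iexp (\<Sum>j\<in>F. t j * X2 j w))"
    and "\<And>j. j \<in> F \<Longrightarrow> E j \<in> sets borel"
  shows "measure M1 {w \<in> space M1. \<forall>j\<in>F. X1 j w \<in> E j} = measure M2 {w \<in> space M2. \<forall>j\<in>F. X2 j w \<in> E j}"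
  using assms
proof (induction F arbitrary: M1 M2 rule: finite_induct)
  case empty
  from empty(5) have "measure M1 (space M1) = measure M2 (space M2)" by simp
  thus ?case by simp
next
  case (insert k F)
  note E = insert.prems(6)
  have X: "X1 k \<in> borel_measurable M1" "X2 k \<in> borel_measurable M2" using insert.prems by auto
  define S1 where "S1 t w = (\<Sum>j\<in>F. t j * X1 j w)" for t w
  define S2 where "S2 t w = (\<Sum>j\<in>F. t j * X2 j w)" for t w
  have S: "S1 t \<in> borel_measurable M1" "S2 t \<in> borel_measurable M2" for t
    unfolding S1_def S2_def using insert.prems by (auto intro!: borel_measurable_sum borel_measurable_times)
  have char: "(CLINT w|M1. iexp (s * X1 k w + S1 t w)) = (CLINT w|M2. iexp (s * X2 k w + S2 t w))" for s t
  proof -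
    have "(\<Sum>j\<in>F. (t(k:=s)) j * x j) = (\<Sum>j\<in>F. t j * x j)" for x :: "'a \<Rightarrow> real"
      using insert.hyps by (intro sum.cong) auto
    hence "(\<Sum>j\<in>insert k F. (t(k:=s)) j * x j) = s * x k + (\<Sum>j\<in>F. t j * x j)" for x :: "'a \<Rightarrow> real"
      using insert.hyps by simp
    thus ?thesis
      using insert.prems(5)[of "t(k:=s)"] by (simp add: S1_def S2_def)
  qed
  have char0: "(CLINT w|M1. iexp (s * X1 k w)) = (CLINT w|M2. iexp (s * X2 k w))" for s
    using char[of s "\<lambda>_. 0"] by (simp add: S1_def S2_def)
  have charm: "(CLINT w|M1. iexp (s * X1 k w - S1 t w)) = (CLINT w|M2. iexp (s * X2 k w - S2 t w))" for s t
    using char[of s "\<lambda>j. - t j"] by (simp add: S1_def S2_def sum_negf)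
  \<comment> \<open>Restricting both measures to \<open>X k \<in> E k\<close> keeps the characteristic functions of the
    remaining variables equal.\<close>
  define I1 where "I1 w = (indicator (E k) (X1 k w) :: real)" for w
  define I2 where "I2 w = (indicator (E k) (X2 k w) :: real)" for w
  have weight: "(LINT w|M1. I1 w * (1 + cos (S1 t w))) = (LINT w|M2. I2 w * (1 + cos (S2 t w)))"
    "(LINT w|M1. I1 w * (1 + sin (S1 t w))) = (LINT w|M2. I2 w * (1 + sin (S2 t w)))"
    "(LINT w|M1. I1 w * 1) = (LINT w|M2. I2 w * 1)" for t
  proof -
    have b: "0 \<le> 1 + cos x \<and> 1 + cos x \<le> 2" "0 \<le> 1 + sin x \<and> 1 + sin x \<le> 2" for x :: real
      using cos_ge_minus_one[of x] cos_le_one[of x] sin_ge_minus_one[of x] sin_le_one[of x] by linarith+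
    have m: "(\<lambda>w. s * X1 k w) \<in> borel_measurable M1" "(\<lambda>w. s * X2 k w) \<in> borel_measurable M2" for s
      using X by auto
    show "(LINT w|M1. I1 w * (1 + cos (S1 t w))) = (LINT w|M2. I2 w * (1 + cos (S2 t w)))"
      unfolding I1_def I2_def
    proof (rule weighted_law_unique[OF insert.prems(1,2), where K=2])
      show "(CLINT w|M1. (1 + cos (S1 t w)) *\<^sub>R iexp (s * X1 k w)) =
          (CLINT w|M2. (1 + cos (S2 t w)) *\<^sub>R iexp (s * X2 k w))" for s
        by (simp only: trig_weight_integrals(1)[OF insert.prems(1) m(1) S(1)]
          trig_weight_integrals(1)[OF insert.prems(2) m(2) S(2)] char char0 charm)
    qed (use S X E b in auto)
    show "(LINT w|M1. I1 w * (1 + sin (S1 t w))) = (LINT w|M2. I2 w * (1 + sin (S2 t w)))"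
      unfolding I1_def I2_def
    proof (rule weighted_law_unique[OF insert.prems(1,2), where K=2])
      show "(CLINT w|M1. (1 + sin (S1 t w)) *\<^sub>R iexp (s * X1 k w)) =
          (CLINT w|M2. (1 + sin (S2 t w)) *\<^sub>R iexp (s * X2 k w))" for s
        by (simp only: trig_weight_integrals(2)[OF insert.prems(1) m(1) S(1)]
          trig_weight_integrals(2)[OF insert.prems(2) m(2) S(2)] char char0 charm)
    qed (use S X E b in auto)
    show "(LINT w|M1. I1 w * 1) = (LINT w|M2. I2 w * 1)"
      unfolding I1_def I2_def using X E
      by (intro weighted_law_unique[OF insert.prems(1,2), where K=1])
        (simp_all only: scaleR_one char0, auto)
  qed
  have restricted: "finite_measure (density M (\<lambda>w. ennreal (indicator (E k) (Z k w)))) \<and>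
      (CLINT w|density M (\<lambda>w. ennreal (indicator (E k) (Z k w))). iexp (T w)) =
        complex_of_real ((LINT w|M. indicator (E k) (Z k w) * (1 + cos (T w))) - (LINT w|M. indicator (E k) (Z k w) * 1)) +
        \<i> * complex_of_real ((LINT w|M. indicator (E k) (Z k w) * (1 + sin (T w))) - (LINT w|M. indicator (E k) (Z k w) * 1)) \<and>
      measure (density M (\<lambda>w. ennreal (indicator (E k) (Z k w)))) {w \<in> space M. \<forall>j\<in>F. Z j w \<in> E j} =
        measure M {w \<in> space M. \<forall>j\<in>insert k F. Z j w \<in> E j}"
    if M: "finite_measure M" and Xm: "\<And>j. j \<in> insert k F \<Longrightarrow> Z j \<in> borel_measurable M"
      and [measurable]: "T \<in> borel_measurable M" for M :: "'z measure" and Z T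
  proof -
    interpret finite_measure M by fact
    note [measurable] = Xm[OF insertI1] E[OF insertI1]
    have [measurable]: "Z j \<in> borel_measurable M" "E j \<in> sets borel" if "j \<in> F" for j using Xm E that by auto
    define i where "i w = (indicator (E k) (Z k w) :: real)" for w
    have [measurable]: "i \<in> borel_measurable M" unfolding i_def by measurable
    have i01: "0 \<le> i w \<and> i w \<le> 1" for w by (auto simp: i_def indicator_def)
    have int: "integrable M i" "integrable M (\<lambda>w. i w * cos (T w))" "integrable M (\<lambda>w. i w * sin (T w))"
      using i01 by (auto intro!: integrable_const_bound[where B=1] simp: abs_mult mult_le_one)
    have "(CLINT w|density M (\<lambda>w. ennreal (i w)). iexp (T w)) = (CLINT w|M. i w *\<^sub>R iexp (T w))"
      using i01 by (subst integral_density) auto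
    also have "\<dots> = (CLINT w|M. complex_of_real (i w * cos (T w)) + \<i> * complex_of_real (i w * sin (T w)))"
      by (intro Bochner_Integration.integral_cong refl) (simp add: complex_eq_iff Re_exp Im_exp)
    also have "\<dots> = complex_of_real (LINT w|M. i w * cos (T w)) + \<i> * complex_of_real (LINT w|M. i w * sin (T w))"
      by (simp only: int integrable_of_real integral_of_real integrable_mult_right integral_mult_right_zero
          Bochner_Integration.integral_add)
    finally have char: "(CLINT w|density M (\<lambda>w. ennreal (i w)). iexp (T w)) =
        complex_of_real ((LINT w|M. i w * (1 + cos (T w))) - (LINT w|M. i w * 1)) +
        \<i> * complex_of_real ((LINT w|M. i w * (1 + sin (T w))) - (LINT w|M. i w * 1))"
      using int by (simp add: distrib_left)
    have "emeasure (density M (\<lambda>w. ennreal (i w))) {w \<in> space M. \<forall>j\<in>F. Z j w \<in> E j} =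
        (\<integral>\<^sup>+w. ennreal (i w) * indicator {w \<in> space M. \<forall>j\<in>F. Z j w \<in> E j} w \<partial>M)"
      using insert.hyps by (intro emeasure_density) measurable
    also have "\<dots> = (\<integral>\<^sup>+w. indicator {w \<in> space M. \<forall>j\<in>insert k F. Z j w \<in> E j} w \<partial>M)"
      by (intro nn_integral_cong) (auto simp: i_def split: split_indicator)
    also have "\<dots> = emeasure M {w \<in> space M. \<forall>j\<in>insert k F. Z j w \<in> E j}"
      using insert.hyps by (intro nn_integral_indicator) (simp, measurable)
    finally show ?thesis
      using char finite_measure_density_bounded[OF M _ i01] by (simp add: measure_def i_def[abs_def])
  qed
  note r1 = restricted[of M1 X1, OF insert.prems(1) insert.prems(3) S(1), folded I1_def]
    and r2 = restricted[of M2 X2, OF insert.prems(2) insert.prems(4) S(2), folded I2_def]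
  have "measure (density M1 (\<lambda>w. ennreal (I1 w))) {w \<in> space (density M1 (\<lambda>w. ennreal (I1 w))). \<forall>j\<in>F. X1 j w \<in> E j} =
      measure (density M2 (\<lambda>w. ennreal (I2 w))) {w \<in> space (density M2 (\<lambda>w. ennreal (I2 w))). \<forall>j\<in>F. X2 j w \<in> E j}"
  proof (rule insert.IH)
    show "(CLINT w|density M1 (\<lambda>w. ennreal (I1 w)). iexp (\<Sum>j\<in>F. t j * X1 j w)) =
        (CLINT w|density M2 (\<lambda>w. ennreal (I2 w)). iexp (\<Sum>j\<in>F. t j * X2 j w))" for t
      unfolding S1_def[symmetric] S2_def[symmetric] by (simp only: r1 r2 weight)
  qed (use r1 r2 insert.prems(3,4) E in auto)
  thus ?case using r1 r2 by simp
qed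

text \<open>Boxes in finitely many coordinates generate the product sigma-algebra and are stable under
  intersection, so the index set may be uncountable.\<close>
lemma charfun_determines_process_law:
  fixes X1 :: "'i \<Rightarrow> 'w1 \<Rightarrow> real" and X2 :: "'i \<Rightarrow> 'w2 \<Rightarrow> real"
  assumes fin: "finite_measure M1" "finite_measure M2"
    and meas: "\<And>j. j \<in> I \<Longrightarrow> X1 j \<in> borel_measurable M1" "\<And>j. j \<in> I \<Longrightarrow> X2 j \<in> borel_measurable M2"
    and eq: "\<And>F t. finite F \<Longrightarrow> F \<subseteq> I \<Longrightarrow>
       (CLINT w|M1. iexp (\<Sum>j\<in>F. t j * X1 j w)) = (CLINT w|M2. iexp (\<Sum>j\<in>F. t j * X2 j w))"
  shows "distr M1 (\<Pi>\<^sub>M j\<in>I. borel) (\<lambda>w. \<lambda>j\<in>I. X1 j w) = distr M2 (\<Pi>\<^sub>M j\<in>I. borel) (\<lambda>w. \<lambda>j\<in>I. X2 j w)"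
proof (rule measure_eqI_PiM_infinite)
  interpret M1: finite_measure M1 by fact
  interpret M2: finite_measure M2 by fact
  have m1: "(\<lambda>w. \<lambda>j\<in>I. X1 j w) \<in> measurable M1 (\<Pi>\<^sub>M j\<in>I. borel)"
    using meas by (intro measurable_restrict) auto
  have m2: "(\<lambda>w. \<lambda>j\<in>I. X2 j w) \<in> measurable M2 (\<Pi>\<^sub>M j\<in>I. borel)"
    using meas by (intro measurable_restrict) auto
  show "finite_measure (distr M1 (\<Pi>\<^sub>M j\<in>I. borel) (\<lambda>w. \<lambda>j\<in>I. X1 j w))"
    using m1 by (rule M1.finite_measure_distr)
  fix A :: "'i \<Rightarrow> real set" and F assume F: "finite F" "F \<subseteq> I" and A: "\<And>i. i \<in> F \<Longrightarrow> A i \<in> sets borel"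
  have s: "prod_emb I (\<lambda>j. borel) F (Pi\<^sub>E F A) \<in> sets (\<Pi>\<^sub>M j\<in>I. (borel::real measure))"
    using F A by (intro sets_PiM_I) auto
  have v: "(\<lambda>w. \<lambda>j\<in>I. X j w) -` prod_emb I (\<lambda>j. borel) F (Pi\<^sub>E F A) \<inter> space M = {w \<in> space M. \<forall>j\<in>F. X j w \<in> A j}"
    for X :: "'i \<Rightarrow> 'y \<Rightarrow> real" and M
    using F by (auto simp: prod_emb_def PiE_iff extensional_def subset_eq)
  show "emeasure (distr M1 (\<Pi>\<^sub>M j\<in>I. borel) (\<lambda>w. \<lambda>j\<in>I. X1 j w)) (prod_emb I (\<lambda>j. borel) F (Pi\<^sub>E F A)) =
     emeasure (distr M2 (\<Pi>\<^sub>M j\<in>I. borel) (\<lambda>w. \<lambda>j\<in>I. X2 j w)) (prod_emb I (\<lambda>j. borel) F (Pi\<^sub>E F A))"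
    unfolding emeasure_distr[OF m1 s] emeasure_distr[OF m2 s] v M1.emeasure_eq_measure M2.emeasure_eq_measure
    using F A meas eq by (subst charfun_determines_boxes[OF F(1) fin]) auto
qed simp_all

section \<open>Jointly Gaussian families\<close>

abbreviation std_gaussian :: "real measure" (\<open>\<gamma>\<close>) where "\<gamma> \<equiv> std_normal_distribution"

lemma std_normal_prob_spaces:
  "prob_space \<gamma>" "product_prob_space (\<lambda>_::'i. \<gamma>)"
proof -
  show p: "prob_space \<gamma>" by (rule prob_space_normal_density) simp
  show "product_prob_space (\<lambda>_::'i. \<gamma>)"
    by (intro product_prob_spaceI p)
qed

text \<open>The weight \<open>exp (q x\<^sup>2)\<close> turns the standard normal density into a multiple of the normal density of
  variance \<open>1 / (1 - 2 q)\<close>; and \<open>1 - 2 q \<ge> exp (- 4 q)\<close> for \<open>q \<le> 1 / 4\<close>.\<close>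
lemma gaussian_exp_square_moment:
  assumes "0 \<le> q" "q \<le> 1 / 4"
  shows "(\<integral>\<^sup>+x. ennreal (exp (q * x\<^sup>2)) \<partial>\<gamma>) \<le> ennreal (exp (2 * q))"
proof -
  define d where "d = 1 - 2 * q"
  have d: "d \<ge> 1 / 2" "d > 0" using assms by (auto simp: d_def)
  have eq: "std_normal_density x * exp (q * x\<^sup>2) = 1 / sqrt d * normal_density 0 (1 / sqrt d) x" for x
  proof -
    have "exp (- x\<^sup>2 / 2) * exp (q * x\<^sup>2) = exp (- d * x\<^sup>2 / 2)"
      by (simp add: exp_add[symmetric] d_def algebra_simps)
    thus ?thesis using d by (simp add: normal_density_def power_divide real_sqrt_divide real_sqrt_mult field_simps)
  qed
  have "(\<integral>\<^sup>+x. ennreal (exp (q * x\<^sup>2)) \<partial>\<gamma>) =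
      (\<integral>\<^sup>+x. ennreal (std_normal_density x * exp (q * x\<^sup>2)) \<partial>lborel)"
    by (subst nn_integral_density) (auto simp: ennreal_mult')
  also have "\<dots> = (\<integral>\<^sup>+x. ennreal (1 / sqrt d) * ennreal (normal_density 0 (1 / sqrt d) x) \<partial>lborel)"
    unfolding eq using d by (subst ennreal_mult') auto
  also have "\<dots> = ennreal (1 / sqrt d) * (\<integral>\<^sup>+x. ennreal (normal_density 0 (1 / sqrt d) x) \<partial>lborel)"
    by (rule nn_integral_cmult) simp
  also have "(\<integral>\<^sup>+x. ennreal (normal_density 0 (1 / sqrt d) x) \<partial>lborel) = 1"
    using prob_space.emeasure_space_1[OF prob_space_normal_density[of "1 / sqrt d" 0]] d
    by (simp add: emeasure_density)
  also have "ennreal (1 / sqrt d) * 1 \<le> ennreal (exp (2 * q))"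
  proof -
    have "1 \<le> d * (1 + 4 * q)"
      using assms mult_nonneg_nonneg[of q "1 - 4 * q"] by (simp add: d_def algebra_simps power2_eq_square)
    also have "\<dots> \<le> d * exp (4 * q)" using d by (intro mult_left_mono exp_ge_add_one_self) auto
    finally have "1 / d \<le> exp (2 * q) ^ 2" using d by (simp add: field_simps flip: exp_of_nat_mult)
    hence "sqrt (1 / d) \<le> exp (2 * q)" by (metis exp_ge_zero real_le_lsqrt)
    thus ?thesis by (simp add: real_sqrt_divide ennreal_leI)
  qed
  finally show ?thesis .
qed

text \<open>Centred independent Gaussians, expressed by their joint characteristic function, since this is what
  can be computed for linear functionals. Variances \<open>0\<close> occur (\<open>a\<^sub>j\<close> may vanish), and there is no
  density then; so the family is compared with multiples of standard normal variables.\<close>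
locale jointly_gaussian = prob_space M for M :: "'w measure" +
  fixes F :: "'i set" and X :: "'i \<Rightarrow> 'w \<Rightarrow> real" and v :: "'i \<Rightarrow> real"
  assumes fin: "finite F" and meas: "\<And>j. j \<in> F \<Longrightarrow> X j \<in> borel_measurable M"
    and var_nonneg: "\<And>j. j \<in> F \<Longrightarrow> 0 \<le> v j"
    and charfun: "\<And>t. (CLINT w|M. iexp (\<Sum>j\<in>F. t j * X j w)) = of_real (exp (- (\<Sum>j\<in>F. (t j)\<^sup>2 * v j) / 2))"
begin

lemma scaled: "jointly_gaussian M F (\<lambda>j w. c * X j w) (\<lambda>j. c\<^sup>2 * v j)"
proof
  show "(CLINT w|M. iexp (\<Sum>j\<in>F. t j * (c * X j w))) = of_real (exp (- (\<Sum>j\<in>F. (t j)\<^sup>2 * (c\<^sup>2 * v j)) / 2))" for t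
    using charfun[of "\<lambda>j. t j * c"] by (simp only: power_mult_distrib mult.assoc)
qed (use fin meas var_nonneg in auto)

lemma law_eq:
  "distr M (\<Pi>\<^sub>M j\<in>F. borel) (\<lambda>w. \<lambda>j\<in>F. X j w) =
    distr (\<Pi>\<^sub>M j\<in>F. \<gamma>) (\<Pi>\<^sub>M j\<in>F. borel) (\<lambda>x. \<lambda>j\<in>F. sqrt (v j) * x j)"
proof (rule charfun_determines_process_law)
  interpret N: product_prob_space "\<lambda>_::'i. \<gamma>" by (rule std_normal_prob_spaces)
  interpret PF: prob_space "\<Pi>\<^sub>M j\<in>F. \<gamma>"
    by (intro prob_space_PiM std_normal_prob_spaces)
  show "finite_measure M" by (rule finite_measure_axioms)
  show "finite_measure (\<Pi>\<^sub>M j\<in>F. \<gamma>)" by (rule PF.finite_measure_axioms)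
  show "(\<lambda>x. sqrt (v j) * x j) \<in> borel_measurable (\<Pi>\<^sub>M j\<in>F. \<gamma>)" if "j \<in> F" for j
    using that by measurable
  fix F' and t :: "'i \<Rightarrow> real" assume F': "finite F'" "F' \<subseteq> F"
  define s where "s j = (if j \<in> F' then t j else 0)" for j
  have ext: "(\<Sum>j\<in>F'. t j * x j) = (\<Sum>j\<in>F. s j * x j)" for x
    unfolding s_def using F' fin by (intro sum.mono_neutral_cong_left) auto
  have "(CLINT x|(\<Pi>\<^sub>M j\<in>F. \<gamma>). iexp (\<Sum>j\<in>F. s j * (sqrt (v j) * x j))) =
     (CLINT x|(\<Pi>\<^sub>M j\<in>F. \<gamma>). (\<Prod>j\<in>F. iexp ((s j * sqrt (v j)) * x j)))"
    using fin by (simp add: exp_sum[symmetric] sum_distrib_left mult.assoc)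
  also have "\<dots> = (\<Prod>j\<in>F. CLINT x|\<gamma>. iexp ((s j * sqrt (v j)) * x))"
    using fin by (intro N.product_integral_prod integrable_iexp_finite prob_space.finite_measure std_normal_prob_spaces) auto
  also have "\<dots> = (\<Prod>j\<in>F. of_real (exp (- ((s j)\<^sup>2 * v j) / 2)))"
  proof (rule prod.cong[OF refl])
    fix j assume "j \<in> F"
    hence "(s j * sqrt (v j))\<^sup>2 = (s j)\<^sup>2 * v j" using var_nonneg by (simp add: power_mult_distrib)
    thus "(CLINT x|\<gamma>. iexp ((s j * sqrt (v j)) * x)) = of_real (exp (- ((s j)\<^sup>2 * v j) / 2))"
      using fun_cong[OF char_std_normal_distribution, of "s j * sqrt (v j)"] unfolding char_def by simp
  qed
  also have "\<dots> = of_real (exp (- (\<Sum>j\<in>F. (s j)\<^sup>2 * v j) / 2))"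
    using fin by (simp add: exp_sum[symmetric] sum_negf sum_divide_distrib flip: of_real_prod)
  finally show "(CLINT w|M. iexp (\<Sum>j\<in>F'. t j * X j w)) =
     (CLINT x|(\<Pi>\<^sub>M j\<in>F. \<gamma>). iexp (\<Sum>j\<in>F'. t j * (sqrt (v j) * x j)))"
    unfolding ext charfun by simp
qed (use meas in auto)

lemma nn_integral_prod:
  assumes h: "\<And>j. j \<in> F \<Longrightarrow> h j \<in> borel_measurable borel"
  shows "(\<integral>\<^sup>+w. (\<Prod>j\<in>F. h j (X j w)) \<partial>M) = (\<Prod>j\<in>F. \<integral>\<^sup>+x. h j (sqrt (v j) * x) \<partial>\<gamma>)"
proof -
  interpret N: product_prob_space "\<lambda>_::'i. \<gamma>" by (rule std_normal_prob_spaces)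
  note [measurable] = meas h
  have hm: "(\<lambda>x. \<Prod>j\<in>F. h j (x j)) \<in> borel_measurable (\<Pi>\<^sub>M j\<in>F. borel)"
    by measurable
  have "(\<integral>\<^sup>+w. (\<Prod>j\<in>F. h j (X j w)) \<partial>M) =
      (\<integral>\<^sup>+x. (\<Prod>j\<in>F. h j (x j)) \<partial>distr M (\<Pi>\<^sub>M j\<in>F. borel) (\<lambda>w. \<lambda>j\<in>F. X j w))"
    using hm by (subst nn_integral_distr) (auto intro!: measurable_restrict meas nn_integral_cong prod.cong)
  also have "\<dots> = (\<integral>\<^sup>+x. (\<Prod>j\<in>F. h j (sqrt (v j) * x j)) \<partial>(\<Pi>\<^sub>M j\<in>F. \<gamma>))"
    unfolding law_eq
    using hm by (subst nn_integral_distr) (auto intro!: measurable_restrict nn_integral_cong prod.cong)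
  also have "\<dots> = (\<Prod>j\<in>F. \<integral>\<^sup>+x. h j (sqrt (v j) * x) \<partial>\<gamma>)"
    using fin by (intro N.product_nn_integral_prod) auto
  finally show ?thesis .
qed

lemma integral_prod:
  fixes h :: "'i \<Rightarrow> real \<Rightarrow> complex"
  assumes h: "\<And>j. j \<in> F \<Longrightarrow> h j \<in> borel_measurable borel"
    and int: "\<And>j. j \<in> F \<Longrightarrow> integrable \<gamma> (\<lambda>x. h j (sqrt (v j) * x))"
  shows "(CLINT w|M. (\<Prod>j\<in>F. h j (X j w))) = (\<Prod>j\<in>F. CLINT x|\<gamma>. h j (sqrt (v j) * x))"
proof -
  interpret N: product_prob_space "\<lambda>_::'i. \<gamma>" by (rule std_normal_prob_spaces)
  note [measurable] = meas h
  have hm: "(\<lambda>x. \<Prod>j\<in>F. h j (x j)) \<in> borel_measurable (\<Pi>\<^sub>M j\<in>F. borel)"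
    by measurable
  have "(CLINT w|M. (\<Prod>j\<in>F. h j (X j w))) =
      (CLINT x|distr M (\<Pi>\<^sub>M j\<in>F. borel) (\<lambda>w. \<lambda>j\<in>F. X j w). (\<Prod>j\<in>F. h j (x j)))"
    using hm by (subst integral_distr) (auto intro!: measurable_restrict meas Bochner_Integration.integral_cong prod.cong)
  also have "\<dots> = (CLINT x|(\<Pi>\<^sub>M j\<in>F. \<gamma>). (\<Prod>j\<in>F. h j (sqrt (v j) * x j)))"
    unfolding law_eq
    using hm by (subst integral_distr) (auto intro!: measurable_restrict Bochner_Integration.integral_cong prod.cong)
  also have "\<dots> = (\<Prod>j\<in>F. CLINT x|\<gamma>. h j (sqrt (v j) * x))"
    using fin int by (intro N.product_integral_prod) auto
  finally show ?thesis .
qed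

lemma energy_exp_moment:
  assumes t: "0 \<le> t" "\<And>j. j \<in> F \<Longrightarrow> 4 * t * v j \<le> 1"
  shows "(\<integral>\<^sup>+w. ennreal (exp (t * (\<Sum>j\<in>F. (X j w)\<^sup>2))) \<partial>M) \<le> ennreal (exp (2 * t * (\<Sum>j\<in>F. v j)))"
proof -
  have "(\<integral>\<^sup>+w. ennreal (exp (t * (\<Sum>j\<in>F. (X j w)\<^sup>2))) \<partial>M) = (\<integral>\<^sup>+w. (\<Prod>j\<in>F. ennreal (exp (t * (X j w)\<^sup>2))) \<partial>M)"
    using fin by (simp add: prod_ennreal exp_sum[symmetric] sum_distrib_left)
  also have "\<dots> = (\<Prod>j\<in>F. \<integral>\<^sup>+x. ennreal (exp (t * (sqrt (v j) * x)\<^sup>2)) \<partial>\<gamma>)"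
    by (rule nn_integral_prod) auto
  also have "\<dots> \<le> (\<Prod>j\<in>F. ennreal (exp (2 * (t * v j))))"
  proof (rule prod_mono_ennreal)
    fix j assume j: "j \<in> F"
    have "(\<integral>\<^sup>+x. ennreal (exp (t * (sqrt (v j) * x)\<^sup>2)) \<partial>\<gamma>) =
       (\<integral>\<^sup>+x. ennreal (exp (t * v j * x\<^sup>2)) \<partial>\<gamma>)"
      using var_nonneg[OF j] by (simp add: power_mult_distrib mult.assoc)
    also have "\<dots> \<le> ennreal (exp (2 * (t * v j)))"
      using t(1) t(2)[OF j] var_nonneg[OF j] by (intro gaussian_exp_square_moment) (auto simp: field_simps)
    finally show "(\<integral>\<^sup>+x. ennreal (exp (t * (sqrt (v j) * x)\<^sup>2)) \<partial>\<gamma>) \<le> ennreal (exp (2 * (t * v j)))" .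
  qed
  also have "\<dots> = ennreal (exp (2 * t * (\<Sum>j\<in>F. v j)))"
    using fin by (simp add: prod_ennreal exp_sum[symmetric] sum_distrib_left mult.assoc)
  finally show ?thesis .
qed

end

lemma exp_moment_tail:
  assumes M: "prob_space M" and Z: "Z \<in> borel_measurable M" and t: "t \<ge> 0"
    and le: "(\<integral>\<^sup>+w. ennreal (exp (t * Z w)) \<partial>M) \<le> ennreal (exp b)"
  shows "measure M {w \<in> space M. Z w > r} \<le> exp (b - t * r)"
proof -
  interpret prob_space M by fact
  note Z[measurable]
  have "ennreal (measure M {w \<in> space M. Z w > r}) = (\<integral>\<^sup>+w. indicator {w \<in> space M. Z w > r} w \<partial>M)"
    by (simp add: emeasure_eq_measure)
  also have "\<dots> \<le> (\<integral>\<^sup>+w. ennreal (exp (- t * r)) * ennreal (exp (t * Z w)) \<partial>M)"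
    using t by (intro nn_integral_mono)
      (auto simp: ennreal_mult'[symmetric] exp_add[symmetric] mult_left_mono split: split_indicator)
  also have "\<dots> = ennreal (exp (- t * r)) * (\<integral>\<^sup>+w. ennreal (exp (t * Z w)) \<partial>M)"
    by (rule nn_integral_cmult) simp
  also have "\<dots> \<le> ennreal (exp (- t * r)) * ennreal (exp b)"
    by (intro mult_left_mono le) simp
  also have "\<dots> = ennreal (exp (b - t * r))"
    by (simp add: ennreal_mult'[symmetric] exp_add[symmetric])
  finally show ?thesis by simp
qed

section \<open>Polynomially growing eigenvalues and the balance index\<close>

locale polynomial_spectrum =
  fixes I :: "nat set" and g :: "nat \<Rightarrow> real" and C :: real
  assumes coord: "coordinate_set I" and C1: "C \<ge> 1"
    and g_pos: "\<And>j. j \<in> I \<Longrightarrow> g j > 0"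
    and g_mono: "\<And>i j. i \<in> I \<Longrightarrow> j \<in> I \<Longrightarrow> i \<le> j \<Longrightarrow> (g i)\<^sup>2 \<le> (g j)\<^sup>2"
    and growth: "polynomial_growth I g C"
begin

definition tail :: "nat \<Rightarrow> real" where
  "tail n = (\<Sum>\<^sub>\<infinity>j\<in>{j\<in>I. n \<le> j}. 1 / (g j)\<^sup>2)"

lemma index_pos: "j \<in> I \<Longrightarrow> 1 \<le> j"
  using coord by (auto simp: coordinate_set_def)

lemma index_downward: "j \<in> I \<Longrightarrow> 1 \<le> i \<Longrightarrow> i \<le> j \<Longrightarrow> i \<in> I"
  using coord by (auto simp: coordinate_set_def)

lemma tail_bounds:
  assumes "J \<in> I"
  shows "real J / (C * (g J)\<^sup>2) \<le> tail J" "tail J \<le> C * real J / (g J)\<^sup>2"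
proof -
  have J: "real J > 0" and g: "(g J)\<^sup>2 > 0" using index_pos g_pos assms by fastforce+
  have "1 / C \<le> 1 / (real J * (1 / (g J)\<^sup>2)) * tail J \<and> 1 / (real J * (1 / (g J)\<^sup>2)) * tail J \<le> C"
    using growth assms unfolding polynomial_growth_def tail_def by blast
  thus "real J / (C * (g J)\<^sup>2) \<le> tail J" "tail J \<le> C * real J / (g J)\<^sup>2"
    using J g C1 by (auto simp: field_simps)
qed

lemma tail_pos: "J \<in> I \<Longrightarrow> tail J > 0"
  using tail_bounds(1)[of J] index_pos[of J] g_pos[of J] C1
  by (smt (verit) divide_pos_pos mult_pos_pos of_nat_0_less_iff zero_less_power less_le_trans less_one not_le le_0_eq)

text \<open>The sum of a divergent family is \<open>0\<close> by convention, which the lower growth bound excludes.\<close>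
lemma tail_summable: "J \<in> I \<Longrightarrow> (\<lambda>j. 1 / (g j)\<^sup>2) summable_on {j\<in>I. J \<le> j}"
  using tail_pos[of J] infsum_not_exists[of "\<lambda>j. 1 / (g j)\<^sup>2" "{j\<in>I. J \<le> j}"]
  unfolding tail_def by fastforce

lemma tail_shift:
  assumes "J \<in> I"
  shows "tail J \<le> real k / (g J)\<^sup>2 + tail (J + k)"
proof -
  let ?h = "\<lambda>j. 1 / (g j)\<^sup>2"
  have split: "{j\<in>I. J \<le> j} = {j\<in>I. J \<le> j \<and> j < J + k} \<union> {j\<in>I. J + k \<le> j}" by auto
  have fin: "finite {j\<in>I. J \<le> j \<and> j < J + k}" by (rule finite_subset[of _ "{..<J+k}"]) auto
  have "?h summable_on {j\<in>I. J + k \<le> j}"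
    by (rule summable_on_subset_banach[OF tail_summable[OF assms]]) auto
  hence "tail J = infsum ?h {j\<in>I. J \<le> j \<and> j < J + k} + tail (J + k)"
    unfolding tail_def using fin by (subst split, subst infsum_Un_disjoint) auto
  also have "infsum ?h {j\<in>I. J \<le> j \<and> j < J + k} = sum ?h {j\<in>I. J \<le> j \<and> j < J + k}"
    using fin by simp
  also have "\<dots> \<le> of_nat (card {j\<in>I. J \<le> j \<and> j < J + k}) * (1 / (g J)\<^sup>2)"
  proof (rule sum_bounded_above)
    fix j assume "j \<in> {j\<in>I. J \<le> j \<and> j < J + k}"
    hence "(g J)\<^sup>2 \<le> (g j)\<^sup>2" "(g J)\<^sup>2 > 0" using g_mono assms g_pos[OF assms] by auto
    thus "1 / (g j)\<^sup>2 \<le> 1 / (g J)\<^sup>2" by (intro divide_left_mono) (auto intro!: mult_pos_pos)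
  qed
  also have "\<dots> \<le> real k * (1 / (g J)\<^sup>2)"
  proof (intro mult_right_mono)
    have "card {j\<in>I. J \<le> j \<and> j < J + k} \<le> card {J..<J + k}" by (rule card_mono) auto
    thus "real (card {j\<in>I. J \<le> j \<and> j < J + k}) \<le> real k" by simp
  qed simp
  finally show ?thesis by simp
qed

text \<open>Passing from \<open>J\<close> to \<open>J + k\<close> removes at most \<open>k / g\<^sub>J\<^sup>2\<close> from the tail sum. For \<open>k \<le> J / (2 C)\<close> this is
  at most half of its lower bound, so the tail at \<open>J + k\<close> is still of order \<open>J / g\<^sub>J\<^sup>2\<close>. On the other
  hand it is at most of order \<open>(J + k) / g\<^bsub>J+k\<^esub>\<^sup>2\<close>. When there are only finitely many indices, the
  nonzero tail also shows that \<open>J + k\<close> is one of them.\<close>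
lemma slow_variation:
  assumes J: "J \<in> I" and k: "2 * C * real k \<le> real J"
  shows "J + k \<in> I" "(g (J + k))\<^sup>2 \<le> 4 * C\<^sup>2 * (g J)\<^sup>2"
proof -
  have Jp: "real J \<ge> 1" and g: "(g J)\<^sup>2 > 0" using index_pos g_pos J by fastforce+
  have kJ: "real k \<le> real J"
  proof -
    have "1 * real k \<le> (2 * C) * real k" using C1 by (intro mult_right_mono) auto
    thus ?thesis using k by simp
  qed
  have "real J / (C * (g J)\<^sup>2) \<le> real k / (g J)\<^sup>2 + tail (J + k)"
    using tail_bounds(1)[OF J] tail_shift[OF J, of k] by linarith
  moreover have "real k / (g J)\<^sup>2 \<le> real J / (2 * C * (g J)\<^sup>2)"
    using k C1 g by (simp add: field_simps)
  moreover have "real J / (C * (g J)\<^sup>2) = 2 * (real J / (2 * C * (g J)\<^sup>2))"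
    using C1 g by (simp add: field_simps)
  ultimately have t: "real J / (2 * C * (g J)\<^sup>2) \<le> tail (J + k)" by linarith
  have "0 < real J / (2 * C * (g J)\<^sup>2)" using Jp C1 g by (intro divide_pos_pos mult_pos_pos) auto
  hence tp: "tail (J + k) > 0" using t by linarith
  show Jk: "J + k \<in> I"
  proof (rule ccontr)
    assume "J + k \<notin> I"
    hence "{j\<in>I. J + k \<le> j} = {}" using index_downward Jp by fastforce
    hence "tail (J + k) = 0" by (simp only: tail_def infsum_empty)
    thus False using tp by simp
  qed
  have gk: "(g (J + k))\<^sup>2 > 0" using g_pos[OF Jk] by simp
  have "real J / (2 * C * (g J)\<^sup>2) \<le> C * real (J + k) / (g (J + k))\<^sup>2"
    using t tail_bounds(2)[OF Jk] by linarith
  also have "\<dots> \<le> C * (2 * real J) / (g (J + k))\<^sup>2"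
    using kJ C1 gk by (intro divide_right_mono mult_left_mono) auto
  finally have "real J * (g (J + k))\<^sup>2 \<le> real J * (4 * C\<^sup>2 * (g J)\<^sup>2)"
    using C1 g gk by (simp add: field_simps power2_eq_square)
  thus "(g (J + k))\<^sup>2 \<le> 4 * C\<^sup>2 * (g J)\<^sup>2" using Jp by simp
qed

text \<open>A bound for all ratios \<open>g\<^bsub>j+1\<^esub>\<^sup>2 / g\<^sub>j\<^sup>2\<close>. The first term covers \<open>j \<ge> 2 C\<close>, by slow variation with one
  step; the remaining finitely many ratios are not controlled by \<open>C\<close> and enter as they are.\<close>
definition L :: real where
  "L = 4 * C\<^sup>2 + (\<Sum>j\<in>{j\<in>I. real j < 2 * C}. (g (j + 1))\<^sup>2 / (g j)\<^sup>2)"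

lemma L_ge_1: "L \<ge> 1"
proof -
  have "0 \<le> (\<Sum>j\<in>{j\<in>I. real j < 2 * C}. (g (j + 1))\<^sup>2 / (g j)\<^sup>2)" by (intro sum_nonneg) auto
  moreover have "1 \<le> C\<^sup>2" using C1 by simp
  ultimately show ?thesis unfolding L_def by linarith
qed

lemma consecutive_ratio:
  assumes "j \<in> I" "j + 1 \<in> I"
  shows "(g (j + 1))\<^sup>2 \<le> L * (g j)\<^sup>2"
proof -
  have g: "(g j)\<^sup>2 > 0" using g_pos[OF assms(1)] by simp
  have fin: "finite {j\<in>I. real j < 2 * C}"
    by (rule finite_subset[of _ "{..nat \<lceil>2 * C\<rceil>}"]) (auto, linarith)
  have s0: "0 \<le> (\<Sum>j\<in>{j\<in>I. real j < 2 * C}. (g (j + 1))\<^sup>2 / (g j)\<^sup>2)" by (intro sum_nonneg) auto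
  show ?thesis
  proof (cases "real j < 2 * C")
    case True
    have "(g (j + 1))\<^sup>2 / (g j)\<^sup>2 \<le> (\<Sum>j\<in>{j\<in>I. real j < 2 * C}. (g (j + 1))\<^sup>2 / (g j)\<^sup>2)"
      using True assms fin by (intro member_le_sum) auto
    also have "\<dots> \<le> L" by (simp add: L_def)
    finally show ?thesis using g by (simp add: field_simps)
  next
    case False
    hence "(g (j + 1))\<^sup>2 \<le> 4 * C\<^sup>2 * (g j)\<^sup>2" using slow_variation(2)[OF assms(1), of 1] by simp
    also have "\<dots> \<le> L * (g j)\<^sup>2" using s0 g by (intro mult_right_mono) (auto simp: L_def)
    finally show ?thesis .
  qed
qed

end

locale balanced_spectrum = polynomial_spectrum I g C
  for I :: "nat set" and g :: "nat \<Rightarrow> real" and C :: real +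
  fixes a :: "nat \<Rightarrow> real" and M \<sigma> :: real and J :: nat
  assumes M_pos: "M > 0" and sigma_pos: "\<sigma> > 0"
    and a_mono: "\<And>i j. i \<in> I \<Longrightarrow> j \<in> I \<Longrightarrow> i \<le> j \<Longrightarrow> (a j)\<^sup>2 \<le> (a i)\<^sup>2"
    and smallest: "smallest_index I g a M \<sigma> J"
begin

abbreviation \<mu> :: real where "\<mu> \<equiv> real J / M"

text \<open>The eigenvalues of \<open>F\<^sub>\<mu>\<close>.\<close>
definition lam :: "nat \<Rightarrow> real" where
  "lam j = (a j)\<^sup>2 / \<sigma>\<^sup>2 + \<mu> * (g j)\<^sup>2"

definition rate :: real where "rate = M / (g J)\<^sup>2"

lemma J_in: "J \<in> I" and J_ge: "real J \<ge> 1"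
  using smallest index_pos by (fastforce simp: smallest_index_def)+

lemma mu_pos: "\<mu> > 0" using J_ge M_pos by simp

lemma gJ_pos: "(g J)\<^sup>2 > 0" using g_pos[OF J_in] by simp

lemma rate_pos: "rate > 0" using gJ_pos M_pos by (simp add: rate_def)

lemma lam_pos: "j \<in> I \<Longrightarrow> lam j > 0"
  unfolding lam_def using mu_pos g_pos[of j] by (intro add_nonneg_pos mult_pos_pos) auto

lemma lam_ge_prior: "\<mu> * (g j)\<^sup>2 \<le> lam j" and lam_ge_data: "(a j)\<^sup>2 / \<sigma>\<^sup>2 \<le> lam j"
  using M_pos by (auto simp: lam_def)

lemma signal_le: "j \<in> I \<Longrightarrow> J \<le> j \<Longrightarrow> (a j)\<^sup>2 / \<sigma>\<^sup>2 \<le> real J * (g J)\<^sup>2 / M"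
proof -
  assume j: "j \<in> I" "J \<le> j"
  have "(a j)\<^sup>2 / \<sigma>\<^sup>2 \<le> (a J)\<^sup>2 / \<sigma>\<^sup>2" using a_mono[OF J_in j] by (simp add: divide_right_mono)
  also have "\<dots> \<le> real J * (g J)\<^sup>2 / M"
    using smallest M_pos sigma_pos by (simp add: smallest_index_def field_simps)
  finally show ?thesis .
qed

lemma lam_le: 
  assumes j: "j \<in> I" "J \<le> j" 
  shows "lam j \<le> 2 * \<mu> * (g j)\<^sup>2"
proof -
  have "real J * (g J)\<^sup>2 / M = \<mu> * (g J)\<^sup>2" by simp
  also have "\<dots> \<le> \<mu> * (g j)\<^sup>2" using g_mono[OF J_in j] mu_pos by (intro mult_left_mono) auto
  finally have "lam j \<le> \<mu> * (g j)\<^sup>2 + \<mu> * (g j)\<^sup>2" using signal_le[OF j] unfolding lam_def by linarith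
  thus ?thesis by (simp only: mult.assoc mult_2 distrib_right)
qed

text \<open>Below \<open>J\<close> the data term is bounded from below by its value at \<open>J - 1\<close>, where minimality of \<open>J\<close>
  applies. The ratio bound \<open>L\<close> then replaces \<open>g\<^bsub>J-1\<^esub>\<close> by \<open>g\<^sub>J\<close>.\<close>
lemma before_J:
  assumes j: "j \<in> I" "j < J"
  shows "J - 1 \<in> I" "real J \<le> 2 * real (J - 1)" "(g j)\<^sup>2 \<le> (g (J - 1))\<^sup>2" "0 < (g (J - 1))\<^sup>2"
    "(g J)\<^sup>2 \<le> L * (g (J - 1))\<^sup>2"
    "real (J - 1) * (g (J - 1))\<^sup>2 / M \<le> lam j"
proof -
  have j1: "1 \<le> j" using index_pos j by simp
  show J1: "J - 1 \<in> I" using index_downward[OF J_in, of "J - 1"] j j1 by simp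
  show "real J \<le> 2 * real (J - 1)" using j j1 by linarith
  show "(g j)\<^sup>2 \<le> (g (J - 1))\<^sup>2" using g_mono[OF j(1) J1] j by simp
  show "0 < (g (J - 1))\<^sup>2" using g_pos[OF J1] by simp
  show "(g J)\<^sup>2 \<le> L * (g (J - 1))\<^sup>2" using consecutive_ratio[OF J1] J_in j j1 by simp
  have "real (J - 1) * (g (J - 1))\<^sup>2 < M * (1 / \<sigma>\<^sup>2) * (a (J - 1))\<^sup>2"
    using smallest J1 j by (auto simp: smallest_index_def not_le)
  hence "real (J - 1) * (g (J - 1))\<^sup>2 / M \<le> (a (J - 1))\<^sup>2 / \<sigma>\<^sup>2" using M_pos by (simp add: field_simps)
  also have "\<dots> \<le> (a j)\<^sup>2 / \<sigma>\<^sup>2" using a_mono[OF j(1) J1] j by (intro divide_right_mono) auto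
  also have "\<dots> \<le> lam j" by (rule lam_ge_data)
  finally show "real (J - 1) * (g (J - 1))\<^sup>2 / M \<le> lam j" .
qed

text \<open>No single coordinate carries more than a constant times the fraction \<open>1 / J\<close> of the risk. This is
  what makes the deviations exponentially small in \<open>J\<close>.\<close>
lemma inverse_lam_le:
  assumes j: "j \<in> I"
  shows "1 / lam j \<le> 2 * L * rate / real J"
proof -
  have "real J * (g J)\<^sup>2 \<le> 2 * L * M * lam j"
  proof (cases "j < J")
    case True
    note b = before_J[OF j True]
    have "real J * (g J)\<^sup>2 \<le> (2 * real (J - 1)) * (L * (g (J - 1))\<^sup>2)"
      using b by (intro mult_mono) auto
    also have "\<dots> = 2 * L * M * (real (J - 1) * (g (J - 1))\<^sup>2 / M)" using M_pos by simp
    also have "\<dots> \<le> 2 * L * M * lam j" using b M_pos L_ge_1 by (intro mult_left_mono) auto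
    finally show ?thesis .
  next
    case False
    have "real J * (g J)\<^sup>2 \<le> real J * (g j)\<^sup>2" using g_mono[OF J_in j] False by (intro mult_left_mono) auto
    also have "\<dots> = M * (\<mu> * (g j)\<^sup>2)" using M_pos by simp
    also have "\<dots> \<le> M * lam j" using lam_ge_prior M_pos by (intro mult_left_mono) auto
    also have "\<dots> \<le> (2 * L) * (M * lam j)" using L_ge_1 M_pos lam_pos[OF j]
      mult_right_mono[of 1 "2 * L" "M * lam j"] by simp
    finally show ?thesis by simp
  qed
  thus ?thesis using J_ge gJ_pos lam_pos[OF j] by (simp add: rate_def field_simps)
qed

text \<open>The factor \<open>\<mu> g\<^sub>j\<^sup>2 / lam j\<close> is the relative bias in the coordinate \<open>j\<close>. The right-hand side is
  proportional to \<open>g\<^sub>j\<^sup>2\<close> so that summing against \<open>f\<^sub>j\<^sup>2\<close> produces the ellipsoid norm.\<close>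
lemma bias_factor_le:
  assumes j: "j \<in> I"
  shows "(\<mu> * (g j)\<^sup>2 / lam j)\<^sup>2 \<le> (4 * L / (g J)\<^sup>2) * (g j)\<^sup>2"
proof -
  have lp: "lam j > 0" and gj: "g j > 0" using lam_pos g_pos j by auto
  have "(\<mu> * (g j)\<^sup>2)\<^sup>2 * (g J)\<^sup>2 \<le> 4 * L * (g j)\<^sup>2 * (lam j)\<^sup>2"
  proof (cases "j < J")
    case True
    note b = before_J[OF j True]
    define h where "h = (g (J - 1))\<^sup>2"
    have h: "h > 0" "(g j)\<^sup>2 \<le> h" "(g J)\<^sup>2 \<le> L * h" using b by (auto simp: h_def)
    have "\<mu> * h \<le> 2 * lam j"
    proof -
      have "\<mu> * h \<le> (2 * real (J - 1) / M) * h" using b M_pos h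
        by (intro mult_right_mono divide_right_mono) auto
      also have "\<dots> = 2 * (real (J - 1) * h / M)" by simp
      also have "\<dots> \<le> 2 * lam j" using b by (simp add: h_def)
      finally show ?thesis .
    qed
    hence "(\<mu> * h)\<^sup>2 \<le> (2 * lam j)\<^sup>2" using M_pos h by (intro power_mono) auto
    hence sq: "\<mu>\<^sup>2 * h * h \<le> 4 * (lam j)\<^sup>2" by (simp add: power2_eq_square mult_ac)
    have "(\<mu> * (g j)\<^sup>2)\<^sup>2 * (g J)\<^sup>2 = \<mu>\<^sup>2 * (g j)\<^sup>2 * ((g j)\<^sup>2 * (g J)\<^sup>2)" by (simp add: power2_eq_square)
    also have "\<dots> \<le> \<mu>\<^sup>2 * (g j)\<^sup>2 * (h * (L * h))"
      using h by (intro mult_left_mono mult_mono) auto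
    also have "\<dots> = L * (g j)\<^sup>2 * (\<mu>\<^sup>2 * h * h)" by simp
    also have "\<dots> \<le> L * (g j)\<^sup>2 * (4 * (lam j)\<^sup>2)" using sq L_ge_1 by (intro mult_left_mono) auto
    finally show ?thesis by simp
  next
    case False
    have "(\<mu> * (g j)\<^sup>2)\<^sup>2 * (g J)\<^sup>2 \<le> (lam j)\<^sup>2 * (g j)\<^sup>2"
    proof (rule mult_mono)
      show "(\<mu> * (g j)\<^sup>2)\<^sup>2 \<le> (lam j)\<^sup>2"
        using lam_ge_prior M_pos by (intro power_mono) auto
      show "(g J)\<^sup>2 \<le> (g j)\<^sup>2" using g_mono[OF J_in j] False by simp
    qed auto
    also have "\<dots> \<le> 4 * L * ((lam j)\<^sup>2 * (g j)\<^sup>2)"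
      using L_ge_1 mult_right_mono[of 1 "4 * L" "(lam j)\<^sup>2 * (g j)\<^sup>2"] by simp
    finally show ?thesis by (simp add: mult_ac)
  qed
  hence "(\<mu> * (g j)\<^sup>2)\<^sup>2 / (lam j)\<^sup>2 \<le> 4 * L * (g j)\<^sup>2 / (g J)\<^sup>2"
    using lp gJ_pos
    by (simp only: pos_divide_le_eq pos_le_divide_eq zero_less_power times_divide_eq_left)
  thus ?thesis by (simp add: power_divide power_mult_distrib)
qed

definition trace_const :: real where "trace_const = 2 * L + C"

text \<open>The indices below \<open>J\<close> contribute at most \<open>J\<close> terms of order \<open>rate / J\<close>; above \<open>J\<close> the prior term
  dominates and the sum is comparable with \<open>tail J / \<mu>\<close>.\<close>
lemma summable_inverse_lam: "(\<lambda>j. 1 / lam j) summable_on I"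
  and trace_lower: "rate / (2 * C) \<le> (\<Sum>\<^sub>\<infinity>j\<in>I. 1 / lam j)"
  and trace_upper: "(\<Sum>\<^sub>\<infinity>j\<in>I. 1 / lam j) \<le> trace_const * rate"
proof -
  define A where "A = {j\<in>I. j < J}"
  define B where "B = {j\<in>I. J \<le> j}"
  have I: "I = A \<union> B" "A \<inter> B = {}" by (auto simp: A_def B_def)
  have fA: "finite A" by (rule finite_subset[of _ "{..<J}"]) (auto simp: A_def)
  note sB = tail_summable[OF J_in, folded B_def]
  have up: "1 / lam j \<le> 1 / \<mu> * (1 / (g j)\<^sup>2)" if "j \<in> B" for j
  proof -
    have "j \<in> I" using that by (simp add: B_def)
    hence "0 < \<mu> * (g j)\<^sup>2" using mu_pos g_pos[OF \<open>j \<in> I\<close>] by (intro mult_pos_pos) auto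
    hence "1 / lam j \<le> 1 / (\<mu> * (g j)\<^sup>2)"
      using lam_pos[OF \<open>j \<in> I\<close>] by (intro divide_left_mono[OF lam_ge_prior] mult_pos_pos[OF _ \<open>0 < \<mu> * (g j)\<^sup>2\<close>]) auto
    thus ?thesis by simp
  qed
  have lo: "1 / (2 * \<mu>) * (1 / (g j)\<^sup>2) \<le> 1 / lam j" if "j \<in> B" for j
  proof -
    have j: "j \<in> I" "J \<le> j" using that by (auto simp: B_def)
    have "1 / (2 * \<mu> * (g j)\<^sup>2) \<le> 1 / lam j"
      using lam_le[OF j] lam_pos[OF j(1)]
      by (intro divide_left_mono mult_pos_pos[OF less_le_trans]) auto
    thus ?thesis by simp
  qed
  have sB': "(\<lambda>j. 1 / \<mu> * (1 / (g j)\<^sup>2)) summable_on B" "(\<lambda>j. 1 / (2 * \<mu>) * (1 / (g j)\<^sup>2)) summable_on B"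
    by (rule summable_on_cmult_right[OF sB])+
  have slB: "(\<lambda>j. 1 / lam j) summable_on B"
    using lam_pos by (intro summable_on_comparison_test[OF sB'(1)] up) (auto simp: B_def less_imp_le)
  have slA: "(\<lambda>j. 1 / lam j) summable_on A" using fA by simp
  show "(\<lambda>j. 1 / lam j) summable_on I"
    unfolding I(1) by (rule summable_on_Un_disjoint[OF slA slB I(2)])
  have split: "(\<Sum>\<^sub>\<infinity>j\<in>I. 1 / lam j) = sum (\<lambda>j. 1 / lam j) A + (\<Sum>\<^sub>\<infinity>j\<in>B. 1 / lam j)"
    using fA infsum_Un_disjoint[OF slA slB I(2)] I(1) by simp
  have tB: "(\<Sum>\<^sub>\<infinity>j\<in>B. c * (1 / (g j)\<^sup>2)) = c * tail J" for c
    unfolding infsum_cmult_right' tail_def B_def ..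
  have "0 \<le> sum (\<lambda>j. 1 / lam j) A" using lam_pos by (intro sum_nonneg) (auto simp: A_def less_imp_le)
  moreover have "1 / (2 * \<mu>) * tail J \<le> (\<Sum>\<^sub>\<infinity>j\<in>B. 1 / lam j)"
    unfolding tB[symmetric] by (intro infsum_mono sB' slB lo)
  moreover have "rate / (2 * C) \<le> 1 / (2 * \<mu>) * tail J"
  proof -
    have "1 / (2 * \<mu>) * (real J / (C * (g J)\<^sup>2)) \<le> 1 / (2 * \<mu>) * tail J"
      using M_pos by (intro mult_left_mono tail_bounds J_in) auto
    thus ?thesis using J_ge M_pos by (simp add: rate_def field_simps)
  qed
  ultimately show "rate / (2 * C) \<le> (\<Sum>\<^sub>\<infinity>j\<in>I. 1 / lam j)" unfolding split by linarith
  have "sum (\<lambda>j. 1 / lam j) A \<le> of_nat (card A) * (2 * L * rate / real J)"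
    by (intro sum_bounded_above inverse_lam_le) (auto simp: A_def)
  also have "\<dots> \<le> real J * (2 * L * rate / real J)"
  proof (intro mult_right_mono)
    have "card A \<le> card {..<J}" by (rule card_mono) (auto simp: A_def)
    thus "real (card A) \<le> real J" by simp
    show "0 \<le> 2 * L * rate / real J" using L_ge_1 rate_pos by simp
  qed
  also have "\<dots> = 2 * L * rate" using J_ge by simp
  finally have uA: "sum (\<lambda>j. 1 / lam j) A \<le> 2 * L * rate" .
  have "(\<Sum>\<^sub>\<infinity>j\<in>B. 1 / lam j) \<le> 1 / \<mu> * tail J"
    unfolding tB[symmetric] by (intro infsum_mono sB' slB up)
  also have "\<dots> \<le> 1 / \<mu> * (C * real J / (g J)\<^sup>2)"
    using M_pos by (intro mult_left_mono tail_bounds J_in) auto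
  also have "\<dots> = C * rate" using J_ge M_pos by (simp add: rate_def field_simps)
  finally show "(\<Sum>\<^sub>\<infinity>j\<in>I. 1 / lam j) \<le> trace_const * rate" unfolding split trace_const_def using uA by (simp add: distrib_right)
qed

lemma partial_trace_le:
  assumes "finite F" "F \<subseteq> I"
  shows "(\<Sum>j\<in>F. 1 / lam j) \<le> trace_const * rate"
proof -
  have "(\<Sum>j\<in>F. 1 / lam j) \<le> (\<Sum>\<^sub>\<infinity>j\<in>I. 1 / lam j)"
    using assms lam_pos by (intro finite_sum_le_infsum summable_inverse_lam) (auto simp: less_imp_le)
  thus ?thesis using trace_upper by linarith
qed

end

section \<open>Orthonormal expansions and the adjoint\<close>

locale orthonormal_expansion =
  fixes I :: "nat set" and e :: "nat \<Rightarrow> 'a::{real_inner, polish_space}"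
  assumes basis: "orthonormal_basis I e"
begin

lemma inner_basis: "i \<in> I \<Longrightarrow> j \<in> I \<Longrightarrow> e i \<bullet> e j = (if i = j then 1 else 0)"
  using basis by (auto simp: orthonormal_basis_def)

definition proj :: "nat set \<Rightarrow> 'a \<Rightarrow> 'a" where
  "proj F x = (\<Sum>j\<in>F. (x \<bullet> e j) *\<^sub>R e j)"

lemma inner_comb_left:
  assumes "finite F" "F \<subseteq> I" "k \<in> I"
  shows "(\<Sum>j\<in>F. c j *\<^sub>R e j) \<bullet> e k = (if k \<in> F then c k else 0)"
proof -
  have "(\<Sum>j\<in>F. c j *\<^sub>R e j) \<bullet> e k = (\<Sum>j\<in>F. if j = k then c j else 0)"
    unfolding inner_sum_left using assms by (intro sum.cong) (auto simp: inner_basis)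
  thus ?thesis using assms(1) by simp
qed

lemma norm_comb:
  assumes "finite F" "F \<subseteq> I"
  shows "(norm (\<Sum>j\<in>F. c j *\<^sub>R e j))\<^sup>2 = (\<Sum>j\<in>F. (c j)\<^sup>2)"
proof -
  have "(norm (\<Sum>j\<in>F. c j *\<^sub>R e j))\<^sup>2 = (\<Sum>k\<in>F. c k * ((\<Sum>j\<in>F. c j *\<^sub>R e j) \<bullet> e k))"
    unfolding power2_norm_eq_inner by (subst inner_sum_right) simp
  also have "\<dots> = (\<Sum>k\<in>F. (c k)\<^sup>2)"
  proof (rule sum.cong[OF refl])
    fix k assume "k \<in> F"
    thus "c k * ((\<Sum>j\<in>F. c j *\<^sub>R e j) \<bullet> e k) = (c k)\<^sup>2"
      using assms inner_comb_left[OF assms, of k c] by (auto simp: power2_eq_square)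
  qed
  finally show ?thesis .
qed

lemma pythagoras_proj:
  assumes "finite F" "F \<subseteq> I"
  shows "(norm x)\<^sup>2 = (\<Sum>j\<in>F. (x \<bullet> e j)\<^sup>2) + (norm (x - proj F x))\<^sup>2"
proof -
  define p where "p = proj F x"
  have "p \<bullet> x = (\<Sum>j\<in>F. (x \<bullet> e j)\<^sup>2)"
    unfolding p_def proj_def inner_sum_left
    by (simp add: power2_eq_square inner_commute[of "e _" x])
  moreover have "p \<bullet> p = (\<Sum>j\<in>F. (x \<bullet> e j)\<^sup>2)"
    unfolding p_def proj_def power2_norm_eq_inner[symmetric] by (rule norm_comb[OF assms])
  moreover have "(x - p) \<bullet> (x - p) = x \<bullet> x - 2 * (p \<bullet> x) + p \<bullet> p"
    by (simp add: inner_diff_left inner_diff_right inner_commute[of x p])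
  ultimately show ?thesis
    unfolding power2_norm_eq_inner p_def by simp
qed

lemma bessel:
  assumes "finite F" "F \<subseteq> I"
  shows "(\<Sum>j\<in>F. (x \<bullet> e j)\<^sup>2) \<le> (norm x)\<^sup>2"
  using pythagoras_proj[OF assms, of x] by simp

text \<open>Together with density of the span, best approximation shows that the finite sections of the
  expansion converge.\<close>
lemma proj_best:
  assumes "finite F" "F \<subseteq> I" "y \<in> span (e ` F)"
  shows "norm (x - proj F x) \<le> norm (x - y)"
proof -
  have "orthogonal (x - proj F x) b" if b: "b \<in> e ` F" for b
  proof -
    obtain k where k: "k \<in> F" "b = e k" using b by blast
    have "proj F x \<bullet> e k = x \<bullet> e k"
      unfolding proj_def using inner_comb_left[OF assms(1,2), of k] k(1) assms(2) by auto
    thus ?thesis unfolding orthogonal_def k(2) inner_diff_left by simp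
  qed
  hence z: "orthogonal (x - proj F x) z" if "z \<in> span (e ` F)" for z
    using orthogonal_to_span[OF that] by blast
  have "proj F x \<in> span (e ` F)"
    unfolding proj_def by (intro span_sum span_scale span_base) auto
  hence "orthogonal (x - proj F x) (proj F x - y)" using assms(3) by (intro z span_diff)
  from norm_add_Pythagorean[OF this]
  have "(norm (x - y))\<^sup>2 = (norm (x - proj F x))\<^sup>2 + (norm (proj F x - y))\<^sup>2" by simp
  hence "(norm (x - proj F x))\<^sup>2 \<le> (norm (x - y))\<^sup>2" by simp
  thus ?thesis by (rule power2_le_imp_le) simp
qed

lemma proj_approximates:
  assumes "\<epsilon> > 0"
  shows "\<exists>F0. finite F0 \<and> F0 \<subseteq> I \<and> (\<forall>F. finite F \<longrightarrow> F0 \<subseteq> F \<longrightarrow> F \<subseteq> I \<longrightarrow> norm (x - proj F x) < \<epsilon>)"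
proof -
  have "x \<in> closure (span (e ` I))" using basis by (simp add: orthonormal_basis_def)
  then obtain y where y: "y \<in> span (e ` I)" "dist y x < \<epsilon>"
    using assms unfolding closure_approachable by blast
  obtain T r where T: "finite T" "T \<subseteq> e ` I" and yT: "y = (\<Sum>b\<in>T. r b *\<^sub>R b)"
    using y(1) unfolding span_explicit by blast
  have yT: "y \<in> span T" unfolding yT by (intro span_sum span_scale span_base)
  obtain F0 where F0: "finite F0" "F0 \<subseteq> I" "T = e ` F0" using T by (meson finite_subset_image)
  show ?thesis
  proof (intro exI[of _ F0] conjI F0(1,2) allI impI)
    fix F assume F: "finite F" "F0 \<subseteq> F" "F \<subseteq> I"
    have "y \<in> span (e ` F)" using yT F0(3) F(2) span_mono[of "e ` F0" "e ` F"] by blast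
    hence "norm (x - proj F x) \<le> norm (x - y)" by (rule proj_best[OF F(1,3)])
    thus "norm (x - proj F x) < \<epsilon>" using y(2) by (simp add: dist_norm norm_minus_commute)
  qed
qed

lemma expansion_has_sum: "((\<lambda>j. (x \<bullet> e j) *\<^sub>R e j) has_sum x) I"
  unfolding has_sum_def tendsto_iff eventually_finite_subsets_at_top
proof (intro allI impI)
  fix \<epsilon> :: real assume "0 < \<epsilon>"
  from proj_approximates[OF this, of x] obtain F0 where F0: "finite F0" "F0 \<subseteq> I"
    "\<And>F. finite F \<Longrightarrow> F0 \<subseteq> F \<Longrightarrow> F \<subseteq> I \<Longrightarrow> norm (x - proj F x) < \<epsilon>"
    by blast
  show "\<exists>X. finite X \<and> X \<subseteq> I \<and>
    (\<forall>Y. finite Y \<and> X \<subseteq> Y \<and> Y \<subseteq> I \<longrightarrow> dist (\<Sum>j\<in>Y. (x \<bullet> e j) *\<^sub>R e j) x < \<epsilon>)"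
  proof (intro exI[of _ F0] conjI F0(1,2) allI impI)
    fix Y assume "finite Y \<and> F0 \<subseteq> Y \<and> Y \<subseteq> I"
    hence "norm (x - proj Y x) < \<epsilon>" using F0(3) by blast
    thus "dist (\<Sum>j\<in>Y. (x \<bullet> e j) *\<^sub>R e j) x < \<epsilon>"
      by (simp add: proj_def dist_norm norm_minus_commute[of _ x])
  qed
qed

abbreviation sect :: "nat \<Rightarrow> nat set" where "sect n \<equiv> {j\<in>I. j \<le> n}"

lemma finite_sect [simp]: "finite (sect n)"
  by (rule finite_subset[of _ "{..n}"]) auto

lemma finite_subset_sect: "finite F \<Longrightarrow> F \<subseteq> I \<Longrightarrow> \<exists>n0. \<forall>n\<ge>n0. F \<subseteq> sect n"
proof (intro exI[of _ "Max F"] allI impI subsetI)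
  fix n j assume F: "finite F" "F \<subseteq> I" and n: "Max F \<le> n" and j: "j \<in> F"
  have "j \<le> Max F" by (rule Max_ge[OF F(1) j])
  thus "j \<in> sect n" using n F(2) j by auto
qed

lemma sect_mono: "m \<le> n \<Longrightarrow> sect m \<subseteq> sect n" by auto

lemma proj_sect_tendsto: "(\<lambda>n. proj (sect n) x) \<longlonglongrightarrow> x"
proof (rule LIMSEQ_I)
  fix r :: real assume "0 < r"
  from proj_approximates[OF this, of x] obtain F0 where F0: "finite F0" "F0 \<subseteq> I"
    "\<And>F. finite F \<Longrightarrow> F0 \<subseteq> F \<Longrightarrow> F \<subseteq> I \<Longrightarrow> norm (x - proj F x) < r"
    by blast
  obtain n0 where "\<forall>n\<ge>n0. F0 \<subseteq> sect n" using finite_subset_sect[OF F0(1,2)] by blast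
  hence "norm (x - proj (sect n) x) < r" if "n \<ge> n0" for n
    using F0(3)[OF finite_sect] that by blast
  thus "\<exists>no. \<forall>n\<ge>no. norm (proj (sect n) x - x) < r"
    unfolding norm_minus_commute[of _ x] by blast
qed

lemma coords_tendsto_norm: "(\<lambda>n. \<Sum>j\<in>sect n. (x \<bullet> e j)\<^sup>2) \<longlonglongrightarrow> (norm x)\<^sup>2"
proof -
  have "(\<lambda>n. (norm (proj (sect n) x))\<^sup>2) \<longlonglongrightarrow> (norm x)\<^sup>2"
    by (intro tendsto_intros proj_sect_tendsto)
  moreover have "(norm (proj (sect n) x))\<^sup>2 = (\<Sum>j\<in>sect n. (x \<bullet> e j)\<^sup>2)" for n
    unfolding proj_def by (rule norm_comb) auto
  ultimately show ?thesis by simp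
qed

lemma norm_le_of_coords:
  assumes "\<And>n. (\<Sum>j\<in>sect n. (x \<bullet> e j)\<^sup>2) \<le> B"
  shows "(norm x)\<^sup>2 \<le> B"
  using coords_tendsto_norm by (rule LIMSEQ_le_const2) (use assms in auto)

lemma coords_eqI:
  assumes "\<And>j. j \<in> I \<Longrightarrow> x \<bullet> e j = y \<bullet> e j"
  shows "x = y"
proof -
  have "(norm (x - y))\<^sup>2 \<le> 0"
    by (rule norm_le_of_coords) (simp add: inner_diff_left assms)
  thus ?thesis by simp
qed

lemma parseval_tendsto: "(\<lambda>n. \<Sum>j\<in>sect n. (x \<bullet> e j) * (y \<bullet> e j)) \<longlonglongrightarrow> x \<bullet> y"
proof -
  have "(\<lambda>n. proj (sect n) x \<bullet> y) \<longlonglongrightarrow> x \<bullet> y"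
    by (intro tendsto_intros proj_sect_tendsto)
  moreover have "proj (sect n) x \<bullet> y = (\<Sum>j\<in>sect n. (x \<bullet> e j) * (y \<bullet> e j))" for n
    unfolding proj_def inner_sum_left by (simp add: inner_commute)
  ultimately show ?thesis by simp
qed

text \<open>Here completeness of the source space enters. All vectors below that are given by infinitely many
  coordinates are obtained in this way.\<close>
lemma riesz_fischer:
  assumes B: "\<And>n. (\<Sum>j\<in>sect n. (c j)\<^sup>2) \<le> B"
  shows "\<exists>x. \<forall>j\<in>I. x \<bullet> e j = c j"
proof -
  define S where "S n = (\<Sum>j\<in>sect n. c j *\<^sub>R e j)" for n
  define T where "T n = (\<Sum>j\<in>sect n. (c j)\<^sup>2)" for n
  have "incseq T" unfolding T_def by (intro incseq_SucI sum_mono2) auto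
  moreover have "\<forall>n. T n \<le> B" using B by (simp add: T_def)
  ultimately obtain l where "T \<longlonglongrightarrow> l" by (rule incseq_convergent)
  hence "Cauchy T" by (rule LIMSEQ_imp_Cauchy)
  have diff: "(norm (S n - S m))\<^sup>2 = T n - T m" if "m \<le> n" for m n
  proof -
    have "S n - S m = (\<Sum>j\<in>sect n - sect m. c j *\<^sub>R e j)" "T n - T m = (\<Sum>j\<in>sect n - sect m. (c j)\<^sup>2)"
      unfolding S_def T_def using sect_mono[OF that] by (simp_all only: sum_diff[OF finite_sect])
    thus ?thesis using norm_comb[of "sect n - sect m" c] by auto
  qed
  have "Cauchy S"
  proof (rule metric_CauchyI)
    fix r :: real assume r: "0 < r"
    then obtain N where N: "\<And>m n. m \<ge> N \<Longrightarrow> n \<ge> N \<Longrightarrow> dist (T m) (T n) < r\<^sup>2"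
      using \<open>Cauchy T\<close> unfolding Cauchy_def by (metis zero_less_power)
    have le: "dist (S m) (S n) < r" if "m \<ge> N" "n \<ge> N" "m \<le> n" for m n
    proof -
      have "(norm (S n - S m))\<^sup>2 < r\<^sup>2" using diff[OF that(3)] N[OF that(1,2)] by (simp add: dist_real_def)
      thus ?thesis using r by (simp add: dist_norm norm_minus_commute power_less_imp_less_base)
    qed
    have "dist (S m) (S n) < r" if "m \<ge> N" "n \<ge> N" for m n
      using le[OF that] le[OF that(2,1)] by (cases "m \<le> n") (auto simp: dist_commute)
    thus "\<exists>N. \<forall>m\<ge>N. \<forall>n\<ge>N. dist (S m) (S n) < r" by blast
  qed
  then obtain x where x: "S \<longlonglongrightarrow> x" using Cauchy_convergent convergent_def by blast
  have "x \<bullet> e k = c k" if k: "k \<in> I" for k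
  proof -
    have "(\<lambda>n. S n \<bullet> e k) \<longlonglongrightarrow> x \<bullet> e k" by (intro tendsto_intros x)
    moreover have "eventually (\<lambda>n. S n \<bullet> e k = c k) sequentially"
      unfolding S_def using k by (auto simp: eventually_sequentially inner_comb_left intro!: exI[of _ k])
    ultimately show ?thesis using LIMSEQ_unique tendsto_eventually by metis
  qed
  thus ?thesis by blast
qed

lemma infsum_coords:
  assumes "\<And>j. j \<in> I \<Longrightarrow> x \<bullet> e j = c j"
  shows "(\<Sum>\<^sub>\<infinity>j\<in>I. c j *\<^sub>R e j) = x"
proof -
  have "((\<lambda>j. c j *\<^sub>R e j) has_sum x) I"
    using expansion_has_sum[of x] assms by (auto cong: has_sum_cong)
  thus ?thesis by (rule infsumI)
qed

lemma summable_comb_bounded: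
  assumes "(\<lambda>j. c j *\<^sub>R e j) summable_on I"
  shows "\<exists>x. \<forall>j\<in>I. x \<bullet> e j = c j"
proof -
  obtain x where x: "((\<lambda>j. c j *\<^sub>R e j) has_sum x) I" using assms by (auto simp: summable_on_def)
  have "x \<bullet> e k = c k" if k: "k \<in> I" for k
  proof -
    have "((\<lambda>j. (c j *\<^sub>R e j) \<bullet> e k) has_sum (x \<bullet> e k)) I"
      using has_sum_bounded_linear[OF bounded_linear_inner_left x] .
    moreover have "((\<lambda>j. (c j *\<^sub>R e j) \<bullet> e k) has_sum c k) I"
    proof -
      have "((\<lambda>j. (c j *\<^sub>R e j) \<bullet> e k) has_sum c k) {k}"
        using has_sum_finite[of "{k}" "\<lambda>j. (c j *\<^sub>R e j) \<bullet> e k"] k by (simp add: inner_basis)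
      thus ?thesis using k by (subst has_sum_cong_neutral[of "{k}"]) (auto simp: inner_basis)
    qed
    ultimately show ?thesis by (rule has_sum_unique)
  qed
  thus ?thesis by blast
qed

text \<open>The adjoint is defined by choice, so its defining property needs an existence proof. The vector
  representing \<open>\<langle>A x, y\<rangle>\<close> has the coordinates \<open>\<langle>A e\<^sub>j, y\<rangle>\<close>; they are square summable, as one sees by
  testing with the vector that has just these coordinates.\<close>
lemma inner_adjoint:
  fixes A :: "'a \<Rightarrow> 'b::real_inner"
  assumes A: "bounded_linear A"
  shows "A x \<bullet> y = x \<bullet> adjoint A y"
proof -
  obtain K where K: "\<And>x. norm (A x) \<le> norm x * K" using bounded_linear.bounded[OF A] by blast
  have "\<exists>z. \<forall>x. A x \<bullet> y = x \<bullet> z" for y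
  proof -
    define c where "c j = A (e j) \<bullet> y" for j
    have Bnd: "(\<Sum>j\<in>sect n. (c j)\<^sup>2) \<le> (K * norm y)\<^sup>2" for n
    proof -
      define s where "s = (\<Sum>j\<in>sect n. (c j)\<^sup>2)"
      define v where "v = (\<Sum>j\<in>sect n. c j *\<^sub>R e j)"
      have s0: "s \<ge> 0" unfolding s_def by (intro sum_nonneg) auto
      have nv: "(norm v)\<^sup>2 = s" unfolding v_def s_def by (rule norm_comb) auto
      have "s = A v \<bullet> y"
        unfolding v_def s_def using A
        by (simp add: linear_sum bounded_linear.linear linear_scale inner_sum_left c_def power2_eq_square)
      also have "\<dots> \<le> norm (A v) * norm y" by (rule norm_cauchy_schwarz)
      also have "\<dots> \<le> norm v * K * norm y" by (intro mult_right_mono K) auto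
      finally have le: "s \<le> norm v * (K * norm y)" by (simp add: mult.assoc)
      show ?thesis
      proof (cases "norm v = 0")
        case True
        thus ?thesis using nv by (simp add: s_def[symmetric])
      next
        case False
        hence "norm v > 0" by simp
        moreover have "norm v * norm v \<le> norm v * (K * norm y)" using le nv by (simp add: power2_eq_square)
        ultimately have "norm v \<le> K * norm y" by (simp only: mult_le_cancel_left_pos)
        hence "(norm v)\<^sup>2 \<le> (K * norm y)\<^sup>2" by (intro power_mono) auto
        thus ?thesis using nv by (simp add: s_def)
      qed
    qed
    obtain z where z: "\<forall>j\<in>I. z \<bullet> e j = c j" using riesz_fischer[OF Bnd] by blast
    have "A x \<bullet> y = x \<bullet> z" for x
    proof -
      have "(\<lambda>n. A (proj (sect n) x) \<bullet> y) \<longlonglongrightarrow> A x \<bullet> y"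
        by (intro tendsto_intros bounded_linear.tendsto[OF A] proj_sect_tendsto)
      moreover have "A (proj (sect n) x) \<bullet> y = (\<Sum>j\<in>sect n. (x \<bullet> e j) * (z \<bullet> e j))" for n
        unfolding proj_def using A z
        by (simp add: linear_sum bounded_linear.linear linear_scale inner_sum_left c_def)
      ultimately show ?thesis using parseval_tendsto[of x z] LIMSEQ_unique by fastforce
    qed
    thus ?thesis by blast
  qed
  hence "\<exists>f'. \<forall>x y. A x \<bullet> y = x \<bullet> f' y" by metis
  hence "\<forall>x y. A x \<bullet> y = x \<bullet> adjoint A y" unfolding adjoint_def by (rule someI_ex)
  thus ?thesis by blast
qed

end

section \<open>Operators diagonal in a common eigenbasis\<close>

locale linear_inverse_problem = balanced_spectrum I g C a M \<sigma> J + orthonormal_expansion I e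
  for I :: "nat set" and g :: "nat \<Rightarrow> real" and C :: real and a :: "nat \<Rightarrow> real"
    and M \<sigma> :: real and J :: nat and e :: "nat \<Rightarrow> 'a::{real_inner, polish_space}" +
  fixes G S :: "'a opr" and A :: "'a \<Rightarrow> 'b::{real_inner, complete_space}"
  assumes ops: "operator_assumptions I g a e G S A"
begin

lemma bounded_A: "bounded_linear A" using ops by (simp add: operator_assumptions_def)

lemma adj: "A x \<bullet> y = x \<bullet> adjoint A y"
  by (rule inner_adjoint[OF bounded_A])

lemmas linear_A = bounded_linear.linear[OF bounded_A]

lemma A_inner_basis: "j \<in> I \<Longrightarrow> A f \<bullet> A (e j) = (a j)\<^sup>2 * (f \<bullet> e j)"
  using ops unfolding adj by (simp add: operator_assumptions_def)

lemma A_basis_orthogonal: "i \<in> I \<Longrightarrow> j \<in> I \<Longrightarrow> A (e i) \<bullet> A (e j) = (if i = j then (a j)\<^sup>2 else 0)"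
  by (simp add: A_inner_basis inner_basis)

lemma S_basis: "j \<in> I \<Longrightarrow> e j \<in> op_dom S" "j \<in> I \<Longrightarrow> op_app S (e j) = (g j)\<^sup>2 *\<^sub>R e j"
  using ops by (auto simp: operator_assumptions_def)

lemma self_adjoint_S: "self_adjoint S" and self_adjoint_G: "self_adjoint G"
  using ops by (auto simp: operator_assumptions_def positive_sqrt_def positive_self_adjoint_def)

lemma symmetric_opr: "self_adjoint T \<Longrightarrow> x \<in> op_dom T \<Longrightarrow> y \<in> op_dom T \<Longrightarrow> op_app T x \<bullet> y = x \<bullet> op_app T y"
  unfolding self_adjoint_def by blast

lemma opr_linear:
  assumes "self_adjoint T"
  shows "subspace (op_dom T)"
    "x \<in> op_dom T \<Longrightarrow> y \<in> op_dom T \<Longrightarrow> op_app T (x + y) = op_app T x + op_app T y"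
    "x \<in> op_dom T \<Longrightarrow> op_app T (c *\<^sub>R x) = c *\<^sub>R op_app T x"
  using assms unfolding self_adjoint_def densely_defined_linear_def by blast+

lemma S_coord: "x \<in> op_dom S \<Longrightarrow> j \<in> I \<Longrightarrow> op_app S x \<bullet> e j = (g j)\<^sup>2 * (x \<bullet> e j)"
  using symmetric_opr[OF self_adjoint_S, of x "e j"] S_basis by simp

text \<open>A positive square root has the same eigenvectors: \<open>h = G e\<^sub>j - g\<^sub>j e\<^sub>j\<close> satisfies \<open>G h = - g\<^sub>j h\<close>, and a
  positive operator has no negative eigenvalue.\<close>
lemma G_basis:
  assumes j: "j \<in> I"
  shows "e j \<in> op_dom G" "op_app G (e j) = g j *\<^sub>R e j"
proof -
  have sq: "positive_sqrt G S" using ops by (simp add: operator_assumptions_def)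
  have d: "e j \<in> op_dom G" "op_app G (e j) \<in> op_dom G" "op_app G (op_app G (e j)) = (g j)\<^sup>2 *\<^sub>R e j"
    using sq S_basis[OF j] by (auto simp: positive_sqrt_def)
  show "e j \<in> op_dom G" by (rule d)
  note lin = opr_linear[OF self_adjoint_G]
  define h where "h = op_app G (e j) + (- g j) *\<^sub>R e j"
  have s: "(- g j) *\<^sub>R e j \<in> op_dom G" using lin(1) d(1) by (rule subspace_scale)
  have hd: "h \<in> op_dom G" unfolding h_def using lin(1) d(2) s by (rule subspace_add)
  have "op_app G h = op_app G (op_app G (e j)) + (- g j) *\<^sub>R op_app G (e j)"
    unfolding h_def lin(2)[OF d(2) s] lin(3)[OF d(1)] ..
  also have "\<dots> = (- g j) *\<^sub>R h"
    unfolding h_def d(3) by (simp add: algebra_simps power2_eq_square)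
  finally have "op_app G h \<bullet> h = - g j * (h \<bullet> h)" by simp
  moreover have "0 \<le> op_app G h \<bullet> h"
    using sq hd by (auto simp: positive_sqrt_def positive_self_adjoint_def)
  ultimately have "g j * (h \<bullet> h) \<le> 0" by simp
  hence "h \<bullet> h \<le> 0" using g_pos[OF j] by (simp add: mult_le_0_iff)
  hence "h = 0" using inner_gt_zero_iff[of h] by (meson not_le)
  thus "op_app G (e j) = g j *\<^sub>R e j" by (simp add: h_def)
qed

lemma ellipsoid_coords:
  assumes f: "f \<in> ellipsoid G M" and F: "finite F" "F \<subseteq> I"
  shows "(\<Sum>j\<in>F. (g j)\<^sup>2 * (f \<bullet> e j)\<^sup>2) \<le> M"
proof -
  have fG: "f \<in> op_dom G" "(norm (op_app G f))\<^sup>2 \<le> M" using f by (auto simp: ellipsoid_def)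
  have "op_app G f \<bullet> e j = g j * (f \<bullet> e j)" if "j \<in> I" for j
    using symmetric_opr[OF self_adjoint_G fG(1), of "e j"] G_basis[OF that] by simp
  hence "(\<Sum>j\<in>F. (g j)\<^sup>2 * (f \<bullet> e j)\<^sup>2) = (\<Sum>j\<in>F. (op_app G f \<bullet> e j)\<^sup>2)"
    using F(2) by (intro sum.cong) (auto simp: power_mult_distrib)
  also have "\<dots> \<le> (norm (op_app G f))\<^sup>2" by (rule bessel[OF F])
  finally show ?thesis using fG(2) by simp
qed

lemma opr_comb:
  assumes "self_adjoint T" "finite F" "\<And>j. j \<in> F \<Longrightarrow> e j \<in> op_dom T"
  shows "(\<Sum>j\<in>F. c j *\<^sub>R e j) \<in> op_dom T"
    "op_app T (\<Sum>j\<in>F. c j *\<^sub>R e j) = (\<Sum>j\<in>F. c j *\<^sub>R op_app T (e j))"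
proof -
  note lin = opr_linear[OF assms(1)]
  have "(\<Sum>j\<in>F. c j *\<^sub>R e j) \<in> op_dom T \<and> op_app T (\<Sum>j\<in>F. c j *\<^sub>R e j) = (\<Sum>j\<in>F. c j *\<^sub>R op_app T (e j))"
    using assms(2,3)
  proof (induction F rule: finite_induct)
    case empty
    have "op_app T (0 *\<^sub>R 0) = 0 *\<^sub>R op_app T 0" by (rule lin(3)) (rule subspace_0[OF lin(1)])
    thus ?case using subspace_0[OF lin(1)] by simp
  next
    case (insert k F)
    have k: "e k \<in> op_dom T" "c k *\<^sub>R e k \<in> op_dom T" using insert.prems subspace_scale[OF lin(1)] by auto
    show ?case using insert k lin(2)[OF k(2)] lin(3)[OF k(1)] subspace_add[OF lin(1) k(2)] by simp
  qed
  thus "(\<Sum>j\<in>F. c j *\<^sub>R e j) \<in> op_dom T"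
    "op_app T (\<Sum>j\<in>F. c j *\<^sub>R e j) = (\<Sum>j\<in>F. c j *\<^sub>R op_app T (e j))" by auto
qed

lemma comb_in_ellipsoid:
  assumes F: "finite F" "F \<subseteq> I" and le: "(\<Sum>j\<in>F. (g j)\<^sup>2 * (c j)\<^sup>2) \<le> M"
  shows "(\<Sum>j\<in>F. c j *\<^sub>R e j) \<in> ellipsoid G M"
proof -
  have "op_app G (\<Sum>j\<in>F. c j *\<^sub>R e j) = (\<Sum>j\<in>F. c j *\<^sub>R op_app G (e j))"
    using F G_basis by (intro opr_comb self_adjoint_G) auto
  also have "\<dots> = (\<Sum>j\<in>F. (g j * c j) *\<^sub>R e j)"
    using F(2) by (intro sum.cong) (auto simp: G_basis subset_eq)
  finally have "(norm (op_app G (\<Sum>j\<in>F. c j *\<^sub>R e j)))\<^sup>2 = (\<Sum>j\<in>F. (g j * c j)\<^sup>2)"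
    using norm_comb[OF F] by simp
  moreover have "(\<Sum>j\<in>F. c j *\<^sub>R e j) \<in> op_dom G"
    using F G_basis by (intro opr_comb self_adjoint_G) auto
  ultimately show ?thesis using le by (simp add: ellipsoid_def power_mult_distrib)
qed

text \<open>The inverse is a definite description; uniqueness of the preimage is seen in coordinates.\<close>
lemma op_inverse_F_basis:
  assumes j: "j \<in> I"
  shows "op_inverse (F_op A S \<sigma> \<mu>) (e j) = (1 / lam j) *\<^sub>R e j"
  unfolding op_inverse_def
proof (rule the_equality)
  let ?F = "F_op A S \<sigma> \<mu>"
  have coord: "op_app ?F y \<bullet> e k = lam k * (y \<bullet> e k)" if "y \<in> op_dom S" "k \<in> I" for y k
  proof -
    have "adjoint A (A y) \<bullet> e k = (a k)\<^sup>2 * (y \<bullet> e k)"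
      using A_inner_basis[OF that(2), of y] adj[of "e k" "A y"] by (simp add: inner_commute)
    thus ?thesis using S_coord[OF that]
      by (simp add: F_op_def inner_add_left lam_def algebra_simps)
  qed
  have dF: "op_dom ?F = op_dom S" by (simp add: F_op_def)
  have dom: "(1 / lam j) *\<^sub>R e j \<in> op_dom S"
    using opr_linear(1)[OF self_adjoint_S] S_basis(1)[OF j] by (rule subspace_scale)
  have "op_app ?F ((1 / lam j) *\<^sub>R e j) = e j"
    using lam_pos[OF j] j by (intro coords_eqI) (auto simp: coord dom inner_basis)
  thus "(1 / lam j) *\<^sub>R e j \<in> op_dom ?F \<and> op_app ?F ((1 / lam j) *\<^sub>R e j) = e j"
    using dom dF by simp
  fix y assume y: "y \<in> op_dom ?F \<and> op_app ?F y = e j"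
  show "y = (1 / lam j) *\<^sub>R e j"
  proof (rule coords_eqI)
    fix k assume k: "k \<in> I"
    have "lam k * (y \<bullet> e k) = e j \<bullet> e k" using coord[OF _ k, of y] y dF by simp
    thus "y \<bullet> e k = ((1 / lam j) *\<^sub>R e j) \<bullet> e k"
      using lam_pos[OF k] k j by (auto simp: inner_basis field_simps split: if_splits)
  qed
qed

lemma trace_eq: "op_trace I e (op_inverse (F_op A S \<sigma> \<mu>)) = (\<Sum>\<^sub>\<infinity>j\<in>I. 1 / lam j)"
  unfolding op_trace_def by (intro infsum_cong) (simp add: op_inverse_F_basis inner_basis)

abbreviation V :: "'a \<Rightarrow> 'a" where "V \<equiv> op_inverse (op_scale \<mu> S)"

text \<open>The preimage of \<open>h\<close> under the unbounded operator \<open>\<mu> G\<^sup>2\<close> is built from its coordinates. That it lies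
  in the domain is the maximality contained in self-adjointness.\<close>
lemma V_coord:
  "j \<in> I \<Longrightarrow> V h \<bullet> e j = (h \<bullet> e j) / (\<mu> * (g j)\<^sup>2)"
proof -
  define c where "c j = (h \<bullet> e j) / (\<mu> * (g j)\<^sup>2)" for j
  have gg: "\<mu> * (g j)\<^sup>2 > 0" if "j \<in> I" for j using mu_pos g_pos[OF that] by (intro mult_pos_pos) auto
  have j0: "1 \<in> I" using index_downward[OF J_in] J_ge by simp
  have "(\<Sum>j\<in>sect n. (c j)\<^sup>2) \<le> (norm ((1 / (\<mu> * (g 1)\<^sup>2)) *\<^sub>R h))\<^sup>2" for n
  proof -
    have "(\<Sum>j\<in>sect n. (c j)\<^sup>2) \<le> (\<Sum>j\<in>sect n. (((1 / (\<mu> * (g 1)\<^sup>2)) *\<^sub>R h) \<bullet> e j)\<^sup>2)"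
    proof (rule sum_mono)
      fix j assume "j \<in> sect n"
      hence j: "j \<in> I" by simp
      define p where "p k = \<mu> * (g k)\<^sup>2" for k
      have "(g 1)\<^sup>2 \<le> (g j)\<^sup>2" by (rule g_mono[OF j0 j index_pos[OF j]])
      hence "p 1 \<le> p j" unfolding p_def using less_imp_le[OF mu_pos] by (rule mult_left_mono)
      moreover have p: "p 1 > 0" "p j > 0" unfolding p_def by (rule gg[OF j0], rule gg[OF j])
      ultimately have "(p 1)\<^sup>2 \<le> (p j)\<^sup>2" by (intro power_mono) auto
      hence "(h \<bullet> e j)\<^sup>2 / (p j)\<^sup>2 \<le> (h \<bullet> e j)\<^sup>2 / (p 1)\<^sup>2" using p by (intro divide_left_mono mult_pos_pos zero_less_power) simp_all
      thus "(c j)\<^sup>2 \<le> (((1 / (\<mu> * (g 1)\<^sup>2)) *\<^sub>R h) \<bullet> e j)\<^sup>2"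
        unfolding c_def p_def[symmetric] inner_scaleR_left power_mult_distrib power_divide by simp
    qed
    also have "\<dots> \<le> (norm ((1 / (\<mu> * (g 1)\<^sup>2)) *\<^sub>R h))\<^sup>2" by (rule bessel) auto
    finally show ?thesis .
  qed
  from riesz_fischer[OF this] obtain y where y: "\<And>j. j \<in> I \<Longrightarrow> y \<bullet> e j = c j" by blast
  have "y \<in> op_dom S \<and> op_app S y = (1 / \<mu>) *\<^sub>R h"
  proof -
    have "op_app S x \<bullet> y = x \<bullet> ((1 / \<mu>) *\<^sub>R h)" if x: "x \<in> op_dom S" for x
    proof -
      have eq: "(op_app S x \<bullet> e j) * (y \<bullet> e j) = (x \<bullet> e j) * (((1 / \<mu>) *\<^sub>R h) \<bullet> e j)" if j: "j \<in> I" for j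
        using S_coord[OF x j] y[OF j] g_pos[OF j] by (simp add: c_def)
      have "(\<lambda>n. \<Sum>j\<in>sect n. (op_app S x \<bullet> e j) * (y \<bullet> e j)) =
          (\<lambda>n. \<Sum>j\<in>sect n. (x \<bullet> e j) * (((1 / \<mu>) *\<^sub>R h) \<bullet> e j))"
        by (intro ext sum.cong refl eq) auto
      with parseval_tendsto[of "op_app S x" y] parseval_tendsto[of x "(1 / \<mu>) *\<^sub>R h"]
      show ?thesis by (intro LIMSEQ_unique[of _ "op_app S x \<bullet> y"]) simp_all
    qed
    thus ?thesis using self_adjoint_S unfolding self_adjoint_def by blast
  qed
  hence ex: "y \<in> op_dom (op_scale \<mu> S) \<and> op_app (op_scale \<mu> S) y = h"
    using J_ge M_pos by (simp add: op_scale_def)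
  have uniq: "z = y" if z: "z \<in> op_dom (op_scale \<mu> S) \<and> op_app (op_scale \<mu> S) z = h" for z
  proof (rule coords_eqI)
    fix j assume j: "j \<in> I"
    have zS: "z \<in> op_dom S" "\<mu> *\<^sub>R op_app S z = h" using z by (auto simp: op_scale_def)
    have "h \<bullet> e j = \<mu> * (g j)\<^sup>2 * (z \<bullet> e j)"
      using S_coord[OF zS(1) j] unfolding zS(2)[symmetric] by simp
    moreover have "\<mu> * (g j)\<^sup>2 \<noteq> 0" using gg[OF j] by (rule less_imp_neq[symmetric])
    ultimately show "z \<bullet> e j = y \<bullet> e j" unfolding y[OF j] c_def
      by (simp only: nonzero_mult_div_cancel_left not_False_eq_True)
  qed
  have "V h = y" unfolding op_inverse_def using ex uniq by (rule the_equality)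
  thus "j \<in> I \<Longrightarrow> V h \<bullet> e j = (h \<bullet> e j) / (\<mu> * (g j)\<^sup>2)" using y by (simp add: c_def)
qed

text \<open>The prior variance of a functional that is split into finitely many coordinates and a general part;
  the cross term is what will cancel against the noise.\<close>
lemma V_add_comb:
  assumes F: "finite F" "F \<subseteq> I"
  shows "V ((\<Sum>j\<in>F. c j *\<^sub>R e j) + h) \<bullet> ((\<Sum>j\<in>F. c j *\<^sub>R e j) + h) =
    (\<Sum>j\<in>F. (c j)\<^sup>2 / (\<mu> * (g j)\<^sup>2)) + 2 * (\<Sum>j\<in>F. c j * (h \<bullet> e j) / (\<mu> * (g j)\<^sup>2)) + V h \<bullet> h"
proof -
  let ?x = "\<Sum>j\<in>F. c j *\<^sub>R e j"
  let ?d = "\<Sum>j\<in>F. (c j / (\<mu> * (g j)\<^sup>2)) *\<^sub>R e j"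
  have V: "V (?x + h) = ?d + V h"
  proof (rule coords_eqI)
    fix j assume j: "j \<in> I"
    show "V (?x + h) \<bullet> e j = (?d + V h) \<bullet> e j"
      unfolding inner_add_left V_coord[OF j] inner_comb_left[OF F j] add_divide_distrib by simp
  qed
  have xV: "?x \<bullet> V h = (\<Sum>j\<in>F. c j * (h \<bullet> e j) / (\<mu> * (g j)\<^sup>2))"
    unfolding inner_sum_left using F(2)
    by (intro sum.cong refl) (auto simp: inner_commute[of "e _" "V h"] V_coord subset_eq)
  have dh: "?d \<bullet> h = (\<Sum>j\<in>F. c j * (h \<bullet> e j) / (\<mu> * (g j)\<^sup>2))"
    unfolding inner_sum_left by (simp add: inner_commute[of "e _" h] mult_ac)
  have dx: "?d \<bullet> ?x = (\<Sum>j\<in>F. (c j)\<^sup>2 / (\<mu> * (g j)\<^sup>2))"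
  proof -
    have "?d \<bullet> ?x = (\<Sum>k\<in>F. c k * (?d \<bullet> e k))" by (subst inner_sum_right) simp
    also have "\<dots> = (\<Sum>k\<in>F. (c k)\<^sup>2 / (\<mu> * (g k)\<^sup>2))"
      using F(2) by (intro sum.cong refl) (auto simp: inner_comb_left[OF F] subset_eq power2_eq_square)
    finally show ?thesis .
  qed
  show ?thesis
    unfolding V inner_add_left inner_add_right dx dh using xV by (simp add: inner_commute[of "V h" ?x])
qed

end

section \<open>White noise and the Cameron-Martin formula\<close>

lemma noise_prob: "standard_gaussian_noise P W \<Longrightarrow> prob_space P"
  and noise_measurable: "standard_gaussian_noise P W \<Longrightarrow> W v \<in> borel_measurable P"
  by (auto simp: standard_gaussian_noise_def)

lemma noise_sum:
  assumes N: "standard_gaussian_noise P W" and F: "finite F"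
  shows "AE w in P. W (\<Sum>j\<in>F. c j *\<^sub>R v j) w = (\<Sum>j\<in>F. c j * W (v j) w)"
  using F
proof (induction F rule: finite_induct)
  case empty
  have "AE w in P. W (0 *\<^sub>R 0 + 0 *\<^sub>R 0) w = 0 * W 0 w + 0 * W 0 w"
    using N unfolding standard_gaussian_noise_def by blast
  thus ?case by simp
next
  case (insert k F)
  have "AE w in P. W (c k *\<^sub>R v k + 1 *\<^sub>R (\<Sum>j\<in>F. c j *\<^sub>R v j)) w = c k * W (v k) w + 1 * W (\<Sum>j\<in>F. c j *\<^sub>R v j) w"
    using N unfolding standard_gaussian_noise_def by blast
  thus ?case using insert.IH by eventually_elim (use insert.hyps in simp)
qed

lemma noise_scale:
  assumes N: "standard_gaussian_noise P W"
  shows "AE w in P. W (c *\<^sub>R v) w = c * W v w"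
  using noise_sum[OF N, of "{()}" "\<lambda>_. c" "\<lambda>_. v"] by simp

text \<open>The characteristic function subsumes the null vector, whose functional vanishes almost surely, and
  so replaces the case distinction on degenerate directions from here on.\<close>
lemma noise_char:
  assumes N: "standard_gaussian_noise P W"
  shows "(CLINT w|P. iexp (W v w)) = of_real (exp (- (norm v)\<^sup>2 / 2))"
proof -
  note [measurable] = noise_measurable[OF N]
  have unit: "(CLINT w|P. iexp (t * W u w)) = of_real (exp (- t\<^sup>2 / 2))" if "norm u = 1" for u t
  proof -
    have "distributed P lborel (W u) std_normal_density"
    proof -
      have "pairwise orthogonal {u} \<and> (\<forall>b\<in>{u}. norm b = 1)" using that by simp
      thus ?thesis using N unfolding standard_gaussian_noise_def by blast
    qed
    hence d: "distr P lborel (W u) = \<gamma>" by (rule distributed_distr_eq_density)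
    have "(CLINT w|P. iexp (t * W u w)) = (CLINT x|distr P lborel (W u). iexp (t * x))"
      by (subst integral_distr) auto
    also have "\<dots> = char \<gamma> t" unfolding d char_def ..
    finally show ?thesis unfolding char_std_normal_distribution by simp
  qed
  show ?thesis
  proof (cases "v = 0")
    case True
    have "AE w in P. W v w = 0" using noise_sum[OF N, of "{}" "\<lambda>_. 0" "\<lambda>_. 0"] True by simp
    hence "(CLINT w|P. iexp (W v w)) = (CLINT w|P. 1)"
      by (intro integral_cong_AE) (auto elim!: eventually_mono)
    thus ?thesis using True prob_space.prob_space[OF noise_prob[OF N]] by simp
  next
    case False
    define u where "u = (1 / norm v) *\<^sub>R v"
    have "norm u = 1" "v = norm v *\<^sub>R u" using False by (auto simp: u_def)
    hence "AE w in P. W v w = norm v * W u w" using noise_scale[OF N, of "norm v" u] by simp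
    hence "(CLINT w|P. iexp (W v w)) = (CLINT w|P. iexp (norm v * W u w))"
      by (intro integral_cong_AE) (auto elim!: eventually_mono)
    thus ?thesis using unit[OF \<open>norm u = 1\<close>] by simp
  qed
qed

lemma norm_orthogonal_sum:
  fixes v :: "'i \<Rightarrow> 'b::real_inner"
  assumes F: "finite F" and orth: "\<And>i j. i \<in> F \<Longrightarrow> j \<in> F \<Longrightarrow> i \<noteq> j \<Longrightarrow> v i \<bullet> v j = 0"
  shows "(norm (\<Sum>j\<in>F. c j *\<^sub>R v j))\<^sup>2 = (\<Sum>j\<in>F. (c j)\<^sup>2 * (norm (v j))\<^sup>2)"
proof -
  have "(\<Sum>i\<in>F. c i *\<^sub>R v i) \<bullet> (\<Sum>j\<in>F. c j *\<^sub>R v j) = (\<Sum>j\<in>F. \<Sum>i\<in>F. c i * c j * (v i \<bullet> v j))"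
    unfolding inner_sum_left inner_sum_right by (simp add: sum_distrib_left mult_ac)
  also have "\<dots> = (\<Sum>j\<in>F. \<Sum>i\<in>F. if i = j then (c j)\<^sup>2 * (v j \<bullet> v j) else 0)"
    using orth by (intro sum.cong refl) (auto simp: power2_eq_square)
  also have "\<dots> = (\<Sum>j\<in>F. (c j)\<^sup>2 * (v j \<bullet> v j))" using F by simp
  finally show ?thesis by (simp add: power2_norm_eq_inner)
qed

lemma noise_jointly_gaussian:
  fixes v :: "'i \<Rightarrow> 'b::real_inner"
  assumes N: "standard_gaussian_noise P W" and F: "finite F"
    and orth: "\<And>i j. i \<in> F \<Longrightarrow> j \<in> F \<Longrightarrow> i \<noteq> j \<Longrightarrow> v i \<bullet> v j = 0"
  shows "jointly_gaussian P F (\<lambda>j. W (v j)) (\<lambda>j. (norm (v j))\<^sup>2)"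
proof (intro jointly_gaussian.intro jointly_gaussian_axioms.intro noise_prob[OF N] F)
  note [measurable] = noise_measurable[OF N]
  fix t
  have "(CLINT w|P. iexp (\<Sum>j\<in>F. t j * W (v j) w)) = (CLINT w|P. iexp (W (\<Sum>j\<in>F. t j *\<^sub>R v j) w))"
    using noise_sum[OF N F, of t v] by (intro integral_cong_AE) (auto elim!: eventually_mono)
  thus "(CLINT w|P. iexp (\<Sum>j\<in>F. t j * W (v j) w)) = of_real (exp (- (\<Sum>j\<in>F. (t j)\<^sup>2 * (norm (v j))\<^sup>2) / 2))"
    unfolding noise_char[OF N] norm_orthogonal_sum[where v = v, OF F orth, of t, simplified] .
qed (use noise_measurable[OF N] in auto)

text \<open>The weight \<open>exp (c x - c\<^sup>2 / 2)\<close> shifts the standard normal distribution by \<open>c\<close>.\<close>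
lemma tilted_gaussian_char:
  "(CLINT x|\<gamma>. iexp (\<alpha> * x) * of_real (exp (c * x - c\<^sup>2 / 2))) =
     iexp (\<alpha> * c) * of_real (exp (- \<alpha>\<^sup>2 / 2))"
  "integrable \<gamma> (\<lambda>x. iexp (\<alpha> * x) * of_real (exp (c * x - c\<^sup>2 / 2)))"
proof -
  have d: "std_normal_density x * exp (c * x - c\<^sup>2 / 2) = std_normal_density (x - c)" for x
    by (simp add: std_normal_density_def exp_add[symmetric] exp_diff[symmetric] power2_eq_square algebra_simps diff_divide_distrib add_divide_distrib)
  have e: "std_normal_density x *\<^sub>R (iexp (\<alpha> * x) * of_real (exp (c * x - c\<^sup>2 / 2))) =
     std_normal_density (x - c) *\<^sub>R iexp (\<alpha> * x)" for x
    unfolding d[symmetric] by (simp add: scaleR_conv_of_real mult_ac)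
  have i0: "integrable \<gamma> (\<lambda>x. iexp (\<alpha> * x))"
    by (intro integrable_iexp_finite prob_space.finite_measure std_normal_prob_spaces) auto
  hence "integrable lborel (\<lambda>x. std_normal_density x *\<^sub>R iexp (\<alpha> * x))"
    by (subst (asm) integrable_density) auto
  hence i1: "integrable lborel (\<lambda>x. std_normal_density x *\<^sub>R (iexp (\<alpha> * c) * iexp (\<alpha> * x)))"
    by (simp only: mult_scaleR_right[symmetric] integrable_mult_right)
  have sh: "std_normal_density (x + c - c) *\<^sub>R iexp (\<alpha> * (x + c)) = std_normal_density x *\<^sub>R (iexp (\<alpha> * c) * iexp (\<alpha> * x))" for x
    by (simp add: exp_add[symmetric] algebra_simps)
  have i2: "integrable lborel (\<lambda>x. std_normal_density (x - c) *\<^sub>R iexp (\<alpha> * x))"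
    using lborel_integrable_real_affine_iff[of 1 "\<lambda>x. std_normal_density (x - c) *\<^sub>R iexp (\<alpha> * x)" c] i1
    by (simp only: sh add.commute[of c]) simp
  show "integrable \<gamma> (\<lambda>x. iexp (\<alpha> * x) * of_real (exp (c * x - c\<^sup>2 / 2)))"
    by (subst integrable_density) (use i2 in \<open>auto simp only: e, auto\<close>)
  have "(CLINT x|\<gamma>. iexp (\<alpha> * x) * of_real (exp (c * x - c\<^sup>2 / 2))) =
     (CLINT x|lborel. std_normal_density (x - c) *\<^sub>R iexp (\<alpha> * x))"
    by (subst integral_density) (auto simp only: e, auto)
  also have "\<dots> = (CLINT x|lborel. std_normal_density x *\<^sub>R (iexp (\<alpha> * c) * iexp (\<alpha> * x)))"
    by (subst lborel_integral_real_affine[of 1 _ c]) (simp_all only: sh add.commute[of c], simp_all)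
  also have "\<dots> = iexp (\<alpha> * c) * (CLINT x|lborel. std_normal_density x *\<^sub>R iexp (\<alpha> * x))"
    by (simp only: mult_scaleR_right[symmetric] integral_mult_right_zero)
  also have "(CLINT x|lborel. std_normal_density x *\<^sub>R iexp (\<alpha> * x)) = char \<gamma> \<alpha>"
    unfolding char_def by (subst integral_density) auto
  finally show "(CLINT x|\<gamma>. iexp (\<alpha> * x) * of_real (exp (c * x - c\<^sup>2 / 2))) =
     iexp (\<alpha> * c) * of_real (exp (- \<alpha>\<^sup>2 / 2))" unfolding char_std_normal_distribution by simp
qed

text \<open>The Cameron-Martin density of a shift by \<open>h\<close>.\<close>
definition tilt :: "('b::real_inner \<Rightarrow> 'w \<Rightarrow> real) \<Rightarrow> 'b \<Rightarrow> 'w \<Rightarrow> real" where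
  "tilt W h w = exp (W h w - (norm h)\<^sup>2 / 2)"

text \<open>Split \<open>u\<close> into its part along \<open>h\<close> and an orthogonal rest \<open>p\<close>. The noise in these two directions is
  independent, and only the first one is shifted.\<close>
lemma noise_tilted_char:
  fixes W :: "'b::real_inner \<Rightarrow> 'w \<Rightarrow> real"
  assumes N: "standard_gaussian_noise P W"
  shows "(CLINT w|P. tilt W h w *\<^sub>R iexp (W u w)) = iexp (u \<bullet> h) * of_real (exp (- (norm u)\<^sup>2 / 2))"
proof -
  note [measurable] = noise_measurable[OF N]
  define n where "n = (1 / norm h) *\<^sub>R h"
  define \<alpha> where "\<alpha> = u \<bullet> n"
  \<comment> \<open>If \<open>h = 0\<close>, then \<open>n = 0\<close> by division by zero, and the decomposition remains valid.\<close>
  define p where "p = u - \<alpha> *\<^sub>R n"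
  have hn: "h = norm h *\<^sub>R n" by (cases "h = 0") (auto simp: n_def)
  have nn: "norm n = (if h = 0 then 0 else 1)" by (auto simp: n_def)
  have pn: "p \<bullet> n = 0"
  proof (cases "h = 0")
    case False
    hence "n \<bullet> n = 1" using nn by (simp add: norm_eq_1)
    thus ?thesis by (simp add: p_def \<alpha>_def inner_diff_left)
  qed (simp add: n_def)
  have u: "u = \<alpha> *\<^sub>R n + 1 *\<^sub>R p" by (simp add: p_def)
  define X where "X i = W (if i then n else p)" for i
  have XT: "X True = W n" and XF: "X False = W p" by (auto simp: X_def)
  have [measurable]: "X i \<in> borel_measurable P" for i by (simp add: X_def)
  define f where "f i x = (if i then iexp (\<alpha> * x) * of_real (exp (norm h * x - (norm h)\<^sup>2 / 2)) else iexp x)" for i x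
  have AEu: "AE w in P. W u w = \<alpha> * W n w + 1 * W p w"
    unfolding u using N unfolding standard_gaussian_noise_def by blast
  have AEh: "AE w in P. W h w = norm h * W n w" 
    using noise_scale[OF N, of "norm h" n] hn by simp
  have "(CLINT w|P. tilt W h w *\<^sub>R iexp (W u w)) = (CLINT w|P. (\<Prod>i\<in>UNIV. f i (X i w)))"
  proof (rule integral_cong_AE)
    show "AE w in P. tilt W h w *\<^sub>R iexp (W u w) = (\<Prod>i\<in>UNIV. f i (X i w))"
      using AEu AEh
    proof eventually_elim
      case (elim w)
      show ?case
        unfolding tilt_def elim by (simp add: UNIV_bool f_def XT XF scaleR_conv_of_real distrib_left exp_add mult_ac)
    qed
  qed (unfold tilt_def f_def, measurable)
  also have "\<dots> = (\<Prod>i\<in>UNIV. CLINT x|\<gamma>. f i (sqrt ((norm (if i then n else p))\<^sup>2) * x))"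
  proof (rule jointly_gaussian.integral_prod)
    show "jointly_gaussian P UNIV X (\<lambda>i. (norm (if i then n else p))\<^sup>2)"
      unfolding X_def by (rule noise_jointly_gaussian[OF N]) (auto simp: pn inner_commute[of n p])
    show "integrable \<gamma> (\<lambda>x. f i (sqrt ((norm (if i then n else p))\<^sup>2) * x))" for i
    proof (cases "i \<and> h \<noteq> 0")
      case True
      thus ?thesis using tilted_gaussian_char(2)[of \<alpha> "norm h"] nn by (simp add: f_def)
    next
      case False
      hence "(\<lambda>x. f i (sqrt ((norm (if i then n else p))\<^sup>2) * x)) = (\<lambda>x. iexp (if i then 0 else norm p * x))"
        using nn by (auto simp: f_def)
      thus ?thesis
        by (simp only:) (intro integrable_iexp_finite prob_space.finite_measure std_normal_prob_spaces, auto)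
    qed
    show "f i \<in> borel_measurable borel" for i unfolding f_def by (cases i) auto
  qed
  also have "\<dots> = (CLINT x|\<gamma>. f True (norm n * x)) * (CLINT x|\<gamma>. f False (norm p * x))"
    by (simp add: UNIV_bool mult.commute)
  also have "(CLINT x|\<gamma>. f False (norm p * x)) = of_real (exp (- (norm p)\<^sup>2 / 2))"
    using fun_cong[OF char_std_normal_distribution, of "norm p"] by (simp add: f_def char_def)
  also have "(CLINT x|\<gamma>. f True (norm n * x)) = iexp (\<alpha> * norm h) * of_real (exp (- \<alpha>\<^sup>2 / 2))"
  proof (cases "h = 0")
    case True
    thus ?thesis using prob_space.prob_space[OF std_normal_prob_spaces(1)] by (simp add: f_def \<alpha>_def n_def)
  next
    case False
    thus ?thesis using tilted_gaussian_char(1)[of \<alpha> "norm h"] nn by (simp add: f_def)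
  qed
  also have "iexp (\<alpha> * norm h) * of_real (exp (- \<alpha>\<^sup>2 / 2)) * of_real (exp (- (norm p)\<^sup>2 / 2)) =
     iexp (u \<bullet> h) * of_real (exp (- (norm u)\<^sup>2 / 2))"
  proof -
    have "(norm u)\<^sup>2 = \<alpha>\<^sup>2 + (norm p)\<^sup>2"
    proof -
      have "(norm u)\<^sup>2 = \<alpha>\<^sup>2 * (norm n)\<^sup>2 + (norm p)\<^sup>2"
        using norm_add_Pythagorean[of "\<alpha> *\<^sub>R n" p] pn
        by (simp add: u[symmetric] orthogonal_def inner_commute[of n p] power_mult_distrib) (simp add: p_def)
      thus ?thesis using nn by (cases "h = 0") (auto simp: \<alpha>_def n_def)
    qed
    moreover have "u \<bullet> h = \<alpha> * norm h"
      by (subst hn) (simp add: \<alpha>_def)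
    ultimately show ?thesis by (simp add: exp_add[symmetric] add_divide_distrib flip: of_real_mult)
  qed
  finally show ?thesis .
qed

lemma noise_tilt: 
  assumes N: "standard_gaussian_noise P W"
  shows "finite_measure (density P (\<lambda>w. ennreal (tilt W h w)))" "tilt W h \<in> borel_measurable P"
proof -
  note [measurable] = noise_measurable[OF N]
  show m[measurable]: "tilt W h \<in> borel_measurable P" unfolding tilt_def by measurable
  have "(CLINT w|P. tilt W h w *\<^sub>R iexp (W 0 w)) = 1" unfolding noise_tilted_char[OF N] by simp
  hence "(CLINT w|P. tilt W h w *\<^sub>R iexp (W 0 w)) \<noteq> 0" by simp
  hence "integrable P (\<lambda>w. tilt W h w *\<^sub>R iexp (W 0 w))" by (metis not_integrable_integral_eq)
  hence "integrable P (\<lambda>w. norm (tilt W h w *\<^sub>R iexp (W 0 w)))" by (rule integrable_norm)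
  hence "integrable P (tilt W h)" by (simp add: tilt_def[abs_def])
  moreover have "0 \<le> tilt W h w" for w by (simp add: tilt_def)
  ultimately show "finite_measure (density P (\<lambda>w. ennreal (tilt W h w)))"
    by (intro finite_measureI) (simp add: emeasure_density nn_integral_eq_integral cong: nn_integral_cong)
qed

lemma data_map_measurable:
  assumes "\<And>v. X v \<in> borel_measurable M"
  shows "(\<lambda>w v. X v w) \<in> measurable M data_space"
  using assms unfolding data_space_def
  by (intro measurable_PiM_single') (auto simp: space_PiM)

lemma observation_measurable:
  assumes N: "standard_gaussian_noise P W"
  shows "observation A s W f \<in> measurable P data_space"
proof -
  note [measurable] = noise_measurable[OF N]
  have "(\<lambda>w v. A f \<bullet> v + s * W v w) \<in> measurable P data_space"
    by (rule data_map_measurable) measurable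
  thus ?thesis by (simp add: observation_def[abs_def])
qed

text \<open>For an almost surely linear process a linear combination of its values is again a value, so the
  one-dimensional characteristic functions determine the whole law.\<close>
lemma linear_process_law_unique:
  fixes X1 :: "'b::real_vector \<Rightarrow> 'w1 \<Rightarrow> real" and X2 :: "'b \<Rightarrow> 'w2 \<Rightarrow> real"
  assumes fin: "finite_measure M1" "finite_measure M2"
    and meas: "\<And>v. X1 v \<in> borel_measurable M1" "\<And>v. X2 v \<in> borel_measurable M2"
    and lin1: "\<And>F t. finite F \<Longrightarrow> AE w in M1. X1 (\<Sum>v\<in>F. t v *\<^sub>R v) w = (\<Sum>v\<in>F. t v * X1 v w)"
    and lin2: "\<And>F t. finite F \<Longrightarrow> AE w in M2. X2 (\<Sum>v\<in>F. t v *\<^sub>R v) w = (\<Sum>v\<in>F. t v * X2 v w)"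
    and eq: "\<And>u. (CLINT w|M1. iexp (X1 u w)) = (CLINT w|M2. iexp (X2 u w))"
  shows "distr M1 data_space (\<lambda>w v. X1 v w) = distr M2 data_space (\<lambda>w v. X2 v w)"
proof -
  note [measurable] = meas
  have "distr M1 (\<Pi>\<^sub>M j\<in>UNIV. borel) (\<lambda>w. \<lambda>j\<in>UNIV. X1 j w) = distr M2 (\<Pi>\<^sub>M j\<in>UNIV. borel) (\<lambda>w. \<lambda>j\<in>UNIV. X2 j w)"
  proof (rule charfun_determines_process_law[OF fin meas])
    fix F :: "'b set" and t assume F: "finite F"
    have "(CLINT w|M1. iexp (\<Sum>v\<in>F. t v * X1 v w)) = (CLINT w|M1. iexp (X1 (\<Sum>v\<in>F. t v *\<^sub>R v) w))"
      using lin1[OF F, of t] by (intro integral_cong_AE) (auto elim!: eventually_mono)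
    moreover have "(CLINT w|M2. iexp (\<Sum>v\<in>F. t v * X2 v w)) = (CLINT w|M2. iexp (X2 (\<Sum>v\<in>F. t v *\<^sub>R v) w))"
      using lin2[OF F, of t] by (intro integral_cong_AE) (auto elim!: eventually_mono)
    ultimately show "(CLINT w|M1. iexp (\<Sum>v\<in>F. t v * X1 v w)) = (CLINT w|M2. iexp (\<Sum>v\<in>F. t v * X2 v w))"
      using eq by simp
  qed
  thus ?thesis by (simp add: data_space_def restrict_def)
qed

lemma observation_linear:
  assumes N: "standard_gaussian_noise P W" and F: "finite F"
  shows "AE w in P. observation A s W f w (\<Sum>v\<in>F. t v *\<^sub>R v) = (\<Sum>v\<in>F. t v * observation A s W f w v)"
  using noise_sum[OF N F, of t "\<lambda>v. v"]
  by eventually_elim (simp add: observation_def inner_sum_right sum.distrib sum_distrib_left algebra_simps)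

text \<open>Both processes are almost surely linear, so it suffices to compare the characteristic functions of
  single functionals, and these are known for tilted noise. The base point \<open>z\<close> is any parameter without
  signal, so that the data under \<open>z\<close> are pure noise.\<close>
lemma cameron_martin:
  fixes A :: "'a::real_inner \<Rightarrow> 'b::real_inner"
  assumes N: "standard_gaussian_noise P W" and s: "s > 0" and A0: "A z = 0"
  shows "distr P data_space (observation A s W f) =
    distr (density P (\<lambda>w. ennreal (tilt W ((1 / s) *\<^sub>R A f) w))) data_space (observation A s W z)"
proof -
  note [measurable] = noise_measurable[OF N] noise_tilt(2)[OF N]
  let ?h = "(1 / s) *\<^sub>R A f"
  let ?D = "density P (\<lambda>w. ennreal (tilt W ?h w))"
  have m: "(\<lambda>w. observation A s W f w v) \<in> borel_measurable P" for f v
    unfolding observation_def by measurable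
  have ch: "(CLINT w|P. iexp (s * W u w)) = of_real (exp (- (norm (s *\<^sub>R u))\<^sup>2 / 2))" for u
  proof -
    have "(CLINT w|P. iexp (s * W u w)) = (CLINT w|P. iexp (W (s *\<^sub>R u) w))"
      using noise_scale[OF N, of s u] by (intro integral_cong_AE) (auto elim!: eventually_mono)
    thus ?thesis unfolding noise_char[OF N] .
  qed
  have "distr P data_space (\<lambda>w v. observation A s W f w v) = distr ?D data_space (\<lambda>w v. observation A s W z w v)"
  proof (rule linear_process_law_unique)
    show "finite_measure P" by (intro prob_space.finite_measure noise_prob[OF N])
    show "finite_measure ?D" by (rule noise_tilt[OF N])
    fix u
    have "(CLINT w|P. iexp (observation A s W f w u)) = (CLINT w|P. iexp (A f \<bullet> u) * iexp (s * W u w))"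
      by (simp add: observation_def distrib_left exp_add)
    also have "\<dots> = iexp (A f \<bullet> u) * of_real (exp (- (norm (s *\<^sub>R u))\<^sup>2 / 2))"
      unfolding integral_mult_right_zero ch ..
    also have "\<dots> = (CLINT w|P. tilt W ?h w *\<^sub>R iexp (W (s *\<^sub>R u) w))"
      unfolding noise_tilted_char[OF N] using s by (simp add: inner_commute)
    also have "\<dots> = (CLINT w|P. tilt W ?h w *\<^sub>R iexp (s * W u w))"
      using noise_scale[OF N, of s u] by (intro integral_cong_AE) (auto elim!: eventually_mono)
    also have "\<dots> = (CLINT w|?D. iexp (observation A s W z w u))"
      by (subst integral_density) (auto simp: tilt_def observation_def A0)
    finally show "(CLINT w|P. iexp (observation A s W f w u)) = (CLINT w|?D. iexp (observation A s W z w u))" .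
  next
    fix F t assume F: "finite (F :: 'b set)"
    show "AE w in P. observation A s W f w (\<Sum>v\<in>F. t v *\<^sub>R v) = (\<Sum>v\<in>F. t v * observation A s W f w v)"
      by (rule observation_linear[OF N F])
    show "AE w in ?D. observation A s W z w (\<Sum>v\<in>F. t v *\<^sub>R v) = (\<Sum>v\<in>F. t v * observation A s W z w v)"
      using observation_linear[OF N F, where A=A and f=z and s=s and t=t]
      by (subst AE_density) (auto elim!: eventually_mono)
  qed (use m in auto)
  thus ?thesis by (simp only: eta_contract_eq)
qed

section \<open>The penalized estimator\<close>

locale gaussian_inverse_problem = linear_inverse_problem I g C a M \<sigma> J e G S A
  for I g C a M \<sigma> J and e :: "nat \<Rightarrow> 'a::{real_inner, polish_space}" and G S
    and A :: "'a \<Rightarrow> 'b::{real_inner, complete_space}" +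
  fixes P :: "'w measure" and W :: "'b \<Rightarrow> 'w \<Rightarrow> real"
  assumes noise: "standard_gaussian_noise P W"
begin

sublocale P: prob_space P by (rule noise_prob[OF noise])

lemmas W_measurable [measurable] = noise_measurable[OF noise]

abbreviation obs :: "'a \<Rightarrow> 'w \<Rightarrow> 'b \<Rightarrow> real" where "obs \<equiv> observation A \<sigma> W"
abbreviation mle :: "('b \<Rightarrow> real) \<Rightarrow> 'a" where "mle \<equiv> penalized_mle I e A S \<sigma> \<mu>"

lemmas obs_measurable [measurable] = observation_measurable[OF noise, of A \<sigma>]

text \<open>The direction of the data space that is read by the \<open>j\<close>-th coordinate of the estimator.\<close>
definition dir :: "nat \<Rightarrow> 'b" where "dir j = A ((1 / lam j) *\<^sub>R e j)"

definition coef :: "nat \<Rightarrow> ('b \<Rightarrow> real) \<Rightarrow> real" where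
  "coef j y = (1 / \<sigma>\<^sup>2) * y (dir j)"

lemma mle_eq: "mle y = (\<Sum>\<^sub>\<infinity>j\<in>I. coef j y *\<^sub>R e j)"
  unfolding penalized_mle_def by (intro infsum_cong) (simp add: coef_def dir_def op_inverse_F_basis)

lemma dir_eq: "dir j = (1 / lam j) *\<^sub>R A (e j)"
  unfolding dir_def by (rule linear_scale[OF linear_A])

lemma dir_orthogonal: "i \<in> I \<Longrightarrow> j \<in> I \<Longrightarrow> i \<noteq> j \<Longrightarrow> dir i \<bullet> dir j = 0"
  by (simp add: dir_eq A_basis_orthogonal)

lemma dir_norm: "j \<in> I \<Longrightarrow> (norm (dir j))\<^sup>2 = (a j)\<^sup>2 / (lam j)\<^sup>2"
  unfolding power2_norm_eq_inner dir_eq by (simp add: A_basis_orthogonal power2_eq_square)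

lemma coef_measurable [measurable]: "coef j \<in> borel_measurable data_space"
  unfolding coef_def data_space_def by measurable

text \<open>On the measurable set where the squared coordinates are summable, the estimator is the limit of its
  finite sections; elsewhere the series diverges and its value is \<open>0\<close> by convention.\<close>
lemma mle_measurable: "mle \<in> estimators"
proof -
  define good where "good = {y \<in> space data_space. \<exists>K::nat. \<forall>n. (\<Sum>j\<in>sect n. (coef j y)\<^sup>2) \<le> real K}"
  have [measurable]: "good \<in> sets data_space" unfolding good_def by measurable
  define u where "u n y = indicat_real good y *\<^sub>R (\<Sum>j\<in>sect n. coef j y *\<^sub>R e j)" for n y
  have um: "u n \<in> borel_measurable data_space" for n
    unfolding u_def by measurable
  have "(\<lambda>n. u n y) \<longlonglongrightarrow> mle y" if y: "y \<in> space data_space" for y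
  proof (cases "y \<in> good")
    case True
    then obtain K where "\<And>n. (\<Sum>j\<in>sect n. (coef j y)\<^sup>2) \<le> K" by (auto simp: good_def)
    from riesz_fischer[OF this] obtain x where x: "\<And>j. j \<in> I \<Longrightarrow> x \<bullet> e j = coef j y" by blast
    have "u n y = proj (sect n) x" for n
      unfolding u_def proj_def using True x by simp
    thus ?thesis using proj_sect_tendsto[of x] infsum_coords[OF x] by (simp add: mle_eq)
  next
    case False
    have "\<not> (\<lambda>j. coef j y *\<^sub>R e j) summable_on I"
    proof
      assume "(\<lambda>j. coef j y *\<^sub>R e j) summable_on I"
      from summable_comb_bounded[OF this] obtain x where x: "\<And>j. j \<in> I \<Longrightarrow> x \<bullet> e j = coef j y" by blast
      obtain K :: nat where K: "(norm x)\<^sup>2 \<le> real K" using real_arch_simple by blast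
      have "(\<Sum>j\<in>sect n. (coef j y)\<^sup>2) \<le> real K" for n
        using bessel[OF finite_sect, of n x] x K by simp
      thus False using False y by (auto simp: good_def)
    qed
    hence "mle y = 0" unfolding mle_eq by (rule infsum_not_exists)
    thus ?thesis using False by (simp add: u_def)
  qed
  from borel_measurable_LIMSEQ_metric[OF um this] show ?thesis by (simp add: estimators_def)
qed

definition noise_coord :: "nat \<Rightarrow> 'w \<Rightarrow> real" where "noise_coord j w = (1 / \<sigma>) * W (dir j) w"

lemma noise_coord_measurable [measurable]: "noise_coord j \<in> borel_measurable P"
  unfolding noise_coord_def by measurable

definition noise_var :: "nat \<Rightarrow> real" where "noise_var j = (1 / \<sigma>)\<^sup>2 * (norm (dir j))\<^sup>2"

lemma noise_var_eq: "j \<in> I \<Longrightarrow> noise_var j = (a j)\<^sup>2 / \<sigma>\<^sup>2 / (lam j)\<^sup>2"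
  by (simp add: noise_var_def dir_norm power_divide)

lemma noise_var_le: "j \<in> I \<Longrightarrow> noise_var j \<le> 1 / lam j"
proof -
  assume j: "j \<in> I"
  have "noise_var j \<le> lam j / (lam j)\<^sup>2"
    unfolding noise_var_eq[OF j] by (intro divide_right_mono lam_ge_data) simp
  thus ?thesis using lam_pos[OF j] by (simp add: power2_eq_square)
qed

lemma coef_obs:
  assumes j: "j \<in> I"
  shows "coef j (obs f w) - f \<bullet> e j = noise_coord j w - (\<mu> * (g j)\<^sup>2 / lam j) * (f \<bullet> e j)"
proof -
  define b where "b = \<mu> * (g j)\<^sup>2 / lam j"
  have "(a j)\<^sup>2 / \<sigma>\<^sup>2 = lam j - \<mu> * (g j)\<^sup>2" by (simp add: lam_def)
  hence "(a j)\<^sup>2 / \<sigma>\<^sup>2 / lam j = 1 - b" unfolding b_def using lam_pos[OF j]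
    by (simp only: diff_divide_distrib divide_self less_imp_neq[symmetric] not_False_eq_True)
  moreover have "coef j (obs f w) = ((a j)\<^sup>2 / \<sigma>\<^sup>2 / lam j) * (f \<bullet> e j) + noise_coord j w"
    using sigma_pos
    by (simp add: coef_def observation_def dir_eq A_inner_basis[OF j] noise_coord_def distrib_left power2_eq_square)
  ultimately have "coef j (obs f w) = (1 - b) * (f \<bullet> e j) + noise_coord j w" by (simp only:)
  thus ?thesis unfolding b_def[symmetric] by (simp add: left_diff_distrib)
qed

lemma noise_coord_jointly_gaussian:
  assumes "finite F" "F \<subseteq> I"
  shows "jointly_gaussian P F noise_coord noise_var"
proof -
  interpret jointly_gaussian P F "\<lambda>j. W (dir j)" "\<lambda>j. (norm (dir j))\<^sup>2"
    using assms dir_orthogonal by (intro noise_jointly_gaussian[OF noise]) auto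
  show ?thesis using scaled[of "1 / \<sigma>"] by (simp only: noise_coord_def[abs_def] noise_var_def[abs_def])
qed

text \<open>The exponent \<open>tilt_rate\<close> is the largest one for which all exponential moments of the squared
  coordinates are under control, by \<open>inverse_lam_le\<close>. The threshold \<open>energy\<close> is then twice the bound
  of the trace, to absorb the exponential moment, plus the amount that gains a factor \<open>exp (- J)\<close>.\<close>
definition energy :: real where "energy = (2 * trace_const + 8 * L) * rate"
definition tilt_rate :: real where "tilt_rate = real J / (8 * L * rate)"

lemma tilt_rate_pos: "tilt_rate > 0"
  using J_ge L_ge_1 rate_pos by (simp add: tilt_rate_def)

lemma tilt_rate_lam: "j \<in> I \<Longrightarrow> 4 * tilt_rate * (1 / lam j) \<le> 1"
proof -
  assume j: "j \<in> I"
  have "4 * tilt_rate * (1 / lam j) \<le> 4 * tilt_rate * (2 * L * rate / real J)"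
    using tilt_rate_pos by (intro mult_left_mono inverse_lam_le j) auto
  also have "\<dots> = 1" using J_ge L_ge_1 rate_pos by (simp add: tilt_rate_def)
  finally show ?thesis .
qed

lemma tilt_exponent:
  assumes "finite F" "F \<subseteq> I"
  shows "2 * tilt_rate * (\<Sum>j\<in>F. 1 / lam j) - tilt_rate * energy \<le> - real J"
proof -
  have "2 * tilt_rate * (\<Sum>j\<in>F. 1 / lam j) \<le> 2 * tilt_rate * (trace_const * rate)"
    using tilt_rate_pos by (intro mult_left_mono partial_trace_le assms) auto
  moreover have "2 * tilt_rate * (trace_const * rate) - tilt_rate * energy = - (tilt_rate * (8 * L * rate))"
    by (simp add: energy_def algebra_simps)
  moreover have "tilt_rate * (8 * L * rate) = real J" using L_ge_1 rate_pos by (simp add: tilt_rate_def)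
  ultimately show ?thesis by linarith
qed

lemma noise_energy_tail:
  assumes F: "finite F" "F \<subseteq> I"
  shows "measure P {w \<in> space P. (\<Sum>j\<in>F. (noise_coord j w)\<^sup>2) > energy} \<le> exp (- real J)"
proof -
  have "(\<integral>\<^sup>+w. ennreal (exp (tilt_rate * (\<Sum>j\<in>F. (noise_coord j w)\<^sup>2))) \<partial>P) \<le> ennreal (exp (2 * tilt_rate * (\<Sum>j\<in>F. noise_var j)))"
  proof (rule jointly_gaussian.energy_exp_moment[OF noise_coord_jointly_gaussian[OF F]])
    fix j assume "j \<in> F"
    hence j: "j \<in> I" using F by auto
    have "4 * tilt_rate * noise_var j \<le> 4 * tilt_rate * (1 / lam j)"
      using tilt_rate_pos by (intro mult_left_mono noise_var_le j) auto
    thus "4 * tilt_rate * noise_var j \<le> 1" using tilt_rate_lam[OF j] by linarith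
  qed (use tilt_rate_pos in simp)
  hence "measure P {w \<in> space P. (\<Sum>j\<in>F. (noise_coord j w)\<^sup>2) > energy} \<le> exp (2 * tilt_rate * (\<Sum>j\<in>F. noise_var j) - tilt_rate * energy)"
    using tilt_rate_pos by (intro exp_moment_tail P.prob_space_axioms) auto
  also have "\<dots> \<le> exp (- real J)"
  proof -
    have "2 * tilt_rate * (\<Sum>j\<in>F. noise_var j) \<le> 2 * tilt_rate * (\<Sum>j\<in>F. 1 / lam j)"
      using tilt_rate_pos F(2) by (intro mult_left_mono sum_mono noise_var_le) auto
    thus ?thesis using tilt_exponent[OF F] by simp
  qed
  finally show ?thesis .
qed

text \<open>The event on which both the estimator and the posterior behave. All finite sections are bounded at
  once, which costs nothing as they increase.\<close>
definition quiet :: "'w set" where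
  "quiet = {w \<in> space P. \<forall>n. (\<Sum>j\<in>sect n. (noise_coord j w)\<^sup>2) \<le> energy}"

lemma quiet_sets [measurable]: "quiet \<in> sets P" unfolding quiet_def by measurable

lemma quiet_prob: "measure P (space P - quiet) \<le> exp (- real J)"
proof -
  define B where "B n = {w \<in> space P. (\<Sum>j\<in>sect n. (noise_coord j w)\<^sup>2) > energy}" for n
  have "incseq B" unfolding B_def incseq_def
    by (auto intro: less_le_trans[OF _ sum_mono2])
  moreover have "range B \<subseteq> sets P" unfolding B_def by auto
  ultimately have "(\<lambda>n. measure P (B n)) \<longlonglongrightarrow> measure P (\<Union>n. B n)"
    by (intro P.finite_Lim_measure_incseq)
  moreover have "measure P (B n) \<le> exp (- real J)" for n
    unfolding B_def by (intro noise_energy_tail) auto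
  ultimately have "measure P (\<Union>n. B n) \<le> exp (- real J)" by (intro LIMSEQ_le_const2) auto
  moreover have "space P - quiet = (\<Union>n. B n)"
    unfolding quiet_def B_def not_le[symmetric] by blast
  ultimately show ?thesis by simp
qed

text \<open>The error is noise minus bias, and by \<open>(x - y)\<^sup>2 \<le> 2 x\<^sup>2 + 2 y\<^sup>2\<close> the energies of both enter twice.\<close>
definition loss_level :: real where "loss_level = 2 * energy + 8 * L * rate"

lemma bias_energy:
  assumes f: "f \<in> ellipsoid G M" and F: "finite F" "F \<subseteq> I"
  shows "(\<Sum>j\<in>F. ((\<mu> * (g j)\<^sup>2 / lam j) * (f \<bullet> e j))\<^sup>2) \<le> 4 * L * rate"
proof -
  have "(\<Sum>j\<in>F. ((\<mu> * (g j)\<^sup>2 / lam j) * (f \<bullet> e j))\<^sup>2) \<le> (\<Sum>j\<in>F. (4 * L / (g J)\<^sup>2) * ((g j)\<^sup>2 * (f \<bullet> e j)\<^sup>2))"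
  proof (rule sum_mono)
    fix j assume "j \<in> F"
    hence "(\<mu> * (g j)\<^sup>2 / lam j)\<^sup>2 \<le> (4 * L / (g J)\<^sup>2) * (g j)\<^sup>2" using F bias_factor_le by auto
    thus "((\<mu> * (g j)\<^sup>2 / lam j) * (f \<bullet> e j))\<^sup>2 \<le> (4 * L / (g J)\<^sup>2) * ((g j)\<^sup>2 * (f \<bullet> e j)\<^sup>2)"
      unfolding power_mult_distrib[of _ "f \<bullet> e j"] mult.assoc[symmetric] by (rule mult_right_mono) simp
  qed
  also have "\<dots> = (4 * L / (g J)\<^sup>2) * (\<Sum>j\<in>F. (g j)\<^sup>2 * (f \<bullet> e j)\<^sup>2)" by (simp add: sum_distrib_left)
  also have "\<dots> \<le> (4 * L / (g J)\<^sup>2) * M"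
    using L_ge_1 by (intro mult_left_mono ellipsoid_coords f F) auto
  finally show ?thesis by (simp add: rate_def)
qed

lemma quiet_coords:
  assumes f: "f \<in> ellipsoid G M" and w: "w \<in> quiet"
  shows "(\<Sum>j\<in>sect n. (coef j (obs f w) - f \<bullet> e j)\<^sup>2) \<le> loss_level"
proof -
  have "(\<Sum>j\<in>sect n. (coef j (obs f w) - f \<bullet> e j)\<^sup>2) \<le>
      (\<Sum>j\<in>sect n. 2 * (noise_coord j w)\<^sup>2 + 2 * ((\<mu> * (g j)\<^sup>2 / lam j) * (f \<bullet> e j))\<^sup>2)"
  proof (rule sum_mono)
    fix j assume "j \<in> sect n"
    hence j: "j \<in> I" by simp
    have "(x - y)\<^sup>2 \<le> 2 * x\<^sup>2 + 2 * y\<^sup>2" for x y :: real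
      using zero_le_power2[of "x + y"] by (simp add: power2_eq_square algebra_simps)
    thus "(coef j (obs f w) - f \<bullet> e j)\<^sup>2 \<le> 2 * (noise_coord j w)\<^sup>2 + 2 * ((\<mu> * (g j)\<^sup>2 / lam j) * (f \<bullet> e j))\<^sup>2"
      unfolding coef_obs[OF j] .
  qed
  also have "\<dots> = 2 * (\<Sum>j\<in>sect n. (noise_coord j w)\<^sup>2) + 2 * (\<Sum>j\<in>sect n. ((\<mu> * (g j)\<^sup>2 / lam j) * (f \<bullet> e j))\<^sup>2)"
    unfolding sum.distrib sum_distrib_left ..
  also have "\<dots> \<le> 2 * energy + 2 * (4 * L * rate)"
    using w by (intro add_mono mult_left_mono bias_energy f) (auto simp: quiet_def)
  finally show ?thesis by (simp add: loss_level_def)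
qed

text \<open>Bounded sections of the error coordinates make the series that defines the estimator converge.\<close>
lemma quiet_loss:
  assumes f: "f \<in> ellipsoid G M" and w: "w \<in> quiet"
  shows "(norm (mle (obs f w) - f))\<^sup>2 \<le> loss_level"
proof -
  from riesz_fischer[OF quiet_coords[OF assms]] obtain z
    where z: "\<And>j. j \<in> I \<Longrightarrow> z \<bullet> e j = coef j (obs f w) - f \<bullet> e j" by blast
  have "mle (obs f w) = z + f"
    unfolding mle_eq by (rule infsum_coords) (simp add: z inner_add_left)
  moreover have "(norm z)\<^sup>2 \<le> loss_level"
    using quiet_coords[OF assms] z by (intro norm_le_of_coords) simp
  ultimately show ?thesis by simp
qed

lemma mle_upper:
  assumes f: "f \<in> ellipsoid G M" and r: "loss_level \<le> r"
  shows "loss_prob P W A \<sigma> mle f r \<le> exp (- real J)"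
proof -
  have "loss_prob P W A \<sigma> mle f r \<le> measure P (space P - quiet)"
    unfolding loss_prob_def
    by (intro P.finite_measure_mono) (use quiet_loss[OF f] r in \<open>fastforce, auto\<close>)
  thus ?thesis using quiet_prob by linarith
qed

end

section \<open>The lower bound over all estimators\<close>

lemma std_normal_exp_moment:
  "integrable \<gamma> (\<lambda>x. exp (c * x))"
  "(LINT x|\<gamma>. exp (c * x)) = exp (c\<^sup>2 / 2)"
proof -
  have i: "integrable \<gamma> (\<lambda>x. complex_of_real (exp (c * x - c\<^sup>2 / 2)))"
    using tilted_gaussian_char(2)[of 0 c] by simp
  have v: "(CLINT x|\<gamma>. complex_of_real (exp (c * x - c\<^sup>2 / 2))) = 1"
    using tilted_gaussian_char(1)[of 0 c] by simp
  have eq: "exp (c * x) = exp (c\<^sup>2 / 2) * Re (complex_of_real (exp (c * x - c\<^sup>2 / 2)))" for x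
    by (simp add: exp_add[symmetric])
  show "integrable \<gamma> (\<lambda>x. exp (c * x))"
    unfolding eq by (intro integrable_mult_right integrable_Re i)
  show "(LINT x|\<gamma>. exp (c * x)) = exp (c\<^sup>2 / 2)"
    unfolding eq integral_mult_right_zero integral_Re[OF i] v by simp
qed

lemma std_normal_second_moment:
  "integrable \<gamma> (\<lambda>x. x\<^sup>2)" "(LINT x|\<gamma>. x\<^sup>2) = 1"
proof -
  have h: "has_bochner_integral lborel (\<lambda>x. std_normal_density x * x\<^sup>2) 1"
    using std_normal_moment_even[of 1] by (simp add: fact_numeral)
  show "integrable \<gamma> (\<lambda>x. x\<^sup>2)"
    by (subst integrable_density) (use h in \<open>auto simp: has_bochner_integral_iff\<close>)
  show "(LINT x|\<gamma>. x\<^sup>2) = 1"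
    by (subst integral_density) (use h in \<open>auto simp: has_bochner_integral_iff\<close>)
qed

text \<open>The contribution of one coordinate to the average over both signs: a correct sign counts fully, a
  wrong one with weight \<open>exp (- 1)\<close>, and the sign is guessed in the best possible way from the
  observed score \<open>x\<close> of variance \<open>s\<close>.\<close>
definition test_factor :: "real \<Rightarrow> real \<Rightarrow> real" where
  "test_factor s x = exp (- s / 2) * (exp \<bar>x\<bar> + exp (- 1) * exp (- \<bar>x\<bar>))"

text \<open>If wrong signs counted fully as well, the value would be \<open>2\<close>, the total likelihood of both signs.
  For small \<open>s\<close> the score carries little information, so the wrong sign keeps a fixed share of the
  likelihood, and its smaller weight pushes the expectation below \<open>2\<close>. The function \<open>q\<close> is an
  explicitly integrable upper bound, obtained from \<open>exp (- t) \<ge> 1 - t \<ge> 1 / 2 - t\<^sup>2 / 2\<close> for \<open>t = |x|\<close>.\<close>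
lemma test_factor_moment:
  assumes s: "0 \<le> s" "s \<le> 1 / 4"
  shows "(\<integral>\<^sup>+x. ennreal (test_factor s (sqrt s * x)) \<partial>\<gamma>) \<le> ennreal (19 / 10)"
proof -
  define q where "q x = exp (- s / 2) * (exp (sqrt s * x) + exp (- sqrt s * x) - (1 / 4 - s / 4 * x\<^sup>2))" for x :: real
  have le: "test_factor s (sqrt s * x) \<le> q x" for x
  proof -
    define z where "z = sqrt s * x"
    have z2: "z\<^sup>2 = s * x\<^sup>2" using s by (simp add: z_def power_mult_distrib)
    have "exp (- 1 :: real) \<le> 1 / 2" using exp_ge_add_one_self[of 1] by (simp add: exp_minus field_simps)
    hence a: "exp (- 1) * exp (- \<bar>z\<bar>) \<le> 1 / 2 * exp (- \<bar>z\<bar>)" by (intro mult_right_mono) auto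
    have b: "1 / 2 - z\<^sup>2 / 2 \<le> exp (- \<bar>z\<bar>)"
    proof -
      have "0 \<le> (\<bar>z\<bar> - 1)\<^sup>2" by simp
      hence "\<bar>z\<bar> \<le> 1 / 2 + z\<^sup>2 / 2" by (simp add: power2_eq_square algebra_simps)
      thus ?thesis using exp_ge_add_one_self[of "- \<bar>z\<bar>"] by linarith
    qed
    have c: "exp \<bar>z\<bar> + exp (- \<bar>z\<bar>) = exp z + exp (- z)" by (auto simp: abs_if)
    have "exp \<bar>z\<bar> + exp (- 1) * exp (- \<bar>z\<bar>) \<le> exp z + exp (- z) - (1 / 4 - z\<^sup>2 / 4)"
      using a b c by linarith
    thus ?thesis
      unfolding test_factor_def q_def z_def[symmetric] using z2 by (intro mult_left_mono) (auto simp: z_def)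
  qed
  have q0: "0 \<le> q x" for x using le[of x] by (rule order_trans[rotated]) (simp add: test_factor_def)
  interpret N: prob_space \<gamma> by (rule std_normal_prob_spaces)
  have i1: "integrable \<gamma> (\<lambda>x. exp (sqrt s * x) + exp (- sqrt s * x))"
    by (intro Bochner_Integration.integrable_add std_normal_exp_moment)
  have i2: "integrable \<gamma> (\<lambda>x. 1 / 4 - s / 4 * x\<^sup>2)"
    by (intro Bochner_Integration.integrable_diff integrable_mult_right std_normal_second_moment N.integrable_const)
  have qi: "integrable \<gamma> q"
    unfolding q_def by (intro integrable_mult_right Bochner_Integration.integrable_diff i1 i2)
  have v1: "(LINT x|\<gamma>. exp (sqrt s * x) + exp (- sqrt s * x)) = exp (s / 2) + exp (s / 2)"
    using s by (subst Bochner_Integration.integral_add) (simp_all only: std_normal_exp_moment power2_minus real_sqrt_pow2)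
  have v2: "(LINT x|\<gamma>. 1 / 4 - s / 4 * x\<^sup>2) = 1 / 4 - s / 4"
    by (subst Bochner_Integration.integral_diff)
      (auto simp: std_normal_second_moment N.prob_space[simplified] intro!: integrable_mult_right std_normal_second_moment)
  have "(LINT x|\<gamma>. q x) = exp (- s / 2) * ((exp (s / 2) + exp (s / 2)) - (1 / 4 - s / 4))"
    unfolding q_def integral_mult_right_zero Bochner_Integration.integral_diff[OF i1 i2] v1 v2 ..
  also have "\<dots> = 2 - exp (- s / 2) * ((1 - s) / 4)"
    by (simp add: algebra_simps exp_add[symmetric] diff_divide_distrib)
  also have "\<dots> \<le> 2 - (7 / 8) * ((3 / 4) / 4)"
  proof -
    have "7 / 8 \<le> exp (- s / 2)" using exp_ge_add_one_self[of "- s / 2"] s by simp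
    hence "(7 / 8) * ((3 / 4) / 4) \<le> exp (- s / 2) * ((1 - s) / 4)" using s by (intro mult_mono) auto
    thus ?thesis by (simp add: mult_ac)
  qed
  also have "\<dots> \<le> 19 / 10" by simp
  finally have qv: "(LINT x|\<gamma>. q x) \<le> 19 / 10" .
  have "(\<integral>\<^sup>+x. ennreal (test_factor s (sqrt s * x)) \<partial>\<gamma>) \<le> (\<integral>\<^sup>+x. ennreal (q x) \<partial>\<gamma>)"
    by (intro nn_integral_mono ennreal_leI le)
  also have "\<dots> = ennreal (LINT x|\<gamma>. q x)"
    using q0 by (intro nn_integral_eq_integral qi) auto
  also have "\<dots> \<le> ennreal (19 / 10)" by (intro ennreal_leI qv)
  finally show ?thesis .
qed

lemma sign_pair_le_test_factor:
  fixes h x s :: real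
  assumes "h = 1 \<or> h = - 1"
  shows "(\<Sum>\<theta>\<in>{-1, 1}. exp (\<theta> * x - s / 2) * (if \<theta> = h then 1 else exp (- 1))) \<le> test_factor s x"
proof -
  have key: "exp (- y) + exp (- 1) * exp y \<le> exp y + exp (- 1) * exp (- y)" if "y \<ge> 0" for y :: real
  proof -
    have "0 \<le> (1 - exp (- 1)) * (exp y - exp (- y))" using that by (intro mult_nonneg_nonneg) auto
    thus ?thesis by (simp add: algebra_simps)
  qed
  have e: "exp (\<theta> * x - s / 2) = exp (- s / 2) * exp (\<theta> * x)" for \<theta> by (simp add: exp_add[symmetric])
  have "(\<Sum>\<theta>\<in>{-1, 1}. exp (\<theta> * x - s / 2) * (if \<theta> = h then 1 else exp (- 1))) =
      exp (- s / 2) * (exp (h * x) + exp (- 1) * exp (- (h * x)))"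
    unfolding e using assms by (auto simp: algebra_simps)
  also have "\<dots> \<le> exp (- s / 2) * (exp \<bar>x\<bar> + exp (- 1) * exp (- \<bar>x\<bar>))"
    using assms key[of x] key[of "- x"] by (intro mult_left_mono) (auto simp: abs_if)
  finally show ?thesis by (simp add: test_factor_def)
qed

context gaussian_inverse_problem
begin

text \<open>The range of \<open>slow_variation\<close>: of order \<open>J\<close> indices with comparable \<open>g\<close> and, being above \<open>J\<close>,
  with weak signal.\<close>
definition block :: "nat set" where "block = {J..J + nat \<lfloor>real J / (2 * C)\<rfloor>}"

lemma block_finite [simp]: "finite block" by (simp add: block_def)

lemma block_card: "real J / (2 * C) \<le> real (card block)" "card block \<ge> 1"
proof -
  have "real J / (2 * C) \<ge> 0" using C1 by simp
  hence "real J / (2 * C) \<le> real (nat \<lfloor>real J / (2 * C)\<rfloor>) + 1" by linarith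
  thus "real J / (2 * C) \<le> real (card block)" by (simp add: block_def)
  show "card block \<ge> 1" by (simp add: block_def)
qed

lemma block_facts:
  assumes j: "j \<in> block"
  shows "j \<in> I" "J \<le> j" "(g j)\<^sup>2 \<le> 4 * C\<^sup>2 * (g J)\<^sup>2"
proof -
  show Jj: "J \<le> j" using j by (simp add: block_def)
  have "j - J \<le> nat \<lfloor>real J / (2 * C)\<rfloor>" using j by (auto simp: block_def)
  moreover have "real J / (2 * C) \<ge> 0" using C1 by simp
  ultimately have "real (j - J) \<le> real J / (2 * C)" by linarith
  hence "2 * C * real (j - J) \<le> real J" using C1 by (simp add: field_simps)
  from slow_variation[OF J_in this] Jj show "j \<in> I" "(g j)\<^sup>2 \<le> 4 * C\<^sup>2 * (g J)\<^sup>2" by auto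
qed

text \<open>The square of each coordinate of a vertex of the cube. It is small enough for the cube to lie in the ellipsoid and
  for the score variances to be at most \<open>1 / 4\<close>; the squared distance between opposite vertices is
  still of order \<open>rate\<close>.\<close>
definition amp2 :: real where "amp2 = rate / (8 * C\<^sup>2 * real (card block))"

lemma amp2_pos: "amp2 > 0"
  using rate_pos C1 block_card(2) unfolding amp2_def by (intro divide_pos_pos mult_pos_pos) auto

definition vertex :: "(nat \<Rightarrow> real) \<Rightarrow> 'a" where
  "vertex \<theta> = (\<Sum>j\<in>block. (sqrt amp2 * \<theta> j) *\<^sub>R e j)"

abbreviation signs :: "(nat \<Rightarrow> real) set" where "signs \<equiv> PiE block (\<lambda>_. {-1, 1})"

lemma sign_sq: "\<theta> \<in> signs \<Longrightarrow> j \<in> block \<Longrightarrow> (\<theta> j)\<^sup>2 = 1"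
  by (auto dest: PiE_mem)

lemma block_sub: "block \<subseteq> I" using block_facts by auto

lemma vertex_in_ellipsoid:
  assumes \<theta>: "\<theta> \<in> signs"
  shows "vertex \<theta> \<in> ellipsoid G M"
  unfolding vertex_def
proof (rule comb_in_ellipsoid[OF block_finite block_sub])
  have "(\<Sum>j\<in>block. (g j)\<^sup>2 * (sqrt amp2 * \<theta> j)\<^sup>2) = (\<Sum>j\<in>block. (g j)\<^sup>2 * amp2)"
    using sign_sq[OF \<theta>] amp2_pos by (intro sum.cong refl) (simp add: power_mult_distrib)
  also have "\<dots> \<le> of_nat (card block) * (4 * C\<^sup>2 * (g J)\<^sup>2 * amp2)"
    using block_facts(3) amp2_pos by (intro sum_bounded_above mult_right_mono) auto
  also have "\<dots> = M / 2"
    using block_card(2) C1 gJ_pos by (auto simp: amp2_def rate_def)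
  also have "\<dots> \<le> M" using M_pos by simp
  finally show "(\<Sum>j\<in>block. (g j)\<^sup>2 * (sqrt amp2 * \<theta> j)\<^sup>2) \<le> M" .
qed

text \<open>The coordinates of the noise that enter the likelihood of the signs.\<close>
definition score :: "nat \<Rightarrow> 'w \<Rightarrow> real" where "score j w = (sqrt amp2 / \<sigma>) * W (A (e j)) w"
definition score_var :: "nat \<Rightarrow> real" where "score_var j = (sqrt amp2 / \<sigma>)\<^sup>2 * (norm (A (e j)))\<^sup>2"

lemma score_var_eq: "j \<in> block \<Longrightarrow> score_var j = amp2 * ((a j)\<^sup>2 / \<sigma>\<^sup>2)"
  unfolding score_var_def power2_norm_eq_inner using block_facts(1) amp2_pos
  by (simp add: A_basis_orthogonal power_divide)

lemma score_measurable [measurable]: "score j \<in> borel_measurable P"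
  unfolding score_def by measurable

lemma score_var_bounds: "j \<in> block \<Longrightarrow> 0 \<le> score_var j \<and> score_var j \<le> 1 / 4"
proof -
  assume j: "j \<in> block"
  have c: "real (card block) > 0" using block_card(2) by simp
  have "score_var j \<le> amp2 * (real J * (g J)\<^sup>2 / M)"
    unfolding score_var_eq[OF j] using signal_le block_facts[OF j] amp2_pos by (intro mult_left_mono) auto
  also have "\<dots> = real J / (8 * C\<^sup>2 * real (card block))"
    using M_pos gJ_pos by (simp add: amp2_def rate_def)
  also have "\<dots> \<le> 1 / 4"
  proof -
    have "real J \<le> 2 * C * real (card block)" using block_card(1) C1 by (simp add: field_simps)
    also have "\<dots> \<le> 2 * C\<^sup>2 * real (card block)"
      using C1 c by (intro mult_right_mono) (auto simp: power2_eq_square)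
    finally show ?thesis using c C1 by (simp add: field_simps)
  qed
  finally show ?thesis by (simp add: score_var_def)
qed

lemma score_jointly_gaussian: "jointly_gaussian P block score score_var"
proof -
  interpret jointly_gaussian P block "\<lambda>j. W (A (e j))" "\<lambda>j. (norm (A (e j)))\<^sup>2"
    using block_facts(1) by (intro noise_jointly_gaussian[OF noise block_finite]) (simp add: A_basis_orthogonal)
  show ?thesis using scaled[of "sqrt amp2 / \<sigma>"] by (simp only: score_def[abs_def] score_var_def[abs_def])
qed

lemma tilt_vertex:
  assumes \<theta>: "\<theta> \<in> signs"
  shows "AE w in P. tilt W ((1 / \<sigma>) *\<^sub>R A (vertex \<theta>)) w = (\<Prod>j\<in>block. exp (\<theta> j * score j w - score_var j / 2))"
proof -
  have h: "(1 / \<sigma>) *\<^sub>R A (vertex \<theta>) = (\<Sum>j\<in>block. (sqrt amp2 / \<sigma> * \<theta> j) *\<^sub>R A (e j))"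
    unfolding vertex_def by (simp add: linear_sum[OF linear_A] linear_scale[OF linear_A] scaleR_right.sum)
  have n: "(norm ((1 / \<sigma>) *\<^sub>R A (vertex \<theta>)))\<^sup>2 = (\<Sum>j\<in>block. score_var j)"
  proof -
    have "(norm ((1 / \<sigma>) *\<^sub>R A (vertex \<theta>)))\<^sup>2 = (\<Sum>j\<in>block. (sqrt amp2 / \<sigma> * \<theta> j)\<^sup>2 * (norm (A (e j)))\<^sup>2)"
      unfolding h using block_facts(1)
      by (intro norm_orthogonal_sum[where v = "\<lambda>j. A (e j)"] block_finite) (simp add: A_basis_orthogonal)
    also have "\<dots> = (\<Sum>j\<in>block. score_var j)"
      by (intro sum.cong refl) (simp add: score_var_def power_mult_distrib power_divide sign_sq[OF \<theta>])
    finally show ?thesis .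
  qed
  have "AE w in P. W (\<Sum>j\<in>block. (sqrt amp2 / \<sigma> * \<theta> j) *\<^sub>R A (e j)) w = (\<Sum>j\<in>block. (sqrt amp2 / \<sigma> * \<theta> j) * W (A (e j)) w)"
    by (rule noise_sum[OF noise block_finite])
  thus ?thesis
  proof eventually_elim
    case (elim w)
    have "tilt W ((1 / \<sigma>) *\<^sub>R A (vertex \<theta>)) w = exp ((\<Sum>j\<in>block. \<theta> j * score j w) - (\<Sum>j\<in>block. score_var j) / 2)"
      unfolding tilt_def n unfolding h elim by (simp add: score_def mult_ac)
    also have "\<dots> = (\<Prod>j\<in>block. exp (\<theta> j * score j w - score_var j / 2))"
      by (simp add: exp_sum[symmetric] sum_subtractf sum_divide_distrib)
    finally show ?case .
  qed
qed

text \<open>Each wrong sign costs \<open>amp2\<close>, so a small loss leaves at most one sign in forty wrong. The number of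
  errors is bounded in exponential form, because the exponential is a product over coordinates.\<close>
lemma close_vertex_few_errors:
  assumes \<theta>: "\<theta> \<in> signs" and r: "r \<le> amp2 * real (card block) / 40"
    and close: "(norm (x - vertex \<theta>))\<^sup>2 \<le> r"
  shows "1 \<le> exp (real (card block) / 40) *
    (\<Prod>j\<in>block. if \<theta> j = (if x \<bullet> e j \<ge> 0 then 1 else -1) then 1 else exp (- 1 :: real))"
proof -
  define err where "err = {j\<in>block. \<theta> j \<noteq> (if x \<bullet> e j \<ge> 0 then 1 else -1)}"
  have "real (card err) * amp2 = (\<Sum>j\<in>err. amp2)" by simp
  also have "\<dots> \<le> (\<Sum>j\<in>err. ((x - vertex \<theta>) \<bullet> e j)\<^sup>2)"
  proof (rule sum_mono)
    fix j assume j: "j \<in> err"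
    hence jb: "j \<in> block" by (simp add: err_def)
    have c: "(x - vertex \<theta>) \<bullet> e j = x \<bullet> e j - sqrt amp2 * \<theta> j"
      unfolding vertex_def inner_diff_left using block_facts(1)[OF jb] jb by (simp add: inner_comb_left[OF block_finite block_sub])
    have "sqrt amp2 \<le> \<bar>x \<bullet> e j - sqrt amp2 * \<theta> j\<bar>"
      using j PiE_mem[OF \<theta> jb] amp2_pos real_sqrt_gt_zero[OF amp2_pos] by (auto simp: err_def split: if_splits)
    hence "(sqrt amp2)\<^sup>2 \<le> \<bar>x \<bullet> e j - sqrt amp2 * \<theta> j\<bar>\<^sup>2" using amp2_pos by (intro power_mono) auto
    thus "amp2 \<le> ((x - vertex \<theta>) \<bullet> e j)\<^sup>2" using amp2_pos by (simp add: c)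
  qed
  also have "\<dots> \<le> (norm (x - vertex \<theta>))\<^sup>2"
    using block_sub by (intro bessel) (auto simp: err_def)
  also have "\<dots> \<le> amp2 * real (card block) / 40" using close r by linarith
  finally have "amp2 * real (card err) \<le> amp2 * (real (card block) / 40)" by (simp add: mult.commute)
  hence card: "real (card err) \<le> real (card block) / 40" using amp2_pos by (simp only: mult_le_cancel_left_pos)
  have "(\<Prod>j\<in>block. if \<theta> j = (if x \<bullet> e j \<ge> 0 then 1 else -1) then 1 else exp (- 1 :: real)) = (\<Prod>j\<in>err. exp (- 1))"
    unfolding err_def by (intro prod.mono_neutral_cong_right) auto
  also have "\<dots> = exp (- real (card err))" by (simp add: exp_of_nat_mult[symmetric])
  finally show ?thesis using card by (simp add: exp_add[symmetric])
qed

text \<open>The probabilities of success, summed over all vertices, are an integral against pure noise. The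
  likelihoods and the exponential error count are both products, so the sum over the vertices is a
  product of \<open>test_factor\<close>s, whatever the estimator guesses. With \<open>n\<close> indices in the block this gives
  at most \<open>exp (n / 40) (19 / 10)\<^sup>n\<close> for \<open>2\<^sup>n\<close> vertices, and \<open>19 / 20 \<le> exp (- 1 / 20)\<close>.\<close>
lemma hard_vertex:
  assumes fhat: "fhat \<in> estimators" and r: "r \<le> amp2 * real (card block) / 40"
  shows "\<exists>f\<in>ellipsoid G M. loss_prob P W A \<sigma> fhat f r \<ge> 1 - exp (- (1 / (80 * C)) * real J)"
proof -
  let ?n = "card block"
  let ?T = "\<lambda>\<theta>. tilt W ((1 / \<sigma>) *\<^sub>R A (vertex \<theta>))"
  have [measurable]: "fhat \<in> borel_measurable data_space" using fhat by (simp add: estimators_def)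
  define D where "D \<theta> = {y \<in> space data_space. (norm (fhat y - vertex \<theta>))\<^sup>2 \<le> r}" for \<theta>
  have [measurable]: "D \<theta> \<in> sets data_space" for \<theta> unfolding D_def by measurable
  define p where "p \<theta> = measure P {w \<in> space P. obs (vertex \<theta>) w \<in> D \<theta>}" for \<theta>
  have fin: "finite signs" by (intro finite_PiE) auto
  have cs: "card signs = 2 ^ ?n" by (subst card_PiE) (auto simp: card_insert_if numeral_2_eq_2)
  have obs_sp: "obs f w \<in> space data_space" if "w \<in> space P" for f w
    using measurable_space[OF obs_measurable that] .
  have tm [measurable]: "tilt W h \<in> borel_measurable P" for h by (rule noise_tilt(2)[OF noise])
  have pe: "ennreal (p \<theta>) = (\<integral>\<^sup>+w. ennreal (?T \<theta> w) * indicator (D \<theta>) (obs 0 w) \<partial>P)" for \<theta>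
  proof -
    have "ennreal (p \<theta>) = emeasure (distr P data_space (obs (vertex \<theta>))) (D \<theta>)"
      by (subst emeasure_distr) (auto simp: p_def P.emeasure_eq_measure intro!: arg_cong[where f="measure P"])
    also have "\<dots> = emeasure (distr (density P (\<lambda>w. ennreal (?T \<theta> w))) data_space (obs 0)) (D \<theta>)"
      by (subst cameron_martin[where A = A and z = 0, OF noise sigma_pos linear_0[OF linear_A]]) simp
    also have "\<dots> = (\<integral>\<^sup>+w. ennreal (?T \<theta> w) * indicator (D \<theta>) (obs 0 w) \<partial>P)"
      by (subst emeasure_distr, measurable, subst emeasure_density)
        (auto intro!: nn_integral_cong split: split_indicator)
    finally show ?thesis .
  qed
  \<comment> \<open>The guessed signs \<open>h j\<close> depend on the data only, not on the vertex; so the sum over the vertices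
    factorizes for fixed data.\<close>
  have pt: "AE w in P. (\<Sum>\<theta>\<in>signs. ennreal (?T \<theta> w) * indicator (D \<theta>) (obs 0 w))
      \<le> ennreal (exp (real ?n / 40)) * (\<Prod>j\<in>block. ennreal (test_factor (score_var j) (score j w)))"
  proof -
    have "AE w in P. \<forall>\<theta>\<in>signs. ?T \<theta> w = (\<Prod>j\<in>block. exp (\<theta> j * score j w - score_var j / 2))"
      by (intro AE_finite_allI fin tilt_vertex)
    thus ?thesis
    proof eventually_elim
      case (elim w)
      define h where "h j = (if fhat (obs 0 w) \<bullet> e j \<ge> 0 then 1 else - 1 :: real)" for j
      let ?E = "\<lambda>\<theta>. \<Prod>j\<in>block. exp (\<theta> j * score j w - score_var j / 2) * (if \<theta> j = h j then 1 else exp (- 1))"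
      have "(\<Sum>\<theta>\<in>signs. ennreal (?T \<theta> w) * indicator (D \<theta>) (obs 0 w)) \<le>
        (\<Sum>\<theta>\<in>signs. ennreal (exp (real ?n / 40) * ?E \<theta>))"
      proof (rule sum_mono)
        fix \<theta> assume \<theta>: "\<theta> \<in> signs"
        let ?t = "\<Prod>j\<in>block. exp (\<theta> j * score j w - score_var j / 2)"
        have t: "?T \<theta> w = ?t" using elim \<theta> by blast
        have t0: "0 \<le> ?t" by (intro prod_nonneg) auto
        show "ennreal (?T \<theta> w) * indicator (D \<theta>) (obs 0 w) \<le>
          ennreal (exp (real ?n / 40) * ?E \<theta>)"
        proof (cases "obs 0 w \<in> D \<theta>")
          case True
          hence "(norm (fhat (obs 0 w) - vertex \<theta>))\<^sup>2 \<le> r" by (simp add: D_def)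
          from close_vertex_few_errors[OF \<theta> r this]
          have "1 \<le> exp (real ?n / 40) * (\<Prod>j\<in>block. if \<theta> j = h j then 1 else exp (- 1))" by (simp add: h_def)
          hence "?t * 1 \<le> ?t * (exp (real ?n / 40) * (\<Prod>j\<in>block. if \<theta> j = h j then 1 else exp (- 1)))"
            using t0 by (rule mult_left_mono)
          also have "\<dots> = exp (real ?n / 40) * ?E \<theta>"
            unfolding prod.distrib by (simp only: mult_ac)
          finally show ?thesis using True t by (simp add: ennreal_leI)
        qed simp
      qed
      also have "\<dots> = ennreal (\<Sum>\<theta>\<in>signs. exp (real ?n / 40) * ?E \<theta>)"
        by (intro sum_ennreal mult_nonneg_nonneg prod_nonneg) auto
      also have "(\<Sum>\<theta>\<in>signs. exp (real ?n / 40) * ?E \<theta>) =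
         exp (real ?n / 40) * (\<Prod>j\<in>block. \<Sum>t\<in>{-1, 1}. exp (t * score j w - score_var j / 2) * (if t = h j then 1 else exp (- 1)))"
        unfolding sum_distrib_left[symmetric] by (subst prod_sum_PiE) auto
      also have "ennreal \<dots> \<le> ennreal (exp (real ?n / 40) * (\<Prod>j\<in>block. test_factor (score_var j) (score j w)))"
        by (intro ennreal_leI mult_left_mono prod_mono conjI sign_pair_le_test_factor sum_nonneg) (auto simp: h_def)
      also have "\<dots> = ennreal (exp (real ?n / 40)) * (\<Prod>j\<in>block. ennreal (test_factor (score_var j) (score j w)))"
        by (subst ennreal_mult', simp, subst prod_ennreal) (auto simp: test_factor_def)
      finally show ?case .
    qed
  qed
  have [measurable]: "test_factor s \<in> borel_measurable borel" for s
    unfolding test_factor_def by measurable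
  have "ennreal (\<Sum>\<theta>\<in>signs. p \<theta>) = (\<Sum>\<theta>\<in>signs. ennreal (p \<theta>))"
    by (intro sum_ennreal[symmetric]) (auto simp: p_def)
  also have "\<dots> = (\<integral>\<^sup>+w. (\<Sum>\<theta>\<in>signs. ennreal (?T \<theta> w) * indicator (D \<theta>) (obs 0 w)) \<partial>P)"
    unfolding pe by (subst nn_integral_sum) auto
  also have "\<dots> \<le> (\<integral>\<^sup>+w. ennreal (exp (real ?n / 40)) * (\<Prod>j\<in>block. ennreal (test_factor (score_var j) (score j w))) \<partial>P)"
    by (intro nn_integral_mono_AE pt)
  also have "\<dots> = ennreal (exp (real ?n / 40)) * (\<integral>\<^sup>+w. (\<Prod>j\<in>block. ennreal (test_factor (score_var j) (score j w))) \<partial>P)"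
    by (intro nn_integral_cmult) measurable
  also have "(\<integral>\<^sup>+w. (\<Prod>j\<in>block. ennreal (test_factor (score_var j) (score j w))) \<partial>P) =
     (\<Prod>j\<in>block. \<integral>\<^sup>+x. ennreal (test_factor (score_var j) (sqrt (score_var j) * x)) \<partial>\<gamma>)"
    by (rule jointly_gaussian.nn_integral_prod[OF score_jointly_gaussian]) measurable
  also have "\<dots> \<le> (\<Prod>j\<in>block. ennreal (19 / 10))"
    using score_var_bounds by (intro prod_mono_ennreal test_factor_moment) auto
  also have "\<dots> = ennreal ((19 / 10) ^ ?n)"
    by (simp only: prod_constant ennreal_power)
  finally have "ennreal (\<Sum>\<theta>\<in>signs. p \<theta>) \<le> ennreal (exp (real ?n / 40) * (19 / 10) ^ ?n)"
    by (simp add: ennreal_mult' mult_left_mono)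
  hence tot: "(\<Sum>\<theta>\<in>signs. p \<theta>) \<le> exp (real ?n / 40) * (19 / 10) ^ ?n" by simp
  \<comment> \<open>Some vertex is at most as probable as the average over all \<open>2\<^sup>n\<close> vertices.\<close>
  have "\<exists>\<theta>\<in>signs. p \<theta> \<le> exp (real ?n / 40) * (19 / 20) ^ ?n"
  proof (rule ccontr)
    assume "\<not> ?thesis"
    hence "(\<Sum>\<theta>\<in>signs. exp (real ?n / 40) * (19 / 20) ^ ?n) < (\<Sum>\<theta>\<in>signs. p \<theta>)"
      using fin cs by (intro sum_strict_mono) (auto simp: not_le PiE_eq_empty_iff)
    also have "(\<Sum>\<theta>\<in>signs. exp (real ?n / 40) * (19 / 20) ^ ?n) = 2 ^ ?n * (exp (real ?n / 40) * (19 / 20) ^ ?n)"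
      using cs by simp
    also have "\<dots> = exp (real ?n / 40) * (2 * (19 / 20)) ^ ?n" unfolding power_mult_distrib by (simp only: mult_ac)
    finally show False using tot by simp
  qed
  then obtain \<theta> where \<theta>: "\<theta> \<in> signs" "p \<theta> \<le> exp (real ?n / 40) * (19 / 20) ^ ?n" by blast
  note \<theta>(2)
  also have "exp (real ?n / 40) * (19 / 20) ^ ?n \<le> exp (real ?n / 40) * exp (- 1 / 20) ^ ?n"
    using exp_ge_add_one_self[of "- 1 / 20"] by (intro mult_left_mono power_mono) auto
  also have "\<dots> = exp (- (real ?n / 40))"
    by (simp add: exp_of_nat_mult[symmetric] exp_add[symmetric])
  also have "\<dots> \<le> exp (- (1 / (80 * C)) * real J)"
  proof -
    have "real J / (2 * C) / 40 \<le> real ?n / 40" by (intro divide_right_mono block_card) simp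
    thus ?thesis by simp
  qed
  finally have pb: "p \<theta> \<le> exp (- (1 / (80 * C)) * real J)" .
  have "loss_prob P W A \<sigma> fhat (vertex \<theta>) r = measure P (space P - {w \<in> space P. obs (vertex \<theta>) w \<in> D \<theta>})"
    unfolding loss_prob_def using obs_sp by (intro arg_cong[where f="measure P"]) (auto simp: D_def not_le)
  also have "\<dots> = 1 - p \<theta>" unfolding p_def by (rule P.prob_compl) measurable
  finally show ?thesis using pb vertex_in_ellipsoid[OF \<theta>(1)] by (intro bexI[of _ "vertex \<theta>"]) auto
qed

end

section \<open>The law of data and parameter under the prior\<close>

locale gaussian_posterior = gaussian_inverse_problem I g C a M \<sigma> J e G S A P W
  for I g C a M \<sigma> J and e :: "nat \<Rightarrow> 'a::{real_inner, polish_space}" and G S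
    and A :: "'a \<Rightarrow> 'b::{real_inner, complete_space}"
    and P :: "'w measure" and W :: "'b \<Rightarrow> 'w \<Rightarrow> real" +
  fixes Q :: "'a measure" and \<kappa> :: "('b \<Rightarrow> real) \<Rightarrow> 'a measure"
  assumes prior: "gaussian_measure 0 V Q" and posterior: "is_posterior Q P W A \<sigma> \<kappa>"
begin

sublocale Q: prob_space Q using prior by (simp add: gaussian_measure_def)

lemma sets_Q [measurable_cong, simp]: "sets Q = sets borel" using prior by (simp add: gaussian_measure_def)

sublocale QP: pair_prob_space Q P ..

abbreviation prior_noise :: "('a \<times> 'w) measure" (\<open>\<Pi>\<close>) where "\<Pi> \<equiv> Q \<Otimes>\<^sub>M P"

lemma V_nonneg: "V h \<bullet> h \<ge> 0"
proof -
  have "0 \<le> (\<Sum>j\<in>sect n. (V h \<bullet> e j) * (h \<bullet> e j))" for n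
  proof (rule sum_nonneg)
    fix j assume "j \<in> sect n"
    hence j: "j \<in> I" by simp
    have "0 \<le> \<mu> * (g j)\<^sup>2" by (intro mult_nonneg_nonneg less_imp_le[OF mu_pos]) simp
    hence "0 \<le> (h \<bullet> e j) * (h \<bullet> e j) / (\<mu> * (g j)\<^sup>2)" by (intro divide_nonneg_nonneg) simp_all
    thus "0 \<le> (V h \<bullet> e j) * (h \<bullet> e j)" unfolding V_coord[OF j] by (simp add: mult_ac)
  qed
  thus ?thesis using LIMSEQ_le_const[OF parseval_tendsto[of "V h" h], of 0] by blast
qed

lemma V_scale: "V (c *\<^sub>R h) = c *\<^sub>R V h"
  by (rule coords_eqI) (simp add: V_coord)

text \<open>All one-dimensional laws of the prior are known, which is all that is assumed about it; joint laws
  are recovered from the characteristic function.\<close>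
lemma prior_char: "(CLINT f|Q. iexp (f \<bullet> h)) = of_real (exp (- (V h \<bullet> h) / 2))"
proof -
  have law: "if V h \<bullet> h = 0 then (AE x in Q. x \<bullet> h = 0 \<bullet> h)
      else distributed Q lborel (\<lambda>x. x \<bullet> h) (normal_density (0 \<bullet> h) (sqrt (V h \<bullet> h)))"
    using prior unfolding gaussian_measure_def by blast
  show ?thesis
  proof (cases "V h \<bullet> h = 0")
    case True
    hence "AE f in Q. f \<bullet> h = 0" using law by simp
    hence "(CLINT f|Q. iexp (f \<bullet> h)) = (CLINT f|Q. 1)"
      by (intro integral_cong_AE) (auto elim!: eventually_mono)
    thus ?thesis using True by (simp add: Q.prob_space)
  next
    case False
    define s where "s = sqrt (V h \<bullet> h)"
    have s: "s > 0" using False V_nonneg[of h] by (simp add: s_def less_le)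
    have "distributed Q lborel (\<lambda>x. x \<bullet> h) (normal_density 0 s)"
      using law False by (simp add: s_def)
    hence "distributed Q lborel (\<lambda>x. (x \<bullet> h - 0) / s) std_normal_density"
      by (rule Q.normal_standard_normal_convert[OF s, THEN iffD1])
    hence d: "distr Q lborel (\<lambda>x. x \<bullet> h / s) = \<gamma>"
      using distributed_distr_eq_density by fastforce
    have "(CLINT f|Q. iexp (f \<bullet> h)) = (CLINT f|Q. iexp (s * (f \<bullet> h / s)))" using s by simp
    also have "\<dots> = (CLINT x|distr Q lborel (\<lambda>x. x \<bullet> h / s). iexp (s * x))"
      by (subst integral_distr) auto
    also have "\<dots> = char \<gamma> s" unfolding d char_def ..
    finally show ?thesis unfolding char_std_normal_distribution using V_nonneg[of h] by (simp add: s_def)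
  qed
qed

definition Y :: "'a \<times> 'w \<Rightarrow> 'b \<Rightarrow> real" where "Y z = obs (fst z) (snd z)"

lemma Y_component [measurable]: "(\<lambda>z. Y z v) \<in> borel_measurable \<Pi>"
proof -
  have "(\<lambda>f. A f \<bullet> v) \<in> borel_measurable Q"
    by (simp cong: measurable_cong_sets)
       (intro borel_measurable_continuous_onI continuous_intros bounded_linear.continuous_on[OF bounded_A])
  thus ?thesis unfolding Y_def observation_def by measurable
qed

lemma Y_measurable [measurable]: "Y \<in> measurable \<Pi> data_space"
  using data_map_measurable[of "\<lambda>v z. Y z v" "\<Pi>"] by (simp add: eta_contract_eq)

definition residual :: "nat \<Rightarrow> 'a \<times> 'w \<Rightarrow> real" where "residual j z = fst z \<bullet> e j - coef j (Y z)"

lemma inner_basis_measurable [measurable]: "(\<lambda>f. f \<bullet> e j) \<in> borel_measurable Q"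
  by (simp cong: measurable_cong_sets)

lemma residual_measurable [measurable]: "residual j \<in> borel_measurable \<Pi>"
  unfolding residual_def by measurable

text \<open>The variance of \<open>\<langle>Y, u\<rangle>\<close> when the parameter is drawn from the prior.\<close>
definition data_var :: "'b \<Rightarrow> real" where "data_var u = V (adjoint A u) \<bullet> adjoint A u + \<sigma>\<^sup>2 * (norm u)\<^sup>2"

lemma data_var_nonneg: "data_var u \<ge> 0" using V_nonneg by (simp add: data_var_def)

lemma adjoint_coord: "adjoint A u \<bullet> e j = A (e j) \<bullet> u"
  using adj[of "e j" u] by (simp add: inner_commute)

lemma adjoint_scale: "adjoint A (c *\<^sub>R u) = c *\<^sub>R adjoint A u"
  by (rule coords_eqI) (simp add: adjoint_coord)

lemma data_var_scale: "data_var (c *\<^sub>R u) = c\<^sup>2 * data_var u"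
  by (simp add: data_var_def adjoint_scale V_scale power_mult_distrib power2_eq_square algebra_simps)

text \<open>The combination on the left is a functional \<open>\<langle>f, h\<rangle>\<close> of the parameter plus a functional \<open>W k\<close> of
  the noise. In the sum of their variances the mixed terms in residuals and data cancel: the estimator
  is the conditional mean, and its error is uncorrelated with the data.\<close>
lemma joint_char:
  assumes F: "finite F" "F \<subseteq> I"
  shows "(CLINT z|\<Pi>. iexp ((\<Sum>j\<in>F. t j * residual j z) + c * Y z u)) =
    of_real (exp (- ((\<Sum>j\<in>F. (t j)\<^sup>2 * (1 / lam j)) + c\<^sup>2 * data_var u) / 2))"
proof -
  define b where "b j = \<mu> * (g j)\<^sup>2 / lam j" for j
  define h where "h = (\<Sum>j\<in>F. (t j * b j) *\<^sub>R e j) + adjoint A (c *\<^sub>R u)"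
  define k where "k = (\<sigma> * c) *\<^sub>R u - (\<Sum>j\<in>F. (t j / \<sigma>) *\<^sub>R dir j)"
  have decomp: "(\<Sum>j\<in>F. t j * residual j (f, w)) + c * Y (f, w) u =
      f \<bullet> h + ((\<sigma> * c) * W u w + (-1) * (\<Sum>j\<in>F. (t j / \<sigma>) * W (dir j) w))" for f w
  proof -
    have "(\<Sum>j\<in>F. t j * residual j (f, w)) = (\<Sum>j\<in>F. t j * (b j * (f \<bullet> e j) - noise_coord j w))"
    proof (intro sum.cong refl)
      fix j assume "j \<in> F"
      hence "j \<in> I" using F by auto
      from coef_obs[OF this, of f w] show "t j * residual j (f, w) = t j * (b j * (f \<bullet> e j) - noise_coord j w)"
        by (simp add: residual_def Y_def b_def)
    qed
    also have "\<dots> = (\<Sum>j\<in>F. t j * b j * (f \<bullet> e j)) - (\<Sum>j\<in>F. (t j / \<sigma>) * W (dir j) w)"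
      by (simp add: sum_subtractf right_diff_distrib noise_coord_def mult_ac)
    finally show ?thesis
      by (simp add: h_def inner_add_right inner_sum_right Y_def observation_def adjoint_scale adj distrib_left mult_ac)
  qed
  have "AE w in P. W ((\<sigma> * c) *\<^sub>R u + (-1) *\<^sub>R (\<Sum>j\<in>F. (t j / \<sigma>) *\<^sub>R dir j)) w = (\<sigma> * c) * W u w + (-1) * W (\<Sum>j\<in>F. (t j / \<sigma>) *\<^sub>R dir j) w"
    using noise unfolding standard_gaussian_noise_def by blast
  hence Wk: "AE w in P. (\<sigma> * c) * W u w + (-1) * (\<Sum>j\<in>F. (t j / \<sigma>) * W (dir j) w) = W k w"
    using noise_sum[OF noise F(1), of "\<lambda>j. t j / \<sigma>" dir] by eventually_elim (simp add: k_def)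
  have int: "integrable \<Pi> (\<lambda>z. iexp ((\<Sum>j\<in>F. t j * residual j z) + c * Y z u))"
    by (intro integrable_iexp_finite QP.finite_measure_axioms) measurable
  have "(CLINT z|\<Pi>. iexp ((\<Sum>j\<in>F. t j * residual j z) + c * Y z u)) =
     (CLINT f|Q. CLINT w|P. iexp ((\<Sum>j\<in>F. t j * residual j (f, w)) + c * Y (f, w) u))"
    using QP.integral_fst'[OF int] by simp
  also have "\<dots> = (CLINT f|Q. iexp (f \<bullet> h) * (CLINT w|P. iexp (W k w)))"
  proof (intro Bochner_Integration.integral_cong refl)
    fix f
    have "(CLINT w|P. iexp ((\<Sum>j\<in>F. t j * residual j (f, w)) + c * Y (f, w) u)) = (CLINT w|P. iexp (f \<bullet> h) * iexp (W k w))"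
      unfolding decomp
    proof (intro integral_cong_AE)
      show "AE w in P. iexp (f \<bullet> h + ((\<sigma> * c) * W u w + (-1) * (\<Sum>j\<in>F. (t j / \<sigma>) * W (dir j) w))) = iexp (f \<bullet> h) * iexp (W k w)"
        using Wk
      proof eventually_elim
        case (elim w)
        show ?case unfolding elim by (simp add: exp_add[symmetric] distrib_left)
      qed
    qed measurable
    thus "(CLINT w|P. iexp ((\<Sum>j\<in>F. t j * residual j (f, w)) + c * Y (f, w) u)) = iexp (f \<bullet> h) * (CLINT w|P. iexp (W k w))"
      by (simp only: integral_mult_right_zero)
  qed
  also have "\<dots> = of_real (exp (- (V h \<bullet> h) / 2)) * of_real (exp (- (norm k)\<^sup>2 / 2))"
    unfolding integral_mult_left_zero prior_char noise_char[OF noise] ..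
  also have "\<dots> = of_real (exp (- (V h \<bullet> h + (norm k)\<^sup>2) / 2))"
    by (simp only: of_real_mult[symmetric] exp_add[symmetric]) (simp add: add_divide_distrib)
  also have "V h \<bullet> h + (norm k)\<^sup>2 = (\<Sum>j\<in>F. (t j)\<^sup>2 * (1 / lam j)) + c\<^sup>2 * data_var u"
  proof -
    have Vh: "V h \<bullet> h = (\<Sum>j\<in>F. (t j * b j)\<^sup>2 / (\<mu> * (g j)\<^sup>2)) +
        2 * (\<Sum>j\<in>F. (t j * b j) * (adjoint A (c *\<^sub>R u) \<bullet> e j) / (\<mu> * (g j)\<^sup>2)) + V (adjoint A (c *\<^sub>R u)) \<bullet> adjoint A (c *\<^sub>R u)"
      unfolding h_def by (rule V_add_comb[OF F])
    define m where "m = (\<Sum>j\<in>F. (t j / \<sigma>) *\<^sub>R dir j)"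
    have nm: "(norm m)\<^sup>2 = (\<Sum>j\<in>F. (t j)\<^sup>2 * noise_var j)"
    proof -
      have "(norm m)\<^sup>2 = (\<Sum>j\<in>F. (t j / \<sigma>)\<^sup>2 * (norm (dir j))\<^sup>2)"
        unfolding m_def using F(2) dir_orthogonal by (intro norm_orthogonal_sum[where v = dir] F(1)) auto
      also have "\<dots> = (\<Sum>j\<in>F. (t j)\<^sup>2 * noise_var j)"
        using F(2) by (intro sum.cong refl) (auto simp: noise_var_def power_divide)
      finally show ?thesis .
    qed
    have nk: "(norm k)\<^sup>2 = (norm (\<sigma> *\<^sub>R (c *\<^sub>R u)))\<^sup>2 - 2 * (\<Sum>j\<in>F. t j * c * (u \<bullet> dir j)) + (norm m)\<^sup>2"
    proof -
      have "((\<sigma> * c) *\<^sub>R u) \<bullet> m = (\<Sum>j\<in>F. t j * c * (u \<bullet> dir j))"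
        unfolding m_def inner_sum_right using sigma_pos by (intro sum.cong refl) simp
      moreover have "(norm (x - m))\<^sup>2 = (norm x)\<^sup>2 - 2 * (x \<bullet> m) + (norm m)\<^sup>2" for x
        unfolding power2_norm_eq_inner by (simp add: inner_diff_left inner_diff_right inner_commute[of m x])
      ultimately show ?thesis unfolding k_def m_def[symmetric] by simp
    qed
    have bl: "b j / (\<mu> * (g j)\<^sup>2) = 1 / lam j" and ul: "adjoint A (c *\<^sub>R u) \<bullet> e j = lam j * (c * (u \<bullet> dir j))"
       if "j \<in> I" for j
    proof -
      have "\<mu> * (g j)\<^sup>2 > 0" using mu_pos g_pos[OF that] by (intro mult_pos_pos) auto
      thus "b j / (\<mu> * (g j)\<^sup>2) = 1 / lam j" unfolding b_def by (metis divide_divide_eq_left' divide_self_if less_irrefl divide_divide_eq_left mult.commute)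
      show "adjoint A (c *\<^sub>R u) \<bullet> e j = lam j * (c * (u \<bullet> dir j))"
        using lam_pos[OF that] by (simp add: adjoint_coord dir_eq inner_commute[of u])
    qed
    have cross: "(\<Sum>j\<in>F. (t j * b j) * (adjoint A (c *\<^sub>R u) \<bullet> e j) / (\<mu> * (g j)\<^sup>2)) = (\<Sum>j\<in>F. t j * c * (u \<bullet> dir j))"
    proof (intro sum.cong refl)
      fix j assume "j \<in> F"
      hence j: "j \<in> I" using F by auto
      have "(t j * b j) * (adjoint A (c *\<^sub>R u) \<bullet> e j) / (\<mu> * (g j)\<^sup>2) = t j * (adjoint A (c *\<^sub>R u) \<bullet> e j) * (b j / (\<mu> * (g j)\<^sup>2))"
        by (simp add: mult_ac)
      thus "(t j * b j) * (adjoint A (c *\<^sub>R u) \<bullet> e j) / (\<mu> * (g j)\<^sup>2) = t j * c * (u \<bullet> dir j)"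
        unfolding bl[OF j] ul[OF j] using lam_pos[OF j] by simp
    qed
    have sq: "(\<Sum>j\<in>F. (t j * b j)\<^sup>2 / (\<mu> * (g j)\<^sup>2)) + (\<Sum>j\<in>F. (t j)\<^sup>2 * noise_var j) = (\<Sum>j\<in>F. (t j)\<^sup>2 * (1 / lam j))"
      unfolding sum.distrib[symmetric]
    proof (intro sum.cong refl)
      fix j assume "j \<in> F"
      hence j: "j \<in> I" using F by auto
      have "(t j * b j)\<^sup>2 / (\<mu> * (g j)\<^sup>2) = (t j)\<^sup>2 * (b j * (b j / (\<mu> * (g j)\<^sup>2)))" by (simp add: power2_eq_square)
      also have "\<dots> = (t j)\<^sup>2 * (\<mu> * (g j)\<^sup>2 / (lam j)\<^sup>2)" unfolding bl[OF j] b_def by (simp add: power2_eq_square)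
      finally have "(t j * b j)\<^sup>2 / (\<mu> * (g j)\<^sup>2) + (t j)\<^sup>2 * noise_var j = (t j)\<^sup>2 * (lam j / (lam j)\<^sup>2)"
        unfolding noise_var_eq[OF j] lam_def by (simp add: distrib_left add_divide_distrib)
      thus "(t j * b j)\<^sup>2 / (\<mu> * (g j)\<^sup>2) + (t j)\<^sup>2 * noise_var j = (t j)\<^sup>2 * (1 / lam j)"
        using lam_pos[OF j] by (simp add: power2_eq_square)
    qed
    have d: "V (adjoint A (c *\<^sub>R u)) \<bullet> adjoint A (c *\<^sub>R u) + (norm (\<sigma> *\<^sub>R (c *\<^sub>R u)))\<^sup>2 = c\<^sup>2 * data_var u"
      unfolding data_var_scale[symmetric] data_var_def[of "c *\<^sub>R u"] by (simp add: power_mult_distrib)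
    show ?thesis unfolding Vh nk nm cross using sq d by linarith
  qed
  finally show ?thesis .
qed

definition residual_weight :: "nat set \<Rightarrow> 'a \<Rightarrow> ('b \<Rightarrow> real) \<Rightarrow> real" where
  "residual_weight F f y = exp (tilt_rate * (\<Sum>j\<in>F. (f \<bullet> e j - coef j y)\<^sup>2))"

lemma residual_weight_pos: "0 \<le> residual_weight F f y" by (simp add: residual_weight_def)

lemma residual_weight_measurable [measurable]:
  "(\<lambda>z. residual_weight F (fst z) (snd z)) \<in> borel_measurable (borel \<Otimes>\<^sub>M data_space)"
  unfolding residual_weight_def by measurable

lemma residual_weight_Y_measurable [measurable]:
  "(\<lambda>z. residual_weight F (fst z) (Y z)) \<in> borel_measurable \<Pi>"
  unfolding residual_weight_def residual_def[symmetric] by measurable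

lemma residual_jointly_gaussian:
  assumes F: "finite F" "F \<subseteq> I"
  shows "jointly_gaussian \<Pi> F residual (\<lambda>j. 1 / lam j)"
proof (intro jointly_gaussian.intro jointly_gaussian_axioms.intro QP.prob_space_axioms F(1) residual_measurable)
  show "0 \<le> 1 / lam j" if "j \<in> F" for j using lam_pos[of j] that F by auto
  show "(CLINT z|\<Pi>. iexp (\<Sum>j\<in>F. t j * residual j z)) = of_real (exp (- (\<Sum>j\<in>F. (t j)\<^sup>2 * (1 / lam j)) / 2))" for t
    using joint_char[OF F, of t 0 0] by simp
qed

lemma residual_moment:
  assumes F: "finite F" "F \<subseteq> I"
  shows "(\<integral>\<^sup>+z. ennreal (residual_weight F (fst z) (Y z)) \<partial>\<Pi>) \<le> ennreal (exp (2 * tilt_rate * (\<Sum>j\<in>F. 1 / lam j)))"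
  unfolding residual_weight_def residual_def[symmetric]
proof (rule jointly_gaussian.energy_exp_moment[OF residual_jointly_gaussian[OF F]])
  show "0 \<le> tilt_rate" using tilt_rate_pos by simp
  show "4 * tilt_rate * (1 / lam j) \<le> 1" if "j \<in> F" for j using that F by (intro tilt_rate_lam) auto
qed

definition total_weight :: "nat set \<Rightarrow> real" where
  "total_weight F = (LINT z|\<Pi>. residual_weight F (fst z) (Y z))"

lemma residual_weight_integrable:
  assumes F: "finite F" "F \<subseteq> I"
  shows "integrable \<Pi> (\<lambda>z. residual_weight F (fst z) (Y z))"
proof (rule integrableI_nonneg)
  show "(\<integral>\<^sup>+z. ennreal (residual_weight F (fst z) (Y z)) \<partial>\<Pi>) < \<infinity>"
    using order_le_less_trans[OF residual_moment[OF F] ennreal_less_top] by simp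
qed (auto simp: residual_weight_pos)

lemma total_weight_bounds:
  assumes F: "finite F" "F \<subseteq> I"
  shows "0 \<le> total_weight F" "total_weight F \<le> exp (2 * tilt_rate * (\<Sum>j\<in>F. 1 / lam j))"
proof -
  show "0 \<le> total_weight F" unfolding total_weight_def by (intro integral_nonneg_AE) (auto simp: residual_weight_pos)
  have "ennreal (total_weight F) \<le> ennreal (exp (2 * tilt_rate * (\<Sum>j\<in>F. 1 / lam j)))"
    using residual_moment[OF F] unfolding total_weight_def
      nn_integral_eq_integral[OF residual_weight_integrable[OF F] AE_I2[OF residual_weight_pos], symmetric] .
  thus "total_weight F \<le> exp (2 * tilt_rate * (\<Sum>j\<in>F. 1 / lam j))" by simp
qed

text \<open>The family consisting of the residuals and of \<open>\<langle>Y, u\<rangle>\<close>, indexed by \<open>None\<close>, is jointly Gaussian with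
  independent members, so the weight, which depends on the residuals only, factors out.\<close>
lemma weighted_data_char:
  assumes F: "finite F" "F \<subseteq> I"
  shows "(CLINT z|\<Pi>. residual_weight F (fst z) (Y z) *\<^sub>R iexp (Y z u)) =
    total_weight F *\<^sub>R (CLINT z|\<Pi>. iexp (Y z u))"
proof -
  define idx where "idx = insert None (Some ` F)"
  define X where "X i z = (case i of None \<Rightarrow> Y z u | Some j \<Rightarrow> residual j z)" for i z
  define v where "v i = (case i of None \<Rightarrow> data_var u | Some j \<Rightarrow> 1 / lam j)" for i
  have split: "(\<Sum>i\<in>idx. s i) = s None + (\<Sum>j\<in>F. s (Some j))" for s :: "nat option \<Rightarrow> real"
    unfolding idx_def using F(1) by (subst sum.insert) (auto simp: sum.reindex)
  have psplit: "(\<Prod>i\<in>idx. s i) = s None * (\<Prod>j\<in>F. s (Some j))" for s :: "nat option \<Rightarrow> complex"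
    unfolding idx_def using F(1) by (subst prod.insert) (auto simp: prod.reindex)
  have fi: "finite idx" using F by (simp add: idx_def)
  have Xm: "X i \<in> borel_measurable \<Pi>" for i
    unfolding X_def by (cases i) auto
  have v0: "0 \<le> v i" if "i \<in> idx" for i
    using that data_var_nonneg lam_pos F(2) by (auto simp: v_def idx_def less_imp_le subset_eq)
  have ch: "(CLINT z|\<Pi>. iexp (\<Sum>i\<in>idx. t i * X i z)) = of_real (exp (- (\<Sum>i\<in>idx. (t i)\<^sup>2 * v i) / 2))" for t
    using joint_char[OF F, of "\<lambda>j. t (Some j)" "t None" u] unfolding split X_def v_def by (simp add: add.commute)
  define w where "w x = complex_of_real (exp (tilt_rate * x\<^sup>2))" for x :: real
  have wm [measurable]: "w \<in> borel_measurable borel" unfolding w_def by measurable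
  have wint: "integrable \<gamma> (\<lambda>x. w (sqrt (v (Some j)) * x))" if j: "j \<in> F" for j
  proof -
    have jI: "j \<in> I" using j F by auto
    have l: "0 \<le> 1 / lam j" using lam_pos[OF jI] by simp
    have "(\<integral>\<^sup>+x. ennreal (exp (tilt_rate * (sqrt (1 / lam j) * x)\<^sup>2)) \<partial>\<gamma>) =
        (\<integral>\<^sup>+x. ennreal (exp (tilt_rate * (1 / lam j) * x\<^sup>2)) \<partial>\<gamma>)"
      using l by (simp only: power_mult_distrib real_sqrt_pow2 mult.assoc)
    also have "\<dots> \<le> ennreal (exp (2 * (tilt_rate * (1 / lam j))))"
      using tilt_rate_lam[OF jI] tilt_rate_pos lam_pos[OF jI] by (intro gaussian_exp_square_moment) auto
    also have "\<dots> < \<infinity>" by simp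
    finally have "integrable \<gamma> (\<lambda>x. exp (tilt_rate * (sqrt (1 / lam j) * x)\<^sup>2))"
      by (intro integrableI_nonneg) simp_all
    hence "integrable \<gamma> (\<lambda>x. complex_of_real (exp (tilt_rate * (sqrt (1 / lam j) * x)\<^sup>2)))"
      by (rule integrable_of_real)
    thus ?thesis by (simp only: w_def v_def option.case)
  qed
  have general: "(CLINT z|\<Pi>. h (Y z u) * (\<Prod>j\<in>F. w (residual j z))) =
      (CLINT x|\<gamma>. h (sqrt (data_var u) * x)) * (\<Prod>j\<in>F. CLINT x|\<gamma>. w (sqrt (1 / lam j) * x))"
    if h: "h \<in> borel_measurable borel" "integrable \<gamma> (\<lambda>x. h (sqrt (data_var u) * x))" for h
  proof -
    define k where "k i = (case i of None \<Rightarrow> h | Some j \<Rightarrow> w)" for i :: "nat option"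
    have "(CLINT z|\<Pi>. (\<Prod>i\<in>idx. k i (X i z))) = (\<Prod>i\<in>idx. CLINT x|\<gamma>. k i (sqrt (v i) * x))"
    proof (rule jointly_gaussian.integral_prod)
      show "jointly_gaussian \<Pi> idx X v"
        by (intro jointly_gaussian.intro jointly_gaussian_axioms.intro QP.prob_space_axioms fi Xm v0 ch)
      fix i assume i: "i \<in> idx"
      show "k i \<in> borel_measurable borel" unfolding k_def using h(1) by (cases i) auto
      show "integrable \<gamma> (\<lambda>x. k i (sqrt (v i) * x))"
        using i wint h(2) by (auto simp: k_def idx_def v_def)
    qed
    thus ?thesis unfolding psplit by (simp add: k_def X_def v_def)
  qed
  have wres: "(\<Prod>j\<in>F. w (residual j z)) = of_real (residual_weight F (fst z) (Y z))" for z
    unfolding w_def residual_weight_def residual_def[symmetric] sum_distrib_left exp_sum[OF F(1)] by simp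
  define K where "K = (\<Prod>j\<in>F. CLINT x|\<gamma>. w (sqrt (1 / lam j) * x))"
  have "of_real (total_weight F) = (CLINT z|\<Pi>. 1 * (\<Prod>j\<in>F. w (residual j z)))"
    unfolding wres total_weight_def by simp
  also have "\<dots> = K"
  proof -
    interpret sn: prob_space \<gamma> by (rule std_normal_prob_spaces)
    have "(CLINT x|\<gamma>. (1 :: complex)) = 1" using sn.prob_space by simp
    thus ?thesis
      using general[OF borel_measurable_const sn.integrable_const, of 1] by (simp only: K_def mult_1_left)
  qed
  finally have K: "of_real (total_weight F) = K" .
  have ie: "integrable \<gamma> (\<lambda>x. iexp (sqrt (data_var u) * x))"
    by (intro integrable_iexp_finite prob_space.finite_measure std_normal_prob_spaces) auto
  have "(CLINT z|\<Pi>. residual_weight F (fst z) (Y z) *\<^sub>R iexp (Y z u)) =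
     (CLINT z|\<Pi>. iexp (Y z u) * (\<Prod>j\<in>F. w (residual j z)))"
    unfolding wres by (simp add: scaleR_conv_of_real mult.commute)
  also have "\<dots> = (CLINT x|\<gamma>. iexp (sqrt (data_var u) * x)) * K"
    unfolding K_def by (rule general) (use ie in auto)
  also have "(CLINT x|\<gamma>. iexp (sqrt (data_var u) * x)) = (CLINT z|\<Pi>. iexp (Y z u))"
  proof -
    have "(CLINT x|\<gamma>. iexp (sqrt (data_var u) * x)) = of_real (exp (- data_var u / 2))"
      using fun_cong[OF char_std_normal_distribution, of "sqrt (data_var u)"] data_var_nonneg[of u] by (simp add: char_def)
    moreover have "(CLINT z|\<Pi>. iexp (Y z u)) = of_real (exp (- data_var u / 2))"
      using joint_char[of "{}" "\<lambda>_. 0" 1 u] by simp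
    ultimately show ?thesis by simp
  qed
  finally show ?thesis unfolding K[symmetric] by (simp add: scaleR_conv_of_real mult.commute)
qed

lemma Y_linear:
  assumes "finite F"
  shows "AE z in \<Pi>. Y z (\<Sum>v\<in>F. t v *\<^sub>R v) = (\<Sum>v\<in>F. t v * Y z v)"
proof (rule QP.AE_pair_measure)
  show "{z \<in> space \<Pi>. Y z (\<Sum>v\<in>F. t v *\<^sub>R v) = (\<Sum>v\<in>F. t v * Y z v)} \<in> sets \<Pi>"
    by measurable
  show "AE f in Q. AE w in P. Y (f, w) (\<Sum>v\<in>F. t v *\<^sub>R v) = (\<Sum>v\<in>F. t v * Y (f, w) v)"
    using observation_linear[OF noise assms, of A \<sigma> _ t] by (simp add: Y_def)
qed

definition marginal :: "('b \<Rightarrow> real) measure" where "marginal = distr \<Pi> data_space Y"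

sublocale marginal: prob_space marginal unfolding marginal_def by (rule QP.prob_space_distr) measurable

lemma sets_marginal [measurable_cong, simp]: "sets marginal = sets data_space" by (simp add: marginal_def)

text \<open>Reweighting by the residuals multiplies the law of the data by a constant. The whole data process is
  needed here, since the posterior conditions on all of it.\<close>
lemma weighted_data_law:
  assumes F: "finite F" "F \<subseteq> I" and D: "D \<in> sets data_space"
  shows "(\<integral>\<^sup>+z. ennreal (residual_weight F (fst z) (Y z)) * indicator D (Y z) \<partial>\<Pi>) = ennreal (total_weight F) * emeasure marginal D"
proof -
  let ?M1 = "density \<Pi> (\<lambda>z. ennreal (residual_weight F (fst z) (Y z)))"
  let ?M2 = "density \<Pi> (\<lambda>z. ennreal (total_weight F))"
  note [measurable] = D
  note tw = total_weight_bounds[OF F]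
  have "distr ?M1 data_space (\<lambda>z v. Y z v) = distr ?M2 data_space (\<lambda>z v. Y z v)"
  proof (rule linear_process_law_unique)
    show "finite_measure ?M1"
    proof (rule finite_measureI)
      have "emeasure ?M1 (space ?M1) = (\<integral>\<^sup>+z. ennreal (residual_weight F (fst z) (Y z)) \<partial>\<Pi>)"
        unfolding space_density by (subst emeasure_density[OF _ sets.top]) (auto intro!: nn_integral_cong)
      also have "\<dots> < \<infinity>" using order_le_less_trans[OF residual_moment[OF F] ennreal_less_top] by simp
      finally show "emeasure ?M1 (space ?M1) \<noteq> \<infinity>" by simp
    qed
    show "finite_measure ?M2"
    proof (rule finite_measureI)
      have "emeasure ?M2 (space ?M2) = (\<integral>\<^sup>+z. ennreal (total_weight F) \<partial>\<Pi>)"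
        unfolding space_density by (subst emeasure_density[OF _ sets.top]) (auto intro!: nn_integral_cong)
      thus "emeasure ?M2 (space ?M2) \<noteq> \<infinity>" by (simp add: QP.emeasure_space_1)
    qed
    fix u
    have "(CLINT z|?M1. iexp (Y z u)) = (CLINT z|\<Pi>. residual_weight F (fst z) (Y z) *\<^sub>R iexp (Y z u))"
      by (subst integral_density) (auto simp: residual_weight_pos)
    also have "\<dots> = (CLINT z|?M2. iexp (Y z u))"
      unfolding weighted_data_char[OF F] using tw(1) by (subst integral_density) auto
    finally show "(CLINT z|?M1. iexp (Y z u)) = (CLINT z|?M2. iexp (Y z u))" .
  next
    fix F' t assume F': "finite (F' :: 'b set)"
    show "AE z in ?M1. Y z (\<Sum>v\<in>F'. t v *\<^sub>R v) = (\<Sum>v\<in>F'. t v * Y z v)"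
      using Y_linear[OF F', of t] by (subst AE_density) (auto elim!: eventually_mono)
    show "AE z in ?M2. Y z (\<Sum>v\<in>F'. t v *\<^sub>R v) = (\<Sum>v\<in>F'. t v * Y z v)"
      using Y_linear[OF F', of t] by (subst AE_density) (auto elim!: eventually_mono)
  qed auto
  hence eq: "emeasure (distr ?M1 data_space Y) D = emeasure (distr ?M2 data_space Y) D" by (simp only: eta_contract_eq)
  have "emeasure (distr (density \<Pi> k) data_space Y) D = (\<integral>\<^sup>+z. k z * indicator D (Y z) \<partial>\<Pi>)"
    if "k \<in> borel_measurable \<Pi>" for k
  proof -
    have "Y \<in> measurable (density \<Pi> k) data_space"
      using Y_measurable by (simp cong: measurable_cong_sets)
    hence "emeasure (distr (density \<Pi> k) data_space Y) D = emeasure (density \<Pi> k) (Y -` D \<inter> space \<Pi>)"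
      using D by (subst emeasure_distr) simp_all
    also have "\<dots> = (\<integral>\<^sup>+z. k z * indicator (Y -` D \<inter> space \<Pi>) z \<partial>\<Pi>)"
      by (rule emeasure_density[OF that measurable_sets[OF Y_measurable D]])
    also have "\<dots> = (\<integral>\<^sup>+z. k z * indicator D (Y z) \<partial>\<Pi>)"
      by (intro nn_integral_cong) (auto split: split_indicator)
    finally show ?thesis .
  qed
  from eq[unfolded this[OF measurable_compose[OF residual_weight_Y_measurable measurable_ennreal]] this[OF borel_measurable_const]]
  have "(\<integral>\<^sup>+z. ennreal (residual_weight F (fst z) (Y z)) * indicator D (Y z) \<partial>\<Pi>) =
     (\<integral>\<^sup>+z. ennreal (total_weight F) * indicator D (Y z) \<partial>\<Pi>)" .
  also have "\<dots> = ennreal (total_weight F) * (\<integral>\<^sup>+z. indicator D (Y z) \<partial>\<Pi>)"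
    by (intro nn_integral_cmult) measurable
  also have "(\<integral>\<^sup>+z. indicator D (Y z) \<partial>\<Pi>) = emeasure marginal D"
    unfolding marginal_def by (subst nn_integral_indicator[symmetric], simp, subst nn_integral_distr) auto
  finally show ?thesis .
qed

end

section \<open>The posterior\<close>

context gaussian_posterior
begin

lemma kernel: "\<kappa> \<in> measurable data_space (prob_algebra borel)"
  using posterior by (simp add: is_posterior_def)

lemma kernel_subprob [measurable]: "\<kappa> \<in> measurable data_space (subprob_algebra borel)"
  by (rule measurable_prob_algebraD[OF kernel])

lemma kernel_prob: "y \<in> space data_space \<Longrightarrow> prob_space (\<kappa> y)"
  and kernel_sets: "y \<in> space data_space \<Longrightarrow> sets (\<kappa> y) = sets borel"
  using measurable_space[OF kernel] by (auto simp: space_prob_algebra)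

definition joint :: "('a \<times> ('b \<Rightarrow> real)) measure" where
  "joint = distr \<Pi> (borel \<Otimes>\<^sub>M data_space) (\<lambda>z. (fst z, Y z))"

definition posterior_slice :: "('b \<Rightarrow> real) \<Rightarrow> ('a \<times> ('b \<Rightarrow> real)) measure" where
  "posterior_slice y = distr (\<kappa> y) (borel \<Otimes>\<^sub>M data_space) (\<lambda>f. (f, y))"

lemma pair_Y_measurable [measurable]: "(\<lambda>z. (fst z, Y z)) \<in> measurable \<Pi> (borel \<Otimes>\<^sub>M data_space)"
proof -
  have [measurable]: "fst \<in> measurable \<Pi> borel"
    using measurable_fst[of Q P] by (simp cong: measurable_cong_sets)
  show ?thesis by measurable
qed

lemma posterior_slice_measurable [measurable]: "posterior_slice \<in> measurable marginal (subprob_algebra (borel \<Otimes>\<^sub>M data_space))"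
proof -
  have "(\<lambda>y. distr (\<kappa> y) (borel \<Otimes>\<^sub>M data_space) (\<lambda>f. (f, y))) \<in> measurable data_space (subprob_algebra (borel \<Otimes>\<^sub>M data_space))"
    by (rule measurable_distr2[OF _ kernel_subprob]) measurable
  thus ?thesis by (simp add: posterior_slice_def[abs_def] cong: measurable_cong_sets)
qed

text \<open>The defining property of the posterior concerns rectangles; as an identity of measures it can be
  integrated against functions of parameter and data.\<close>
lemma joint_disintegration: "joint = marginal \<bind> posterior_slice"
proof (rule measure_eqI_generator_eq)
  let ?E = "{B \<times> D |B D. B \<in> sets (borel :: 'a measure) \<and> D \<in> sets (data_space :: ('b \<Rightarrow> real) measure)}"
  show "Int_stable ?E" by (rule Int_stable_pair_measure_generator)
  show "?E \<subseteq> Pow (space borel \<times> space data_space)" using sets.sets_into_space by fastforce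
  show "sets joint = sigma_sets (space borel \<times> space data_space) ?E"
    by (simp add: joint_def sets_pair_measure)
  have sp_marginal: "space marginal \<noteq> {}" by (rule marginal.not_empty)
  have sb: "sets (marginal \<bind> posterior_slice) = sets (borel \<Otimes>\<^sub>M data_space)"
    by (rule sets_bind[OF _ sp_marginal]) (simp add: posterior_slice_def)
  show "sets (marginal \<bind> posterior_slice) = sigma_sets (space borel \<times> space data_space) ?E"
    unfolding sb by (simp add: sets_pair_measure)
  show "range (\<lambda>_::nat. space borel \<times> space data_space) \<subseteq> ?E"
    using sets.top[of "borel :: 'a measure"] sets.top[of "data_space :: ('b \<Rightarrow> real) measure"] by blast
  show "(\<Union>i::nat. space borel \<times> space data_space) = space borel \<times> space data_space" by simp
  show "emeasure joint (space borel \<times> space data_space) \<noteq> \<infinity>" for i :: nat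
  proof -
    interpret j: prob_space joint unfolding joint_def by (rule QP.prob_space_distr) measurable
    show ?thesis using j.emeasure_finite by simp
  qed
  fix X assume "X \<in> ?E"
  then obtain B D where X: "X = B \<times> D" and B: "B \<in> sets borel" and D: "D \<in> sets data_space" by blast
  note [measurable] = B D
  have Xs: "X \<in> sets (borel \<Otimes>\<^sub>M data_space)" unfolding X by measurable
  have spQP: "(case z of (f, w) \<Rightarrow> u f w) = u (fst z) (snd z)" for z :: "'a \<times> 'w" and u :: "'a \<Rightarrow> 'w \<Rightarrow> ennreal"
    by (cases z) simp
  have "emeasure joint X = emeasure \<Pi> {(f, w) \<in> space \<Pi>. f \<in> B \<and> obs f w \<in> D}"
    unfolding joint_def by (subst emeasure_distr[OF pair_Y_measurable Xs])
      (auto intro!: arg_cong[where f="emeasure \<Pi>"] simp: X Y_def)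
  also have "\<dots> = (\<integral>\<^sup>+z. indicator D (Y z) * emeasure (\<kappa> (Y z)) B \<partial>\<Pi>)"
    using posterior B D unfolding is_posterior_def by (simp add: Y_def split_beta')
  also have "\<dots> = (\<integral>\<^sup>+y. indicator D y * emeasure (\<kappa> y) B \<partial>marginal)"
  proof -
    have [measurable]: "(\<lambda>y. emeasure (\<kappa> y) B) \<in> borel_measurable data_space"
      by (rule measurable_emeasure_kernel[OF kernel_subprob B])
    show ?thesis unfolding marginal_def by (subst nn_integral_distr) measurable
  qed
  also have "\<dots> = (\<integral>\<^sup>+y. emeasure (posterior_slice y) X \<partial>marginal)"
  proof (intro nn_integral_cong)
    fix y assume "y \<in> space marginal"
    hence y: "y \<in> space data_space" by (simp add: marginal_def)
    have m: "(\<lambda>f. (f, y)) \<in> measurable (\<kappa> y) (borel \<Otimes>\<^sub>M data_space)"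
      using y kernel_sets[OF y] by (simp cong: measurable_cong_sets)
    have sp: "space (\<kappa> y) = UNIV" using sets_eq_imp_space_eq[OF kernel_sets[OF y]] by simp
    show "indicator D y * emeasure (\<kappa> y) B = emeasure (posterior_slice y) X"
      unfolding posterior_slice_def emeasure_distr[OF m Xs] by (auto simp: X sp vimage_def split: split_indicator)
  qed
  also have "\<dots> = emeasure (marginal \<bind> posterior_slice) X"
    by (rule emeasure_bind[OF sp_marginal posterior_slice_measurable Xs, symmetric])
  finally show "emeasure joint X = emeasure (marginal \<bind> posterior_slice) X" .
qed

text \<open>Integrated over an event of the data, both sides agree by independence, and a density is unique up
  to null sets.\<close>
lemma posterior_weight:
  assumes F: "finite F" "F \<subseteq> I"
  shows "AE y in marginal. (\<integral>\<^sup>+f. ennreal (residual_weight F f y) \<partial>\<kappa> y) = ennreal (total_weight F)"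
proof -
  let ?R = "\<lambda>z. ennreal (residual_weight F (fst z) (snd z))"
  define H where "H y = (\<integral>\<^sup>+f. ennreal (residual_weight F f y) \<partial>\<kappa> y)" for y
  have R [measurable]: "?R \<in> borel_measurable (borel \<Otimes>\<^sub>M data_space)" by measurable
  have Hd: "(\<integral>\<^sup>+z. ?R z * indicator D (snd z) \<partial>posterior_slice y) = H y * indicator D y"
    if y: "y \<in> space data_space" and [measurable]: "D \<in> sets data_space" for y D
  proof -
    have m: "(\<lambda>f. (f, y)) \<in> measurable (\<kappa> y) (borel \<Otimes>\<^sub>M data_space)"
      using y kernel_sets[OF y] by (simp cong: measurable_cong_sets)
    have "(\<integral>\<^sup>+z. ?R z * indicator D (snd z) \<partial>posterior_slice y) = (\<integral>\<^sup>+f. ennreal (residual_weight F f y) * indicator D y \<partial>\<kappa> y)"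
      unfolding posterior_slice_def by (subst nn_integral_distr[OF m]) simp_all
    thus ?thesis unfolding H_def by (cases "y \<in> D") simp_all
  qed
  have Hm [measurable]: "H \<in> borel_measurable marginal"
  proof -
    have "(\<lambda>y. \<integral>\<^sup>+z. ?R z \<partial>posterior_slice y) \<in> borel_measurable marginal"
      by (rule measurable_compose[OF posterior_slice_measurable nn_integral_measurable_subprob_algebra[OF R]])
    moreover have "(\<integral>\<^sup>+z. ?R z \<partial>posterior_slice y) = H y" if "y \<in> space marginal" for y
    proof -
      have y: "y \<in> space data_space" using that by (simp add: marginal_def)
      have "(\<integral>\<^sup>+z. ?R z \<partial>posterior_slice y) = (\<integral>\<^sup>+z. ?R z * indicator (space data_space) (snd z) \<partial>posterior_slice y)"
        by (intro nn_integral_cong) (auto simp: posterior_slice_def space_pair_measure)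
      thus ?thesis using Hd[OF y sets.top] y by simp
    qed
    ultimately show ?thesis by (simp cong: measurable_cong)
  qed
  have "density marginal H = density marginal (\<lambda>_. ennreal (total_weight F))"
  proof (rule measure_eqI)
    fix D assume "D \<in> sets (density marginal H)"
    hence D [measurable]: "D \<in> sets data_space" by simp
    have "emeasure (density marginal H) D = (\<integral>\<^sup>+y. H y * indicator D y \<partial>marginal)"
      by (subst emeasure_density) auto
    also have "\<dots> = (\<integral>\<^sup>+y. \<integral>\<^sup>+z. ?R z * indicator D (snd z) \<partial>posterior_slice y \<partial>marginal)"
      by (intro nn_integral_cong Hd[symmetric]) (auto simp: marginal_def)
    also have "\<dots> = (\<integral>\<^sup>+z. ?R z * indicator D (snd z) \<partial>joint)"
      unfolding joint_disintegration by (rule nn_integral_bind[OF _ posterior_slice_measurable, symmetric]) measurable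
    also have "\<dots> = (\<integral>\<^sup>+z. ennreal (residual_weight F (fst z) (Y z)) * indicator D (Y z) \<partial>\<Pi>)"
      unfolding joint_def by (subst nn_integral_distr[OF pair_Y_measurable]) simp_all
    also have "\<dots> = ennreal (total_weight F) * emeasure marginal D" by (rule weighted_data_law[OF F D])
    also have "\<dots> = emeasure (density marginal (\<lambda>_. ennreal (total_weight F))) D"
      by (subst emeasure_density) (auto simp: nn_integral_cmult_indicator)
    finally show "emeasure (density marginal H) D = emeasure (density marginal (\<lambda>_. ennreal (total_weight F))) D" .
  qed simp
  from marginal.density_unique[OF Hm borel_measurable_const this] show ?thesis by (simp add: H_def)
qed

text \<open>A set of data that is null for the mixture over the prior is null for some parameter, hence by the
  Cameron-Martin formula for pure noise, hence for every parameter.\<close>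
lemma data_law_absolutely_continuous:
  assumes X: "X \<in> sets data_space" and null: "emeasure marginal X = 0"
  shows "AE w in P. obs f w \<notin> X"
proof -
  note [measurable] = X
  have tm [measurable]: "tilt W h \<in> borel_measurable P" for h by (rule noise_tilt(2)[OF noise])
  have cm: "emeasure (distr P data_space (obs f')) X = 0 \<longleftrightarrow> (AE w in P. obs 0 w \<notin> X)" for f'
  proof -
    let ?t = "tilt W ((1 / \<sigma>) *\<^sub>R A f')"
    have "emeasure (distr P data_space (obs f')) X = (\<integral>\<^sup>+w. ennreal (?t w) * indicator X (obs 0 w) \<partial>P)"
      by (subst cameron_martin[where A = A and z = 0, OF noise sigma_pos linear_0[OF linear_A]],
          subst emeasure_distr, measurable, subst emeasure_density)
        (auto intro!: nn_integral_cong split: split_indicator)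
    also have "\<dots> = 0 \<longleftrightarrow> (AE w in P. ennreal (?t w) * indicator X (obs 0 w) = 0)"
      by (intro nn_integral_0_iff_AE) measurable
    also have "\<dots> \<longleftrightarrow> (AE w in P. obs 0 w \<notin> X)"
      by (intro AE_cong) (auto simp: tilt_def split: split_indicator)
    finally show ?thesis .
  qed
  have dist: "emeasure (distr P data_space (obs f')) X = 0 \<longleftrightarrow> (AE w in P. obs f' w \<notin> X)" for f'
  proof -
    have "{w \<in> space P. \<not> obs f' w \<notin> X} = obs f' -` X \<inter> space P" by auto
    from AE_iff_measurable[OF measurable_sets[OF obs_measurable X] this]
    show ?thesis using emeasure_distr[OF obs_measurable X, of f'] by simp
  qed
  have "AE y in marginal. y \<notin> X" using null X by (intro AE_not_in) (auto simp: null_sets_def)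
  hence "AE z in \<Pi>. Y z \<notin> X" unfolding marginal_def by (subst (asm) AE_distr_iff) auto
  hence "AE f' in Q. AE w in P. Y (f', w) \<notin> X" by (rule QP.AE_pair)
  moreover have "(AE w in P. Y (f', w) \<notin> X) \<longleftrightarrow> (AE w in P. obs 0 w \<notin> X)" for f'
    using cm[of f'] dist[of f'] by (simp only: Y_def fst_conv snd_conv)
  ultimately have "AE f' in Q. AE w in P. obs 0 w \<notin> X" by simp
  hence "AE w in P. obs 0 w \<notin> X" by simp
  thus ?thesis using cm[of f] dist[of f] by (simp only:)
qed

lemma posterior_weight_true_law:
  "AE w in P. \<forall>n. (\<integral>\<^sup>+h. ennreal (residual_weight (sect n) h (obs f w)) \<partial>\<kappa> (obs f w)) = ennreal (total_weight (sect n))"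
proof -
  have "AE y in marginal. \<forall>n. (\<integral>\<^sup>+h. ennreal (residual_weight (sect n) h y) \<partial>\<kappa> y) = ennreal (total_weight (sect n))"
    unfolding AE_all_countable by (intro allI posterior_weight) auto
  then obtain X where X: "{y \<in> space marginal. \<not> (\<forall>n. (\<integral>\<^sup>+h. ennreal (residual_weight (sect n) h y) \<partial>\<kappa> y) = ennreal (total_weight (sect n)))} \<subseteq> X"
    "emeasure marginal X = 0" "X \<in> sets marginal" by (rule AE_E)
  have "AE w in P. obs f w \<notin> X" using X by (intro data_law_absolutely_continuous) auto
  with AE_space show ?thesis
  proof eventually_elim
    case (elim w)
    have "obs f w \<in> space marginal" using measurable_space[OF obs_measurable elim(1)] by (simp add: marginal_def)
    thus ?case using X(1) elim(2) by blast
  qed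
qed

text \<open>On the quiet event the estimator is close to the truth, so a parameter far from the truth has large
  residual energy in some finite section; there the Chernoff bound applies to the posterior itself.\<close>
lemma posterior_mass:
  assumes w: "w \<in> quiet" and f: "f \<in> ellipsoid G M"
    and H: "\<forall>n. (\<integral>\<^sup>+h. ennreal (residual_weight (sect n) h (obs f w)) \<partial>\<kappa> (obs f w)) = ennreal (total_weight (sect n))"
    and r: "2 * energy + 2 * loss_level \<le> r"
  shows "measure (\<kappa> (obs f w)) {h. (norm (h - f))\<^sup>2 > r} \<le> exp (- real J)"
proof -
  let ?y = "obs f w"
  have y: "?y \<in> space data_space"
    using measurable_space[OF obs_measurable] w by (auto simp: quiet_def)
  interpret K: prob_space "\<kappa> ?y" by (rule kernel_prob[OF y])
  have sK [measurable_cong, simp]: "sets (\<kappa> ?y) = sets borel" by (rule kernel_sets[OF y])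
  have spK [simp]: "space (\<kappa> ?y) = UNIV" using sets_eq_imp_space_eq[OF sK] by simp
  have [measurable]: "(\<lambda>h. h \<bullet> e j) \<in> borel_measurable (\<kappa> ?y)" for j
    by (simp cong: measurable_cong_sets)
  define B where "B n = {h. (\<Sum>j\<in>sect n. ((h - f) \<bullet> e j)\<^sup>2) > r}" for n
  have Bm: "B n \<in> sets (\<kappa> ?y)" for n
  proof -
    have "{h \<in> space (\<kappa> ?y). (\<Sum>j\<in>sect n. (h \<bullet> e j - f \<bullet> e j)\<^sup>2) > r} \<in> sets (\<kappa> ?y)" by measurable
    thus ?thesis by (simp add: B_def inner_diff_left)
  qed
  have mass: "measure (\<kappa> ?y) (B n) \<le> exp (- real J)" for n
  proof -
    define Z where "Z h = (\<Sum>j\<in>sect n. (h \<bullet> e j - coef j ?y)\<^sup>2)" for h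
    have Zm [measurable]: "Z \<in> borel_measurable (\<kappa> ?y)" unfolding Z_def by measurable
    have "B n \<subseteq> {h \<in> space (\<kappa> ?y). Z h > energy}"
    proof
      fix h assume h: "h \<in> B n"
      have "(\<Sum>j\<in>sect n. ((h - f) \<bullet> e j)\<^sup>2) \<le> (\<Sum>j\<in>sect n. 2 * (h \<bullet> e j - coef j ?y)\<^sup>2 + 2 * (coef j ?y - f \<bullet> e j)\<^sup>2)"
      proof (rule sum_mono)
        fix j
        have "(x + y)\<^sup>2 \<le> 2 * x\<^sup>2 + 2 * y\<^sup>2" for x y :: real
          using zero_le_power2[of "x - y"] by (simp add: power2_eq_square algebra_simps)
        from this[of "h \<bullet> e j - coef j ?y" "coef j ?y - f \<bullet> e j"]
        show "((h - f) \<bullet> e j)\<^sup>2 \<le> 2 * (h \<bullet> e j - coef j ?y)\<^sup>2 + 2 * (coef j ?y - f \<bullet> e j)\<^sup>2"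
          by (simp add: inner_diff_left)
      qed
      also have "\<dots> = 2 * Z h + 2 * (\<Sum>j\<in>sect n. (coef j ?y - f \<bullet> e j)\<^sup>2)"
        unfolding Z_def sum.distrib sum_distrib_left ..
      also have "\<dots> \<le> 2 * Z h + 2 * loss_level" using quiet_coords[OF f w, of n] by simp
      finally show "h \<in> {h \<in> space (\<kappa> ?y). Z h > energy}" using h r by (simp add: B_def)
    qed
    hence "measure (\<kappa> ?y) (B n) \<le> measure (\<kappa> ?y) {h \<in> space (\<kappa> ?y). Z h > energy}"
      by (intro K.finite_measure_mono) measurable
    also have "\<dots> \<le> exp (2 * tilt_rate * (\<Sum>j\<in>sect n. 1 / lam j) - tilt_rate * energy)"
    proof (rule exp_moment_tail[OF K.prob_space_axioms Zm])
      show "0 \<le> tilt_rate" using tilt_rate_pos by simp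
      have "(\<integral>\<^sup>+h. ennreal (exp (tilt_rate * Z h)) \<partial>\<kappa> ?y) = ennreal (total_weight (sect n))"
        using H unfolding residual_weight_def Z_def by blast
      also have "\<dots> \<le> ennreal (exp (2 * tilt_rate * (\<Sum>j\<in>sect n. 1 / lam j)))"
        by (intro ennreal_leI total_weight_bounds) auto
      finally show "(\<integral>\<^sup>+h. ennreal (exp (tilt_rate * Z h)) \<partial>\<kappa> ?y) \<le> ennreal (exp (2 * tilt_rate * (\<Sum>j\<in>sect n. 1 / lam j)))" .
    qed
    also have "\<dots> \<le> exp (- real J)" using tilt_exponent[of "sect n"] by simp
    finally show ?thesis .
  qed
  have "incseq B" unfolding incseq_def
  proof (intro allI impI subsetI)
    fix m n :: nat and h assume mn: "m \<le> n" and h: "h \<in> B m"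
    have "(\<Sum>j\<in>sect m. ((h - f) \<bullet> e j)\<^sup>2) \<le> (\<Sum>j\<in>sect n. ((h - f) \<bullet> e j)\<^sup>2)"
      using sect_mono[OF mn] by (intro sum_mono2) auto
    thus "h \<in> B n" using h by (simp add: B_def)
  qed
  hence lim: "(\<lambda>n. measure (\<kappa> ?y) (B n)) \<longlonglongrightarrow> measure (\<kappa> ?y) (\<Union>n. B n)"
    using Bm by (intro K.finite_Lim_measure_incseq) auto
  have "{h. (norm (h - f))\<^sup>2 > r} \<subseteq> (\<Union>n. B n)"
  proof
    fix h assume "h \<in> {h. (norm (h - f))\<^sup>2 > r}"
    hence "\<not> (\<forall>n. (\<Sum>j\<in>sect n. ((h - f) \<bullet> e j)\<^sup>2) \<le> r)"
      using norm_le_of_coords[of "h - f" r] by (auto simp: not_le[symmetric])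
    thus "h \<in> (\<Union>n. B n)" by (auto simp: B_def not_le)
  qed
  hence "measure (\<kappa> ?y) {h. (norm (h - f))\<^sup>2 > r} \<le> measure (\<kappa> ?y) (\<Union>n. B n)"
    using Bm by (intro K.finite_measure_mono) auto
  also have "\<dots> \<le> exp (- real J)" using lim mass by (intro LIMSEQ_le_const2) auto
  finally show ?thesis .
qed

lemma contraction:
  assumes f: "f \<in> ellipsoid G M" and r: "2 * energy + 2 * loss_level \<le> r"
  shows "measure P {w \<in> space P. measure (\<kappa> (obs f w)) {h. (norm (h - f))\<^sup>2 > r} > exp (- real J)} \<le> exp (- real J)"
proof -
  have "measure P {w \<in> space P. measure (\<kappa> (obs f w)) {h. (norm (h - f))\<^sup>2 > r} > exp (- real J)} \<le> measure P (space P - quiet)"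
  proof (rule P.finite_measure_mono_AE)
    show "AE w in P. w \<in> {w \<in> space P. measure (\<kappa> (obs f w)) {h. (norm (h - f))\<^sup>2 > r} > exp (- real J)} \<longrightarrow> w \<in> space P - quiet"
      using posterior_weight_true_law[of f]
    proof eventually_elim
      case (elim w)
      show ?case using posterior_mass[OF _ f elim r] by (auto simp: not_less[symmetric])
    qed
  qed measurable
  thus ?thesis using quiet_prob by linarith
qed

end

section \<open>Minimax rate and posterior contraction\<close>

theorem theorem4p15:
  fixes I :: "nat set" and g :: "nat \<Rightarrow> real" and C :: real
  assumes "coordinate_set I" and "C \<ge> 1"
    and "\<forall>j\<in>I. g j > 0" and "\<forall>i\<in>I. \<forall>j\<in>I. i \<le> j \<longrightarrow> (g i)\<^sup>2 \<le> (g j)\<^sup>2"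
    and "polynomial_growth I g C"
  shows "\<exists>c1>0. \<exists>c2>0. \<exists>C1>0. \<exists>C2>0. \<exists>C3>0. \<exists>C4>0. \<exists>K1>0. \<exists>K2>0. \<exists>K3>0.
    \<forall>(G :: 'a::{real_inner, polish_space} opr) (S :: 'a opr)
      (A :: 'a \<Rightarrow> 'b::{real_inner, complete_space}) (a :: nat \<Rightarrow> real) (e :: nat \<Rightarrow> 'a)
      (M :: real) (\<sigma> :: real) (J :: nat) (\<mu> :: real)
      (P :: 'w measure) (W :: 'b \<Rightarrow> 'w \<Rightarrow> real).
      operator_assumptions I g a e G S A \<and> M > 0 \<and> \<sigma> > 0 \<and>
      smallest_index I g a M \<sigma> J \<and> \<mu> = real J / M \<and> standard_gaussian_noise P W \<longrightarrow>
      (let R = op_trace I e (op_inverse (F_op A S \<sigma> \<mu>)) in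
        c1 * (M * (1 / (g J)\<^sup>2)) \<le> R \<and> R \<le> c2 * (M * (1 / (g J)\<^sup>2)) \<and>
        nearly_minimax C1 C2 C3 C4 P W A \<sigma> (ellipsoid G M) (penalized_mle I e A S \<sigma> \<mu>) R (M * \<mu>) \<and>
        (\<forall>Q \<kappa>. gaussian_measure 0 (op_inverse (op_scale \<mu> S)) Q \<and> is_posterior Q P W A \<sigma> \<kappa> \<longrightarrow>
          posterior_contraction K1 K2 K3 P W A \<sigma> (ellipsoid G M) \<kappa> R (M * \<mu>)))"
proof -
  interpret polynomial_spectrum I g C
    using assms by unfold_locales auto
  \<comment> \<open>\<open>energy\<close> and \<open>loss_level\<close> divided by \<open>rate\<close>. These constants and the two trace constants are
    fixed before the operators, so they depend on \<open>g\<close> and \<open>C\<close> only.\<close>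
  define en where "en = 2 * (2 * L + C) + 8 * L"
  define ll where "ll = 2 * en + 8 * L"
  define kc1 where "kc1 = 1 / (2 * C)"
  define kc2 where "kc2 = 2 * L + C"
  \<comment> \<open>The cost \<open>amp2\<close> of a sign error times the number of tolerated errors is \<open>rate / (320 C\<^sup>2)\<close>.\<close>
  define kC3 where "kC3 = 1 / (320 * C\<^sup>2 * kc2)"
  have p: "kc1 > 0" "kc2 > 0" "en > 0" "ll > 0" "C > 0"
    using L_ge_1 C1 by (auto simp: kc1_def kc2_def en_def ll_def)
  have p3: "kC3 > 0" using p by (simp add: kC3_def)
  have pos: "ll / kc1 > 0" "1 / (80 * C) > 0" "(2 * en + 2 * ll) / kc1 > 0" "(1 :: real) > 0"
    using p by auto
  have main: "let R = op_trace I e (op_inverse (F_op A S \<sigma> \<mu>')) in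
        kc1 * (M * (1 / (g J)\<^sup>2)) \<le> R \<and> R \<le> kc2 * (M * (1 / (g J)\<^sup>2)) \<and>
        nearly_minimax (ll / kc1) 1 kC3 (1 / (80 * C)) P W A \<sigma> (ellipsoid G M) (penalized_mle I e A S \<sigma> \<mu>') R (M * \<mu>') \<and>
        (\<forall>Q \<kappa>. gaussian_measure 0 (op_inverse (op_scale \<mu>' S)) Q \<and> is_posterior Q P W A \<sigma> \<kappa> \<longrightarrow>
          posterior_contraction ((2 * en + 2 * ll) / kc1) 1 1 P W A \<sigma> (ellipsoid G M) \<kappa> R (M * \<mu>'))"
    if h: "operator_assumptions I g a e G S A \<and> M > 0 \<and> \<sigma> > 0 \<and>
      smallest_index I g a M \<sigma> J \<and> \<mu>' = real J / M \<and> standard_gaussian_noise P W"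
    for G S :: "'a opr" and A :: "'a \<Rightarrow> 'b" and a :: "nat \<Rightarrow> real" and e :: "nat \<Rightarrow> 'a"
      and M \<sigma> :: real and J :: nat and \<mu>' :: real and P :: "'w measure" and W :: "'b \<Rightarrow> 'w \<Rightarrow> real"
  proof -
    interpret gaussian_inverse_problem I g C a M \<sigma> J e G S A P W
      by unfold_locales (use h in \<open>auto simp: operator_assumptions_def\<close>)
    have mu: "\<mu>' = \<mu>" using h by simp
    have n: "M * \<mu>' = real J" using mu M_pos by simp
    define R where "R = op_trace I e (op_inverse (F_op A S \<sigma> \<mu>'))"
    have lo: "kc1 * rate \<le> R" and up: "R \<le> kc2 * rate"
      using trace_lower trace_upper unfolding R_def mu trace_eq by (simp_all add: kc1_def kc2_def trace_const_def)
    have en: "energy = en * rate" by (simp add: energy_def en_def trace_const_def)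
    have ll: "loss_level = ll * rate" by (simp add: loss_level_def ll_def en distrib_right)
    have scale: "x * rate \<le> x / kc1 * R" if "x > 0" for x
    proof -
      have "x / kc1 * (kc1 * rate) \<le> x / kc1 * R" using that p by (intro mult_left_mono lo) auto
      thus ?thesis using p by simp
    qed
    have low: "kC3 * R \<le> amp2 * real (card block) / 40"
    proof -
      have "kC3 * R \<le> kC3 * (kc2 * rate)" using p3 by (intro mult_left_mono up) auto
      also have "\<dots> = rate / (320 * C\<^sup>2)" using p by (simp add: kC3_def)
      also have "\<dots> = amp2 * real (card block) / 40" using block_card(2) p by (auto simp: amp2_def)
      finally show ?thesis .
    qed
    have zero: "0 \<in> ellipsoid G M" using comb_in_ellipsoid[of "{}"] M_pos by simp
    have "nearly_minimax (ll / kc1) 1 kC3 (1 / (80 * C)) P W A \<sigma> (ellipsoid G M) mle R (real J)"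
      unfolding nearly_minimax_def
    proof (intro conjI)
      show "mle \<in> estimators" by (rule mle_measurable)
      show "(SUP f\<in>ellipsoid G M. loss_prob P W A \<sigma> mle f (ll / kc1 * R)) \<le> exp (- 1 * real J)"
      proof (rule cSUP_least)
        fix f assume "f \<in> ellipsoid G M"
        thus "loss_prob P W A \<sigma> mle f (ll / kc1 * R) \<le> exp (- 1 * real J)"
          using mle_upper[of f "ll / kc1 * R"] scale[OF p(4)] ll by simp
      qed (use zero in auto)
      show "1 - exp (- (1 / (80 * C)) * real J) \<le> (INF fhat\<in>estimators. SUP f\<in>ellipsoid G M. loss_prob P W A \<sigma> fhat f (kC3 * R))"
      proof (rule cINF_greatest)
        show "(estimators :: (('b \<Rightarrow> real) \<Rightarrow> 'a) set) \<noteq> {}" using mle_measurable by blast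
        fix fhat :: "('b \<Rightarrow> real) \<Rightarrow> 'a" assume "fhat \<in> estimators"
        from hard_vertex[OF this low] obtain f where f: "f \<in> ellipsoid G M"
          "1 - exp (- (1 / (80 * C)) * real J) \<le> loss_prob P W A \<sigma> fhat f (kC3 * R)" by blast
        have "bdd_above ((\<lambda>f. loss_prob P W A \<sigma> fhat f (kC3 * R)) ` ellipsoid G M)"
          by (rule bdd_aboveI2[of _ _ 1]) (simp add: loss_prob_def)
        thus "1 - exp (- (1 / (80 * C)) * real J) \<le> (SUP f\<in>ellipsoid G M. loss_prob P W A \<sigma> fhat f (kC3 * R))"
          using f by (intro cSUP_upper2)
      qed
    qed
    note minimax = this
    have contr: "posterior_contraction ((2 * en + 2 * ll) / kc1) 1 1 P W A \<sigma> (ellipsoid G M) \<kappa> R (real J)"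
      if "gaussian_measure 0 V Q \<and> is_posterior Q P W A \<sigma> \<kappa>" for Q \<kappa>
    proof -
      interpret gaussian_posterior I g C a M \<sigma> J e G S A P W Q \<kappa>
        by unfold_locales (use that in auto)
      have "2 * energy + 2 * loss_level \<le> (2 * en + 2 * ll) / kc1 * R"
        using scale[of "2 * en + 2 * ll"] p by (simp add: en ll distrib_right)
      from contraction[OF _ this] show ?thesis
        unfolding posterior_contraction_def by simp
    qed
    show ?thesis
      unfolding Let_def R_def[symmetric] n unfolding mu
    proof (intro conjI allI impI)
      show "kc1 * (M * (1 / (g J)\<^sup>2)) \<le> R" "R \<le> kc2 * (M * (1 / (g J)\<^sup>2))"
        using lo up by (simp_all add: rate_def)
      show "nearly_minimax (ll / kc1) 1 kC3 (1 / (80 * C)) P W A \<sigma> (ellipsoid G M) mle R (real J)"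
        by (rule minimax)
    qed (rule contr)
  qed
  show ?thesis
    by (rule exI[of _ kc1], rule conjI[OF p(1)], rule exI[of _ kc2], rule conjI[OF p(2)],
        rule exI[of _ "ll / kc1"], rule conjI[OF pos(1)], rule exI[of _ 1], rule conjI[OF pos(4)],
        rule exI[of _ kC3], rule conjI[OF p3], rule exI[of _ "1 / (80 * C)"], rule conjI[OF pos(2)],
        rule exI[of _ "(2 * en + 2 * ll) / kc1"], rule conjI[OF pos(3)],
        rule exI[of _ 1], rule conjI[OF pos(4)], rule exI[of _ 1], rule conjI[OF pos(4)],
        intro allI impI, rule main)
qed

end
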